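(* Let $f,g\in C^1(\mathbb{R}_+)$ be real-valued and strictly monotone on the support of a measurable function $\chi$ on $\mathbb{R}_+$. Let $\sigma,\tau\in C^0(\mathbb{R}_+)$ be such that, for some $A>0$, we have $$\frac{|\sigma(\rho)|}{|f'(\rho)|^{1/2}}\leq A\,\frac{|\tau(\rho)|}{|g'(\rho)|^{1/2}}\qquad(\mathrm{I})$$ for all $\rho\in\operatorname{supp}\chi$ satisfying $f'(\rho)\neq0$ and $g'(\rho)\neq0$. Then we have $$\left\|\chi(|D_x|)\sigma(|D_x|)e^{itf(|D_x|)}\varphi(x)\right\|_{L^2(\mathbb{R}_t)}\leq A\left\|\chi(|D_x|)\tau(|D_x|)e^{itg(|D_x|)}\varphi(x)\right\|_{L^2(\mathbb{R}_t)}\qquad(\mathrm{II})$$ for all $x\in\mathbb{R}^n$. Consequently, for any measurable function $w$ on $\mathbb{R}^n$, we have $$\left\|w(x)\chi(|D_x|)\sigma(|D_x|)e^{itf(|D_x|)}\varphi(x)\right\|_{L^2(\mathbb{R}_t\times\mathbb{R}^n_x)}\leq A\left\|w(x)\chi(|D_x|)\tau(|D_x|)e^{itg(|D_x|)}\varphi(x)\right\|_{L^2(\mathbb{R}_t\times\mathbb{R}^n_x)}.\qquad(\mathrm{III})$$ Moreover, if $\chi\in C^0(\mathbb{R}_+)$ and $w\neq0$ on a set of $\mathbb{R}^n$ with positive measure, the converse is true, namely, if we have estimate (II) for all $\varphi$, for some $x\in\mathbb{R}^n$, or if we have estimate (III) for all $\varphi$, and the norms are finite, then we also have inequality (I) (for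 all $\rho\in\operatorname{supp}\chi$ satisfying $f'(\rho)\neq0$ and $g'(\rho)\neq0$).
   Context: Notation: $\mathbb{R}_+=(0,\infty)$. $D_x=(D_1,\ldots,D_n)$ with $D_j=\frac1i\frac{\partial}{\partial x_j}$. For a function $a$ on $\mathbb{R}_+$, $a(|D_x|)$ denotes the Fourier multiplier on $\mathbb{R}^n$ with symbol $a(|\xi|)$, i.e. $a(|D_x|)\varphi(x)=(2\pi)^{-n}\int_{\mathbb{R}^n}e^{ix\cdot\xi}a(|\xi|)\widehat\varphi(\xi)\,d\xi$ with $\widehat\varphi(\xi)=\int_{\mathbb{R}^n}e^{-ix\cdot\xi}\varphi(x)\,dx$. The function $\varphi$ on $\mathbb{R}^n$ is an arbitrary initial datum (the paper does not specify its class). In (II) the point $x$ is fixed and the norms are taken in $t$ only.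
   Formalization: (II) and (III) are proved for φ in L¹ with both symbols times φ̂ in L¹, and with f' and g' nonzero at almost every frequency where χ(|ξ|)φ̂(ξ) ≠ 0; without this last condition the claim fails when f' vanishes on a positive-measure subset of supp χ. *)

theory Defs
  imports "HOL-Analysis.Analysis"
begin

text \<open>Functions on \<open>(0,\<infinity>)\<close> are rendered as total functions on \<^typ>\<open>real\<close> whose values on \<open>{..0}\<close>
  are irrelevant: multipliers only see them through \<open>norm \<xi>\<close>, which is positive off a null set.\<close>

definition fourier :: "(real^'n \<Rightarrow> complex) \<Rightarrow> real^'n \<Rightarrow> complex" where
  "fourier \<phi> \<xi> = (LINT x|lebesgue. exp (- \<i> * complex_of_real (x \<bullet> \<xi>)) * \<phi> x)"

text \<open>\<open>a(|D\<^sub>x|)\<phi>\<close>.\<close>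

definition radial_multiplier ::
    "(real \<Rightarrow> complex) \<Rightarrow> (real^'n \<Rightarrow> complex) \<Rightarrow> real^'n \<Rightarrow> complex" where
  "radial_multiplier a \<phi> x =
     complex_of_real (1 / (2 * pi) ^ CARD('n)) *
     (LINT \<xi>|lebesgue. exp (\<i> * complex_of_real (x \<bullet> \<xi>)) * a (norm \<xi>) * fourier \<phi> \<xi>)"

text \<open>\<open>chi(|D\<^sub>x|) \<sigma>(|D\<^sub>x|) exp(i t f(|D\<^sub>x|)) \<phi>(x)\<close>; the composition of multipliers is
  the multiplier with the product symbol.\<close>

definition evolution ::
    "(real \<Rightarrow> complex) \<Rightarrow> (real \<Rightarrow> complex) \<Rightarrow> (real \<Rightarrow> real) \<Rightarrow> (real^'n \<Rightarrow> complex)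
      \<Rightarrow> real \<Rightarrow> real^'n \<Rightarrow> complex" where
  "evolution chi \<sigma> f \<phi> t x =
     radial_multiplier (\<lambda>\<rho>. chi \<rho> * \<sigma> \<rho> * exp (\<i> * complex_of_real (t * f \<rho>))) \<phi> x"

text \<open>The extended \<open>L\<^sup>2\<close> norm: it is \<open>\<infinity>\<close> when the function is not square integrable.\<close>

definition L2_ennorm :: "('a::euclidean_space \<Rightarrow> complex) \<Rightarrow> ennreal" where
  "L2_ennorm u =
     (let I = (\<integral>\<^sup>+ z. ennreal ((cmod (u z))\<^sup>2) \<partial>lebesgue)
      in if I = \<infinity> then \<infinity> else ennreal (sqrt (enn2real I)))"

definition time_norm ::
    "(real \<Rightarrow> complex) \<Rightarrow> (real \<Rightarrow> complex) \<Rightarrow> (real \<Rightarrow> real) \<Rightarrow> (real^'n \<Rightarrow> complex)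
      \<Rightarrow> real^'n \<Rightarrow> ennreal" where
  "time_norm chi \<sigma> f \<phi> x = L2_ennorm (\<lambda>t. evolution chi \<sigma> f \<phi> t x)"

definition spacetime_norm ::
    "(real^'n \<Rightarrow> complex) \<Rightarrow> (real \<Rightarrow> complex) \<Rightarrow> (real \<Rightarrow> complex) \<Rightarrow> (real \<Rightarrow> real)
      \<Rightarrow> (real^'n \<Rightarrow> complex) \<Rightarrow> ennreal" where
  "spacetime_norm w chi \<sigma> f \<phi> = L2_ennorm (\<lambda>(t, x). w x * evolution chi \<sigma> f \<phi> t x)"

text \<open>Support relative to \<open>(0,\<infinity>)\<close>.\<close>

definition supp_pos :: "(real \<Rightarrow> complex) \<Rightarrow> real set" where
  "supp_pos chi = {0<..} \<inter> closure {\<rho>. 0 < \<rho> \<and> chi \<rho> \<noteq> 0}"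

definition strictly_monotone_on :: "real set \<Rightarrow> (real \<Rightarrow> real) \<Rightarrow> bool" where
  "strictly_monotone_on S f \<longleftrightarrow> strict_mono_on S f \<or> strict_antimono_on S f"

definition symbol_comparison ::
    "(real \<Rightarrow> complex) \<Rightarrow> (real \<Rightarrow> complex) \<Rightarrow> (real \<Rightarrow> complex) \<Rightarrow> (real \<Rightarrow> real) \<Rightarrow> (real \<Rightarrow> real)
      \<Rightarrow> real \<Rightarrow> bool" where
  "symbol_comparison chi \<sigma> \<tau> f g A \<longleftrightarrow>
     (\<forall>\<rho> \<in> supp_pos chi. deriv f \<rho> \<noteq> 0 \<and> deriv g \<rho> \<noteq> 0 \<longrightarrow>
        cmod (\<sigma> \<rho>) / sqrt \<bar>deriv f \<rho>\<bar> \<le> A * (cmod (\<tau> \<rho>) / sqrt \<bar>deriv g \<rho>\<bar>))"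

text \<open>The initial data for which both sides of the estimates are defined by absolutely convergent
  integrals. The last condition only matters when \<open>f'\<close> or \<open>g'\<close> vanishes on a subset of
  \<open>{chi \<noteq> 0}\<close> of positive measure (otherwise it holds for every \<open>\<phi>\<close>). It cannot be dropped: let
  \<open>K\<close> be a compact nowhere dense subset of \<open>(0,\<infinity>)\<close> of positive measure, \<open>chi\<close> its indicator
  function, \<open>\<sigma> = \<tau> = 1\<close>, \<open>g(\<rho>) = \<rho>\<close> and \<open>f(\<rho>)\<close> the integral of \<open>dist(s, K)\<close> over
  \<open>s\<close> in \<open>(0, \<rho>)\<close>. Then \<open>f\<close> is \<open>C\<^sup>1\<close> and strictly increasing and
  \<open>symbol_comparison\<close> is vacuous, but for \<open>\<phi>\<close> with positive Fourier transform
  \<open>time_norm chi \<sigma> f \<phi> 0\<close> is the norm of the Fourier transform of a nonzero singular measure,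
  hence infinite, whereas \<open>time_norm chi \<tau> g \<phi> 0\<close> is finite.\<close>

definition admissible_datum ::
    "(real \<Rightarrow> complex) \<Rightarrow> (real \<Rightarrow> complex) \<Rightarrow> (real \<Rightarrow> complex) \<Rightarrow> (real \<Rightarrow> real) \<Rightarrow> (real \<Rightarrow> real)
      \<Rightarrow> (real^'n \<Rightarrow> complex) \<Rightarrow> bool" where
  "admissible_datum chi \<sigma> \<tau> f g \<phi> \<longleftrightarrow>
     integrable lebesgue \<phi> \<and>
     integrable lebesgue (\<lambda>\<xi>. chi (norm \<xi>) * \<sigma> (norm \<xi>) * fourier \<phi> \<xi>) \<and>
     integrable lebesgue (\<lambda>\<xi>. chi (norm \<xi>) * \<tau> (norm \<xi>) * fourier \<phi> \<xi>) \<and>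
     (AE \<xi> in lebesgue. chi (norm \<xi>) * fourier \<phi> \<xi> \<noteq> 0 \<longrightarrow>
        deriv f (norm \<xi>) \<noteq> 0 \<and> deriv g (norm \<xi>) \<noteq> 0)"

text \<open>Data whose Fourier transform has compact support away from the origin and from the critical
  frequencies. Finiteness of the norms in the converse is required for these data only: over
  all admissible data it would typically fail, e.g. for smooth \<open>f\<close> as soon as \<open>f'\<close> has a zero at
  which \<open>chi \<sigma>\<close> does not vanish.\<close>

definition localized_datum ::
    "(real \<Rightarrow> complex) \<Rightarrow> (real \<Rightarrow> complex) \<Rightarrow> (real \<Rightarrow> complex) \<Rightarrow> (real \<Rightarrow> real) \<Rightarrow> (real \<Rightarrow> real)
      \<Rightarrow> (real^'n \<Rightarrow> complex) \<Rightarrow> bool" where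
  "localized_datum chi \<sigma> \<tau> f g \<phi> \<longleftrightarrow>
     admissible_datum chi \<sigma> \<tau> f g \<phi> \<and>
     compact (closure {\<xi>. fourier \<phi> \<xi> \<noteq> 0}) \<and>
     (\<forall>\<xi> \<in> closure {\<xi>. fourier \<phi> \<xi> \<noteq> 0}.
        \<xi> \<noteq> 0 \<and> deriv f (norm \<xi>) \<noteq> 0 \<and> deriv g (norm \<xi>) \<noteq> 0)"

end

theory Submission
  imports Defs "HOL-Probability.Probability"
begin

text \<open>
Fix \<open>x\<close> and put \<open>H(\<xi>) = exp(i x \<bullet> \<xi>) chi(|\<xi>|) (|\<sigma>(|\<xi>|)| + |\<tau>(|\<xi>|)|) F(\<xi>)\<close>, where \<open>F\<close> is the Fourier
transform of \<open>\<phi>\<close>. Up to the factor \<open>(2 \<pi>)\<^sup>-\<^sup>n\<close>, the two evolutions at \<open>x\<close> are the integrals of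
\<open>H(\<xi>) \<theta>(|\<xi>|) exp(i t f(|\<xi>|))\<close> with \<open>\<theta> = \<sigma> / (|\<sigma>| + |\<tau>|)\<close>, and of the same expression with \<open>\<tau>\<close>, \<open>g\<close> in place
of \<open>\<sigma>\<close>, \<open>f\<close>. The map \<open>\<xi> \<mapsto> |\<xi>|\<close> pushes the complex measure \<open>H d\<xi>\<close> forward to a measure on the half-line
that has a density \<open>M\<close> (\<open>radial_density\<close>), and this profile \<open>M\<close> is common to both flows. The substitution
\<open>s = f(\<rho>)\<close> then exhibits the evolution as the Fourier transform, at time \<open>t\<close>, of the function whose value at
\<open>f(\<rho>)\<close> is \<open>M(\<rho>) \<theta>(\<rho>) / |f'(\<rho>)|\<close>, and Plancherel's identity gives (\<open>oscillatory_plancherel\<close>,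
\<open>evolution_L2\<close>)

  squared norm in \<open>t\<close> = \<open>(2 \<pi>)\<^sup>1\<^sup>-\<^sup>2\<^sup>n\<close> times the integral of \<open>|M|\<^sup>2 |\<theta>|\<^sup>2 / |f'|\<close>.

The amplitude of an admissible datum lives on noncritical frequencies, where the hypothesis on the symbols
applies. Squared and divided by \<open>(|\<sigma>| + |\<tau>|)\<^sup>2\<close>, it is the pointwise
comparison of the two densities. Integration proves the estimate in time, and Tonelli's theorem (\<open>spacetime_energy\<close>) the one in
space-time. Squared norms may be infinite, so Plancherel's identity is needed for every integrable function,
as an identity in \<open>[0, \<infinity>]\<close> (\<open>plancherel_L1\<close>).

For the converse, suppose that the comparison of the symbols fails. By continuity the opposite strict
inequality holds on a compact interval \<open>J\<close> on which \<open>chi\<close>, \<open>f'\<close> and \<open>g'\<close> do not vanish. Let \<open>F\<close> be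
\<open>exp(- i x0 \<bullet> \<xi>) b(\<xi>)\<close> with a bump \<open>b \<ge> 0\<close> supported where \<open>|\<xi>| \<in> J\<close>. Both energies are finite, and the
formula above yields the opposite strict inequality at \<open>x\<close> unless the profile vanishes almost everywhere
(\<open>amplitude_moments_vanish\<close>). In that case every radial moment of \<open>H\<close> vanishes, among them the integral of
\<open>exp(i (x - x0) \<bullet> \<xi>) b(\<xi>)\<close>; but this integral is nonzero for \<open>x\<close> in a ball around \<open>x0\<close> whose radius \<open>r\<close> depends
on \<open>b\<close> only (\<open>localized_test_data\<close>). With \<open>x0 = x\<close> this contradicts the estimate in time. The estimate in
space-time forces \<open>w = 0\<close> almost everywhere on the ball of radius \<open>r\<close> around every \<open>x0\<close>; countably many such
balls cover the space.
\<close>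

section \<open>The Fourier transform on the line and Gaussian mollification\<close>

definition ft :: "(real \<Rightarrow> complex) \<Rightarrow> real \<Rightarrow> complex" where
  "ft h t = (LINT s|lborel. iexp (t * s) * h s)"

lemma integrable_iexp_mult [simp]:
  fixes h :: "real \<Rightarrow> complex"
  assumes "integrable lborel h"
  shows "integrable lborel (\<lambda>s. iexp (t * s) * h s)"
  using assms by (rule Bochner_Integration.integrable_bound) (use assms in \<open>auto simp: norm_mult\<close>)

lemma norm_ft_le: "cmod (ft h t) \<le> (LINT s|lborel. cmod (h s))"
  unfolding ft_def by (rule order_trans[OF integral_norm_bound]) (simp add: norm_mult)

lemma isCont_ft: "integrable lborel h \<Longrightarrow> isCont (ft h) t"
  unfolding ft_def continuous_at_sequentially comp_def
  apply safe
  apply (rule integral_dominated_convergence[where w="\<lambda>s. cmod (h s)"])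
  by (auto intro!: tendsto_intros simp: norm_mult)

lemma continuous_ft: "integrable lborel h \<Longrightarrow> continuous_on UNIV (ft h)"
  by (simp add: continuous_on_eq_continuous_at isCont_ft)

lemma borel_measurable_ft [measurable]: "integrable lborel h \<Longrightarrow> ft h \<in> borel_measurable borel"
  by (rule borel_measurable_continuous_onI[OF continuous_ft])

text \<open>Fubini's theorem. Suitable choices of \<open>a\<close> and \<open>b\<close> give the mollification formula and the pairing behind
Plancherel's identity.\<close>

lemma ft_multiplication_formula:
  assumes a: "integrable lborel a" and b: "integrable lborel b"
  shows "(LINT t|lborel. ft a t * b t) = (LINT s|lborel. a s * ft b s)"
proof -
  note [measurable] = borel_measurable_integrable[OF a] borel_measurable_integrable[OF b]
  have int: "integrable (lborel \<Otimes>\<^sub>M lborel) (\<lambda>(t, s). iexp (t * s) * a s * b t)"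
  proof (rule lborel_pair.Fubini_integrable)
    show "integrable lborel (\<lambda>t. LINT s|lborel. cmod (case (t, s) of (t, s) \<Rightarrow> iexp (t * s) * a s * b t))"
      using b by (simp add: norm_mult)
    show "AE t in lborel. integrable lborel (\<lambda>s. case (t, s) of (t, s) \<Rightarrow> iexp (t * s) * a s * b t)"
      by (simp only: case_prod_conv) (intro AE_I2 integrable_mult_left integrable_iexp_mult a)
  qed measurable
  have "(LINT t|lborel. ft a t * b t) = (LINT t|lborel. LINT s|lborel. iexp (t * s) * a s * b t)"
    unfolding ft_def by simp
  also have "\<dots> = (LINT s|lborel. LINT t|lborel. iexp (t * s) * a s * b t)"
    using lborel_pair.Fubini_integral[OF int] by simp
  also have "\<dots> = (LINT s|lborel. a s * ft b s)"
    unfolding ft_def by (subst integral_mult_right_zero[symmetric]) (simp add: mult_ac)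
  finally show ?thesis .
qed

definition gauss_weight :: "real \<Rightarrow> real \<Rightarrow> real" where
  "gauss_weight \<delta> t = exp (- (\<delta> * t)\<^sup>2 / 2)"

lemma gauss_weight_borel [measurable]: "gauss_weight \<delta> \<in> borel_measurable borel"
  unfolding gauss_weight_def by measurable

lemma gauss_weight_bounds: "0 < gauss_weight \<delta> t" "gauss_weight \<delta> t \<le> 1"
  unfolding gauss_weight_def by auto

lemma gauss_weight_eq:
  assumes "\<delta> > 0" shows "gauss_weight \<delta> t = sqrt (2 * pi) * std_normal_density (\<delta> * t)"
  unfolding gauss_weight_def std_normal_density_def by simp

lemma integrable_gauss_weight:
  assumes "\<delta> > 0" shows "integrable lborel (gauss_weight \<delta>)"
proof -
  have "integrable lborel (\<lambda>t. std_normal_density (0 + \<delta> * t))"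
    by (subst lborel_integrable_real_affine_iff) (use assms in \<open>auto simp: \<close>)
  then have "integrable lborel (\<lambda>t. sqrt (2 * pi) * std_normal_density (\<delta> * t))" by simp
  then show ?thesis by (simp only: gauss_weight_eq[OF assms, symmetric])
qed

text \<open>The characteristic function of the standard normal distribution, rescaled: the transform of the
Gaussian cutoff is \<open>2 \<pi>\<close> times a probability density that concentrates at \<open>0\<close> as \<open>\<delta>\<close> tends to \<open>0\<close>.\<close>

lemma ft_gauss_weight:
  assumes d: "\<delta> > 0"
  shows "ft (\<lambda>t. complex_of_real (gauss_weight \<delta> t)) u = 2 * pi * normal_density 0 \<delta> u"
proof -
  have "complex_of_real (exp (- ((u/\<delta>)^2) / 2)) = char std_normal_distribution (u/\<delta>)"
    by (simp add: char_std_normal_distribution)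
  also have "\<dots> = (LINT x|lborel. std_normal_density x *\<^sub>R iexp (u/\<delta> * x))"
    unfolding char_def by (subst integral_density) (auto)
  also have "\<dots> = \<bar>\<delta>\<bar> *\<^sub>R (LINT x|lborel. std_normal_density (0 + \<delta> * x) *\<^sub>R iexp (u/\<delta> * (0 + \<delta> * x)))"
    by (rule lborel_integral_real_affine) (use d in auto)
  also have "(\<lambda>x. std_normal_density (0 + \<delta> * x) *\<^sub>R iexp (u/\<delta> * (0 + \<delta> * x))) =
     (\<lambda>x. complex_of_real (1 / sqrt (2*pi)) * (iexp (u * x) * complex_of_real (gauss_weight \<delta> x)))"
    using d by (auto simp: gauss_weight_eq fun_eq_iff scaleR_conv_of_real)
  also have "(LINT x|lborel. complex_of_real (1 / sqrt (2*pi)) * (iexp (u * x) * complex_of_real (gauss_weight \<delta> x)))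
     = complex_of_real (1 / sqrt (2*pi)) * ft (\<lambda>t. complex_of_real (gauss_weight \<delta> t)) u"
    unfolding ft_def by simp
  finally have *: "complex_of_real (exp (- ((u/\<delta>)^2) / 2)) =
     complex_of_real (\<delta> / sqrt (2*pi)) * ft (\<lambda>t. complex_of_real (gauss_weight \<delta> t)) u"
    using d by (simp add: scaleR_conv_of_real)
  have n0: "complex_of_real (\<delta> / sqrt (2*pi)) \<noteq> 0" using d by simp
  have "ft (\<lambda>t. complex_of_real (gauss_weight \<delta> t)) u = complex_of_real (exp (- ((u/\<delta>)^2) / 2)) / complex_of_real (\<delta> / sqrt (2*pi))"
    using * n0 by (simp add: field_simps)
  also have "\<dots> = complex_of_real (exp (- ((u/\<delta>)^2) / 2) / (\<delta> / sqrt (2*pi)))" by simp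
  also have "exp (- ((u/\<delta>)^2) / 2) / (\<delta> / sqrt (2*pi)) = 2 * pi * normal_density 0 \<delta> u"
  proof -
    have "sqrt (2*pi*\<delta>\<^sup>2) = sqrt (2*pi) * \<delta>" using d by (simp add: real_sqrt_mult)
    moreover have "sqrt (2*pi) * sqrt (2*pi) = 2 * pi" by simp
    ultimately show ?thesis using d unfolding normal_density_def
      by (simp add: field_simps power_divide)
  qed
  finally show ?thesis by simp
qed

definition mollify :: "real \<Rightarrow> (real \<Rightarrow> complex) \<Rightarrow> real \<Rightarrow> complex" where
  "mollify \<delta> h s = (LINT s'|lborel. h s' * normal_density 0 \<delta> (s' - s))"

text \<open>Inserting a Gaussian cutoff before inverting the Fourier transform amounts to convolving \<open>h\<close> with a
narrow Gaussian. This is the multiplication formula with \<open>b(t) = exp(- i s t) gauss_weight \<delta> t\<close>.\<close>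

lemma ft_mollify:
  assumes d: "\<delta> > 0" and h: "integrable lborel h"
  shows "ft (\<lambda>t. ft h t * gauss_weight \<delta> t) (- s) = 2 * pi * mollify \<delta> h s"
proof -
  let ?b = "\<lambda>t. iexp (- s * t) * complex_of_real (gauss_weight \<delta> t)"
  have b: "integrable lborel ?b" using integrable_gauss_weight[OF d] by (intro integrable_iexp_mult) simp
  have "ft (\<lambda>t. ft h t * gauss_weight \<delta> t) (- s) = (LINT t|lborel. ft h t * ?b t)"
    by (subst ft_def) (simp add: mult_ac)
  also have "\<dots> = (LINT s'|lborel. h s' * ft ?b s')"
    by (rule ft_multiplication_formula[OF h b])
  also have "(\<lambda>s'. ft ?b s') = (\<lambda>s'. 2 * pi * normal_density 0 \<delta> (s' - s))"
    unfolding ft_gauss_weight[OF d, symmetric]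
    by (simp add: ft_def mult_exp_exp mult.assoc[symmetric] exp_add[symmetric] ring_distribs)
  finally show ?thesis unfolding mollify_def by (subst integral_mult_right_zero[symmetric]) (simp add: mult_ac)
qed

section \<open>Convergence of mollifications\<close>

lemma integrable_translate:
  fixes h :: "real \<Rightarrow> complex"
  assumes "integrable lborel h" shows "integrable lborel (\<lambda>s. h (s + y))"
  using lborel_integrable_real_affine[OF assms, of 1 y] by (simp add: add.commute)

lemma integral_translate:
  fixes h :: "real \<Rightarrow> 'a::{banach,second_countable_topology}"
  shows "(LINT s|lborel. h (s + y)) = integral\<^sup>L lborel h"
  using lborel_integral_real_affine[of 1 h y] by (simp add: add.commute)

lemma lborel_inner_compact:
  fixes A :: "'a::euclidean_space set"
  assumes A [measurable]: "A \<in> sets borel" and fin: "emeasure lborel A < \<infinity>" and e: "e > 0"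
  obtains K where "compact K" "K \<subseteq> A" "emeasure lborel (A - K) \<le> ennreal e"
proof -
  let ?M = "density lborel (indicator A)"
  have M: "emeasure ?M B = emeasure lborel B" if "B \<subseteq> A" "B \<in> sets borel" for B
  proof -
    have "emeasure ?M B = (\<integral>\<^sup>+x. indicator A x * indicator B x \<partial>lborel)"
      using that by (intro emeasure_density) auto
    also have "\<dots> = (\<integral>\<^sup>+x. indicator B x \<partial>lborel)"
      using that by (intro nn_integral_cong) (auto simp: indicator_def)
    finally show ?thesis using that by simp
  qed
  interpret finite_measure ?M
    by (rule finite_measureI) (use fin in \<open>simp add: emeasure_density\<close>)
  have *: "emeasure ?M A = (SUP K \<in> {K. K \<subseteq> A \<and> compact K}. emeasure ?M K)"
    by (rule inner_regular) (auto simp: emeasure_finite)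
  have "\<exists>K. K \<subseteq> A \<and> compact K \<and> emeasure ?M A \<le> emeasure ?M K + ennreal e"
  proof (cases "emeasure ?M A = 0")
    case True
    then show ?thesis using e by (intro exI[of _ "{}"]) auto
  next
    case False
    then have "emeasure ?M A - ennreal e < emeasure ?M A"
      using e False emeasure_finite[of A]
      by (intro ennreal_between) (auto simp: less_top[symmetric] zero_less_iff_neq_zero)
    then obtain K where "K \<subseteq> A" "compact K" "emeasure ?M A - ennreal e < emeasure ?M K"
      by (subst (asm) (2) *) (auto simp: less_SUP_iff)
    then have "emeasure ?M A - ennreal e \<le> emeasure ?M K" by simp
    then show ?thesis using \<open>K \<subseteq> A\<close> \<open>compact K\<close> by (intro exI[of _ K]) (auto simp: ennreal_minus_le_iff add.commute)
  qed
  then obtain K where K: "K \<subseteq> A" "compact K" "emeasure ?M A \<le> emeasure ?M K + ennreal e" by blast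
  have [measurable]: "K \<in> sets borel" using K(2) by (simp add: compact_imp_closed)
  have fK: "emeasure lborel K \<noteq> \<infinity>" using M[OF K(1)] emeasure_finite[of K] by simp
  have "emeasure lborel (A - K) = emeasure lborel A - emeasure lborel K"
    by (rule emeasure_Diff) (use K fK in auto)
  also have "\<dots> \<le> ennreal e"
    using K(3) M[of A] M[OF K(1)] fK e by (simp add: ennreal_minus_le_iff)
  finally show ?thesis using that K by blast
qed

text \<open>The claim holds for indicators of sets of finite measure by regularity of Lebesgue measure, and it
survives sums and limits in the mean.\<close>

lemma L1_translation_continuous:
  fixes h :: "real \<Rightarrow> complex"
  assumes "integrable lborel h"
  shows "\<forall>e>0. \<exists>d>0. \<forall>y. \<bar>y\<bar> < d \<longrightarrow> (LINT s|lborel. cmod (h (s + y) - h s)) \<le> e"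
  using assms
proof (induction rule: integrable_induct)
  case (base A c)
  show ?case
  proof (intro allI impI)
    fix e :: real assume "e > 0"
    define e' where "e' = e / (4 * (cmod c + 1))"
    have e': "e' > 0" using \<open>e > 0\<close> unfolding e'_def by (simp add: add_nonneg_pos)
    \<comment> \<open>For compact \<open>K\<close> inside \<open>A\<close> inside open \<open>U\<close>, a small shift moves \<open>K\<close> within \<open>U\<close>; so \<open>A\<close> and its
      shift differ only on \<open>U - K\<close> and on the shift of \<open>U - K\<close>.\<close>
    obtain K where K: "compact K" "K \<subseteq> A" "emeasure lborel (A - K) \<le> e'"
      using lborel_inner_compact[OF _ _ e'] base by auto
    obtain U where U: "open U" "A \<subseteq> U" "emeasure lborel (U - A) < e'"
      using outer_regular_lborel[OF _ e', of A] base by auto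
    obtain d where d: "d > 0" "(\<Union>x\<in>K. cball x d) \<subseteq> U"
      using compact_subset_open_imp_cball_epsilon_subset[OF K(1) U(1)] K(2) U(2) by blast
    let ?D = "U - K"
    have [measurable]: "A \<in> sets borel" using base by simp
    have [measurable]: "K \<in> sets borel" "U \<in> sets borel" using U(1) K(1) by (auto simp: compact_imp_closed)
    have Ds: "?D \<in> sets borel" by measurable
    have "emeasure lborel ?D = emeasure lborel ((U - A) \<union> (A - K))"
      using U(2) K(2) by (intro arg_cong[where f="emeasure lborel"]) auto
    also have "\<dots> \<le> emeasure lborel (U - A) + emeasure lborel (A - K)"
      by (rule emeasure_subadditive) auto
    also have "\<dots> \<le> ennreal e' + ennreal e'" using U(3) K(3) by (intro add_mono) auto
    finally have eD: "emeasure lborel ?D \<le> ennreal (2 * e')" using e' by (simp flip: ennreal_plus)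
    then have mD: "measure lborel ?D \<le> 2 * e'" using e' unfolding measure_def by (intro enn2real_leI) auto
    have Df: "emeasure lborel ?D < \<infinity>" using eD by (simp add: le_less_trans)
    have Di: "integrable lborel (indicator ?D :: real \<Rightarrow> real)"
      using Df Ds by (auto simp: integrable_indicator_iff)
    have Di': "integrable lborel (\<lambda>s. indicator ?D (s + y) :: real)" for y
      using lborel_integrable_real_affine[OF Di, of 1 y] by (simp add: add.commute)
    show "\<exists>d>0. \<forall>y. \<bar>y\<bar> < d \<longrightarrow> (LINT s|lborel. cmod (indicat_real A (s + y) *\<^sub>R c - indicat_real A s *\<^sub>R c)) \<le> e"
    proof (intro exI[of _ d] conjI allI impI d(1))
      fix y :: real assume y: "\<bar>y\<bar> < d"
      have near: "s + y \<in> U" if "s \<in> K" for s using that y d(2) by (force simp: dist_real_def)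
      have near': "s \<in> U" if "s + y \<in> K" for s using that y d(2) by (force simp: dist_real_def)
      have "(LINT s|lborel. cmod (indicat_real A (s + y) *\<^sub>R c - indicat_real A s *\<^sub>R c))
         \<le> (LINT s|lborel. cmod c * (indicator ?D s + indicator ?D (s + y)))"
      proof (rule integral_mono')
        show "integrable lborel (\<lambda>s. cmod c * (indicat_real ?D s + indicat_real ?D (s + y)))"
          by (intro integrable_mult_right Bochner_Integration.integrable_add Di Di')
        show "cmod (indicat_real A (s + y) *\<^sub>R c - indicat_real A s *\<^sub>R c)
            \<le> cmod c * (indicator ?D s + indicator ?D (s + y))" for s
          using K(2) U(2) near[of s] near'[of s] by (auto simp: indicator_def)
      qed auto
      also have "\<dots> = cmod c * (measure lborel ?D + measure lborel ?D)"
        using Di Di' integral_translate[of "indicator ?D :: real \<Rightarrow> real" y] Ds by simp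
      also have "\<dots> \<le> (cmod c + 1) * (4 * e')"
        using mD by (intro mult_mono) auto
      also have "\<dots> = e"
      proof -
        have "4 * cmod c + 4 \<noteq> 0" using norm_ge_zero[of c] by linarith
        then show ?thesis unfolding e'_def by (simp add: field_simps)
      qed
      finally show "(LINT s|lborel. cmod (indicat_real A (s + y) *\<^sub>R c - indicat_real A s *\<^sub>R c)) \<le> e" .
    qed
  qed
next
  case (add f g)
  show ?case
  proof (intro allI impI)
    fix e :: real assume "e > 0"
    then have "e/2 > 0" by simp
    then obtain d1 d2 where d: "d1 > 0" "d2 > 0"
      "\<And>y. \<bar>y\<bar> < d1 \<Longrightarrow> (LINT s|lborel. cmod (f (s + y) - f s)) \<le> e/2"
      "\<And>y. \<bar>y\<bar> < d2 \<Longrightarrow> (LINT s|lborel. cmod (g (s + y) - g s)) \<le> e/2"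
      using add.IH by blast
    show "\<exists>d>0. \<forall>y. \<bar>y\<bar> < d \<longrightarrow> (LINT s|lborel. cmod (f (s + y) + g (s + y) - (f s + g s))) \<le> e"
    proof (intro exI[of _ "min d1 d2"] conjI allI impI)
      fix y :: real assume y: "\<bar>y\<bar> < min d1 d2"
      have i: "integrable lborel (\<lambda>s. cmod (f (s + y) - f s))" "integrable lborel (\<lambda>s. cmod (g (s + y) - g s))"
        by (intro integrable_norm Bochner_Integration.integrable_diff integrable_translate add.hyps)+
      have "(LINT s|lborel. cmod (f (s + y) + g (s + y) - (f s + g s))) \<le>
         (LINT s|lborel. cmod (f (s + y) - f s) + cmod (g (s + y) - g s))"
        by (rule integral_mono') (auto intro: i simp: add_diff_add norm_triangle_ineq)
      also have "\<dots> = (LINT s|lborel. cmod (f (s + y) - f s)) + (LINT s|lborel. cmod (g (s + y) - g s))"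
        by (rule Bochner_Integration.integral_add[OF i])
      also have "\<dots> \<le> e" using d(3)[of y] d(4)[of y] y by simp
      finally show "(LINT s|lborel. cmod (f (s + y) + g (s + y) - (f s + g s))) \<le> e" .
    qed (use d in auto)
  qed
next
  case (lim f u)
  have "(\<lambda>i. LINT s|lborel. cmod (u i s - f s)) \<longlonglongrightarrow> (LINT s::real|lborel. 0)"
  proof (rule integral_dominated_convergence[where w="\<lambda>s. 3 * cmod (f s)"])
    show "AE x in lborel. (\<lambda>i. cmod (u i x - f x)) \<longlonglongrightarrow> 0"
      using lim.hyps(2) by (auto intro!: AE_I2 tendsto_norm_zero LIM_zero)
    show "AE x in lborel. norm (cmod (u i x - f x)) \<le> 3 * cmod (f x)" for i
    proof (rule AE_I2)
      fix x
      have "norm (cmod (u i x - f x)) \<le> cmod (u i x) + cmod (f x)" using norm_triangle_ineq4 by simp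
      then show "norm (cmod (u i x - f x)) \<le> 3 * cmod (f x)" using lim.hyps(3)[of x i] by simp
    qed
  qed (use lim.hyps in auto)
  then have t: "(\<lambda>i. LINT s|lborel. cmod (u i s - f s)) \<longlonglongrightarrow> 0" by simp
  show ?case
  proof (intro allI impI)
    fix e :: real assume "e > 0"
    then have e: "e/3 > 0" by simp
    obtain i where i: "(LINT s|lborel. cmod (u i s - f s)) < e/3"
      using order_tendstoD(2)[OF t e] by (auto simp: eventually_sequentially)
    obtain d where d: "d > 0" "\<And>y. \<bar>y\<bar> < d \<Longrightarrow> (LINT s|lborel. cmod (u i (s + y) - u i s)) \<le> e/3"
      using lim.IH e by blast
    show "\<exists>d>0. \<forall>y. \<bar>y\<bar> < d \<longrightarrow> (LINT s|lborel. cmod (f (s + y) - f s)) \<le> e"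
    proof (intro exI[of _ d] conjI allI impI d)
      fix y :: real assume y: "\<bar>y\<bar> < d"
      have I1: "integrable lborel (\<lambda>s. cmod (u i s - f s))" using lim.hyps by auto
      have I2: "integrable lborel (\<lambda>s. cmod (u i (s+y) - f (s+y)))"
        by (intro integrable_norm Bochner_Integration.integrable_diff integrable_translate lim.hyps)
      have I3: "integrable lborel (\<lambda>s. cmod (u i (s + y) - u i s))"
        by (intro integrable_norm Bochner_Integration.integrable_diff integrable_translate lim.hyps)
      have "(LINT s|lborel. cmod (f (s + y) - f s)) \<le> (LINT s|lborel. cmod (u i s - f s) + cmod (u i (s+y) - f (s+y)) + cmod (u i (s + y) - u i s))"
      proof (rule integral_mono')
        show "cmod (f (s + y) - f s) \<le> cmod (u i s - f s) + cmod (u i (s+y) - f (s+y)) + cmod (u i (s + y) - u i s)" for s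
        proof -
          have "f (s + y) - f s = (u i s - f s) - (u i (s+y) - f (s+y)) + (u i (s + y) - u i s)" by simp
          then have "cmod (f (s + y) - f s) \<le> cmod ((u i s - f s) - (u i (s+y) - f (s+y))) + cmod (u i (s + y) - u i s)"
            by (metis norm_triangle_ineq)
          also have "\<dots> \<le> cmod (u i s - f s) + cmod (u i (s+y) - f (s+y)) + cmod (u i (s + y) - u i s)"
            by (intro add_mono norm_triangle_ineq4) auto
          finally show ?thesis .
        qed
      qed (intro Bochner_Integration.integrable_add I1 I2 I3, simp)
      also have "\<dots> = (LINT s|lborel. cmod (u i s - f s)) + (LINT s|lborel. cmod (u i (s+y) - f (s+y))) + (LINT s|lborel. cmod (u i (s + y) - u i s))"
        by (simp add: I1 I2 I3)
      also have "(LINT s|lborel. cmod (u i (s+y) - f (s+y))) = (LINT s|lborel. cmod (u i s - f s))"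
        using integral_translate[of "\<lambda>s. cmod (u i s - f s)" y] by simp
      finally show "(LINT s|lborel. cmod (f (s + y) - f s)) \<le> e" using i d(2)[OF y] by simp
    qed
  qed
qed

text \<open>Averaging shifts \<open>\<delta> z\<close> over a standard normal \<open>z\<close> puts the dependence on \<open>\<delta>\<close> inside \<open>h\<close>, which is
the form needed for dominated convergence.\<close>

lemma mollify_eq_average:
  fixes h :: "real \<Rightarrow> complex"
  assumes d: "\<delta> > 0"
  shows "mollify \<delta> h s = (LINT z|lborel. std_normal_density z *\<^sub>R h (s + \<delta> * z))"
proof -
  have "mollify \<delta> h s = \<bar>\<delta>\<bar> *\<^sub>R (LINT z|lborel. h (s + \<delta> * z) * normal_density 0 \<delta> (s + \<delta> * z - s))"
    unfolding mollify_def by (rule lborel_integral_real_affine) (use d in auto)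
  also have "\<dots> = (LINT z|lborel. \<bar>\<delta>\<bar> *\<^sub>R (h (s + \<delta> * z) * normal_density 0 \<delta> (s + \<delta> * z - s)))" by simp
  also have "(\<lambda>z. \<bar>\<delta>\<bar> *\<^sub>R (h (s + \<delta> * z) * normal_density 0 \<delta> (s + \<delta> * z - s))) = (\<lambda>z. std_normal_density z *\<^sub>R h (s + \<delta> * z))"
  proof
    fix z
    have "sqrt (2*pi*\<delta>\<^sup>2) = sqrt (2*pi) * \<delta>" using d by (simp add: real_sqrt_mult)
    then have "\<delta> * normal_density 0 \<delta> (\<delta> * z) = std_normal_density z"
      using d unfolding normal_density_def by (simp add: power_mult_distrib)
    then show "\<bar>\<delta>\<bar> *\<^sub>R (h (s + \<delta> * z) * normal_density 0 \<delta> (s + \<delta> * z - s)) = std_normal_density z *\<^sub>R h (s + \<delta> * z)"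
      using d by (simp add: scaleR_conv_of_real mult_ac flip: of_real_mult)
  qed
  finally show ?thesis .
qed

lemma integrable_normal_mult:
  fixes h :: "real \<Rightarrow> complex"
  assumes d: "\<delta> > 0" and h: "integrable lborel h"
  shows "integrable lborel (\<lambda>z. std_normal_density z *\<^sub>R h (s + \<delta> * z))"
proof -
  have "integrable lborel (\<lambda>z. h (s + \<delta> * z))"
    using lborel_integrable_real_affine[OF h, of \<delta> s] d by simp
  moreover have "(\<lambda>z. std_normal_density z *\<^sub>R h (s + \<delta> * z)) \<in> borel_measurable lborel"
    using borel_measurable_integrable[OF h] by measurable
  moreover have "norm (std_normal_density z *\<^sub>R h (s + \<delta> * z)) \<le> norm (h (s + \<delta> * z))" for z
  proof -
    have "1 \<le> sqrt (2 * pi)" by (rule real_le_rsqrt) (use pi_gt3 in simp)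
    then have "exp (- z\<^sup>2 / 2) / sqrt (2 * pi) \<le> 1 / 1" by (intro frac_le) auto
    then have "std_normal_density z \<le> 1" by (simp add: std_normal_density_def)
    then show ?thesis by (simp add: mult_left_le_one_le)
  qed
  ultimately show ?thesis
    by (rule Bochner_Integration.integrable_bound[OF _ _ AE_I2])
qed

text \<open>The distance in the mean is at most the Gaussian average of the modulus of continuity
\<open>\<omega>(y)\<close>, the norm of \<open>h(\<cdot> + y) - h\<close>, at the shifts \<open>\<delta> z\<close>; it is bounded and tends to \<open>0\<close> with \<open>y\<close>.\<close>

lemma mollify_tendsto_L1:
  fixes h :: "real \<Rightarrow> complex" and \<delta> :: "nat \<Rightarrow> real"
  assumes h: "integrable lborel h" and d: "\<And>k. \<delta> k > 0" "\<delta> \<longlonglongrightarrow> 0"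
  shows "(\<lambda>k. \<integral>\<^sup>+s. ennreal (cmod (mollify (\<delta> k) h s - h s)) \<partial>lborel) \<longlonglongrightarrow> 0"
proof -
  note [measurable] = borel_measurable_integrable[OF h]
  define \<omega> where "\<omega> y = (LINT s|lborel. cmod (h (s + y) - h s))" for y
  have [measurable]: "\<omega> \<in> borel_measurable borel" unfolding \<omega>_def by measurable
  have nn: "(\<integral>\<^sup>+s. ennreal (cmod (h (s + y) - h s)) \<partial>lborel) = ennreal (\<omega> y)" for y
    unfolding \<omega>_def by (rule nn_integral_eq_integral)
      (auto intro!: integrable_norm Bochner_Integration.integrable_diff integrable_translate h)
  have w0: "\<omega> y \<ge> 0" for y unfolding \<omega>_def by simp
  have wb: "\<omega> y \<le> 2 * (LINT s|lborel. cmod (h s))" for y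
  proof -
    have "\<omega> y \<le> (LINT s|lborel. cmod (h (s + y)) + cmod (h s))"
      unfolding \<omega>_def using h integrable_translate[OF h, of y]
      by (intro integral_mono') (auto intro: norm_triangle_ineq4)
    also have "\<dots> = 2 * (LINT s|lborel. cmod (h s))"
      using h integrable_translate[OF h, of y] integral_translate[of "\<lambda>s. cmod (h s)" y] by simp
    finally show ?thesis .
  qed
  have bound: "(\<integral>\<^sup>+s. ennreal (cmod (mollify (\<delta> k) h s - h s)) \<partial>lborel) \<le> ennreal (LINT z|lborel. std_normal_density z * \<omega> (\<delta> k * z))" for k
  proof -
    have "ennreal (cmod (mollify (\<delta> k) h s - h s)) \<le> (\<integral>\<^sup>+z. ennreal (std_normal_density z) * ennreal (cmod (h (s + \<delta> k * z) - h s)) \<partial>lborel)" for s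
    proof -
      have i: "integrable lborel (\<lambda>z. std_normal_density z *\<^sub>R h s)" by simp
      have "mollify (\<delta> k) h s - h s = (LINT z|lborel. std_normal_density z *\<^sub>R h (s + \<delta> k * z)) - (LINT z|lborel. std_normal_density z *\<^sub>R h s)"
        using mollify_eq_average[OF d(1)] by simp
      also have "\<dots> = (LINT z|lborel. std_normal_density z *\<^sub>R h (s + \<delta> k * z) - std_normal_density z *\<^sub>R h s)"
        by (rule Bochner_Integration.integral_diff[symmetric, OF integrable_normal_mult[OF d(1) h] i])
      finally have "ennreal (cmod (mollify (\<delta> k) h s - h s)) \<le> (\<integral>\<^sup>+z. ennreal (cmod (std_normal_density z *\<^sub>R h (s + \<delta> k * z) - std_normal_density z *\<^sub>R h s)) \<partial>lborel)"
        using integral_norm_bound_ennreal[OF Bochner_Integration.integrable_diff[OF integrable_normal_mult[OF d(1) h] i]] by simp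
      also have "\<dots> = (\<integral>\<^sup>+z. ennreal (std_normal_density z) * ennreal (cmod (h (s + \<delta> k * z) - h s)) \<partial>lborel)"
        by (intro nn_integral_cong) (auto simp flip: ennreal_mult scaleR_diff_right)
      finally show ?thesis .
    qed
    then have "(\<integral>\<^sup>+s. ennreal (cmod (mollify (\<delta> k) h s - h s)) \<partial>lborel) \<le> (\<integral>\<^sup>+s. \<integral>\<^sup>+z. ennreal (std_normal_density z) * ennreal (cmod (h (s + \<delta> k * z) - h s)) \<partial>lborel \<partial>lborel)"
      by (intro nn_integral_mono) auto
    also have "\<dots> = (\<integral>\<^sup>+z. \<integral>\<^sup>+s. ennreal (std_normal_density z) * ennreal (cmod (h (s + \<delta> k * z) - h s)) \<partial>lborel \<partial>lborel)"
      by (rule lborel_pair.Fubini') measurable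
    also have "\<dots> = (\<integral>\<^sup>+z. ennreal (std_normal_density z * \<omega> (\<delta> k * z)) \<partial>lborel)"
      by (intro nn_integral_cong) (simp add: nn_integral_cmult nn ennreal_mult w0)
    also have "\<dots> = ennreal (LINT z|lborel. std_normal_density z * \<omega> (\<delta> k * z))"
    proof (rule nn_integral_eq_integral)
      show "integrable lborel (\<lambda>z. std_normal_density z * \<omega> (\<delta> k * z))"
        by (rule Bochner_Integration.integrable_bound[where f="\<lambda>z. std_normal_density z * (2 * (LINT s|lborel. cmod (h s)))"])
          (auto intro!: AE_I2 mult_left_mono simp: abs_mult w0 wb abs_of_nonneg)
    qed (auto simp: w0)
    finally show ?thesis .
  qed
  have "(\<lambda>k. LINT z|lborel. std_normal_density z * \<omega> (\<delta> k * z)) \<longlonglongrightarrow> (LINT z::real|lborel. 0)"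
  proof (rule integral_dominated_convergence[where w="\<lambda>z. std_normal_density z * (2 * (LINT s|lborel. cmod (h s)))"])
    show "AE z in lborel. (\<lambda>k. std_normal_density z * \<omega> (\<delta> k * z)) \<longlonglongrightarrow> 0"
    proof (rule AE_I2)
      fix z :: real
      have "(\<lambda>k. \<delta> k * z) \<longlonglongrightarrow> 0" using d(2) by (rule tendsto_mult_left_zero)
      moreover have "(\<omega> \<longlongrightarrow> 0) (at 0)"
        unfolding tendsto_iff eventually_at
      proof (intro allI impI)
        fix e :: real assume "e > 0"
        then have "e/2 > 0" by simp
        then obtain dd where "dd > 0" "\<And>y. \<bar>y\<bar> < dd \<Longrightarrow> \<omega> y \<le> e/2"
          using L1_translation_continuous[OF h] unfolding \<omega>_def by blast
        then show "\<exists>d>0. \<forall>x\<in>UNIV. x \<noteq> 0 \<and> dist x 0 < d \<longrightarrow> dist (\<omega> x) 0 < e"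
          using \<open>e > 0\<close> w0 by (intro exI[of _ dd]) (force simp: dist_real_def)
      qed
      moreover have "\<omega> 0 = 0" unfolding \<omega>_def by simp
      ultimately have "(\<lambda>k. \<omega> (\<delta> k * z)) \<longlonglongrightarrow> 0"
        using isCont_tendsto_compose[of 0 \<omega> "\<lambda>k. \<delta> k * z" sequentially] by (simp add: isCont_def)
      then show "(\<lambda>k. std_normal_density z * \<omega> (\<delta> k * z)) \<longlonglongrightarrow> 0"
        by (rule tendsto_mult_right_zero)
    qed
    show "AE x in lborel. norm (std_normal_density x * \<omega> (\<delta> k * x)) \<le> std_normal_density x * (2 * (LINT s|lborel. cmod (h s)))" for k
      by (auto intro!: AE_I2 mult_left_mono simp: abs_mult w0 wb abs_of_nonneg)
  qed auto
  then have "(\<lambda>k. ennreal (LINT z|lborel. std_normal_density z * \<omega> (\<delta> k * z))) \<longlonglongrightarrow> ennreal 0"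
    by (intro tendsto_ennrealI) simp
  then have lim0: "(\<lambda>k. ennreal (LINT z|lborel. std_normal_density z * \<omega> (\<delta> k * z))) \<longlonglongrightarrow> 0" by simp
  show ?thesis
    by (rule tendsto_sandwich[OF _ _ tendsto_const lim0]) (simp_all add: bound)
qed

lemma mollify_measurable [measurable]:
  assumes "integrable lborel h" shows "mollify \<delta> h \<in> borel_measurable borel"
proof -
  note [measurable] = borel_measurable_integrable[OF assms]
  show ?thesis unfolding mollify_def by measurable
qed

lemma mollify_AE_subseq:
  fixes h :: "real \<Rightarrow> complex" and \<delta> :: "nat \<Rightarrow> real"
  assumes h: "integrable lborel h" and d: "\<And>k. \<delta> k > 0" "\<delta> \<longlonglongrightarrow> 0"
  shows "\<exists>r. strict_mono r \<and> (AE s in lborel. (\<lambda>k. mollify (\<delta> (r k)) h s) \<longlonglongrightarrow> h s)"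
proof -
  note [measurable] = borel_measurable_integrable[OF h] mollify_measurable[OF h]
  have t: "(\<lambda>k. \<integral>\<^sup>+s. ennreal (cmod (mollify (\<delta> k) h s - h s)) \<partial>lborel) \<longlonglongrightarrow> 0"
    by (rule mollify_tendsto_L1[OF h d])
  have "eventually (\<lambda>k. (\<integral>\<^sup>+s. ennreal (cmod (mollify (\<delta> k) h s - h s)) \<partial>lborel) < 1) sequentially"
    using order_tendstoD(2)[OF t, of 1] by simp
  \<comment> \<open>Finite \<open>L\<^sup>1\<close> distance makes the differences integrable, but only from some index \<open>N\<close> on.\<close>
  then obtain N where N: "\<And>k. k \<ge> N \<Longrightarrow> (\<integral>\<^sup>+s. ennreal (cmod (mollify (\<delta> k) h s - h s)) \<partial>lborel) < 1"
    by (auto simp: eventually_sequentially)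
  have int: "integrable lborel (\<lambda>s. mollify (\<delta> (k + N)) h s - h s)" for k
    by (rule integrableI_bounded) (use N[of "k + N"] in \<open>auto intro: less_trans\<close>)
  have "\<exists>r::nat\<Rightarrow>nat. strict_mono r \<and> (AE s in lborel. (\<lambda>n. mollify (\<delta> (r n + N)) h s - h s) \<longlonglongrightarrow> 0)"
  proof (rule tendsto_L1_AE_subseq)
    have "(\<lambda>k. ennreal (LINT s|lborel. cmod (mollify (\<delta> (k + N)) h s - h s))) \<longlonglongrightarrow> ennreal 0"
      using LIMSEQ_ignore_initial_segment[OF t, of N] nn_integral_eq_integral[OF integrable_norm[OF int]] by simp
    then show "(\<lambda>n. LINT s|lborel. cmod (mollify (\<delta> (n + N)) h s - h s)) \<longlonglongrightarrow> 0"
      by (subst (asm) tendsto_ennreal_iff) auto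
  qed (rule int)
  then obtain r where r: "strict_mono r" "AE s in lborel. (\<lambda>n. mollify (\<delta> (r n + N)) h s - h s) \<longlonglongrightarrow> 0"
    by blast
  show ?thesis
  proof (intro exI[of _ "\<lambda>n. r n + N"] conjI)
    show "strict_mono (\<lambda>n. r n + N)" using r(1) by (simp add: strict_mono_def)
    show "AE s in lborel. (\<lambda>k. mollify (\<delta> (r k + N)) h s) \<longlonglongrightarrow> h s"
      using r(2) by eventually_elim (rule LIM_zero_cancel)
  qed
qed

section \<open>Plancherel's identity for integrable functions\<close>

lemma nn_integral_normal_translate:
  assumes "\<delta> > 0"
  shows "(\<integral>\<^sup>+s'. ennreal (normal_density 0 \<delta> (s' - s)) \<partial>lborel) = 1"
    "(\<integral>\<^sup>+s. ennreal (normal_density 0 \<delta> (s' - s)) \<partial>lborel) = 1"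
proof -
  have *: "(\<integral>\<^sup>+s'. ennreal (normal_density \<mu> \<delta> s') \<partial>lborel) = 1" for \<mu>
    using prob_space.emeasure_space_1[OF prob_space_normal_density[OF assms, of \<mu>]]
    by (simp add: emeasure_density)
  show "(\<integral>\<^sup>+s'. ennreal (normal_density 0 \<delta> (s' - s)) \<partial>lborel) = 1" using *[of s] unfolding normal_density_def by simp
  show "(\<integral>\<^sup>+s. ennreal (normal_density 0 \<delta> (s' - s)) \<partial>lborel) = 1" using *[of s'] unfolding normal_density_def by (simp add: power2_commute)
qed

lemma ft_cnj: "ft (\<lambda>t. cnj (h t)) s = cnj (ft h (- s))"
  unfolding ft_def Bochner_Integration.integral_cnj[symmetric]
  by (simp add: exp_cnj del: Bochner_Integration.integral_cnj)

text \<open>By the multiplication formula the weighted integral equals \<open>2 \<pi>\<close> times the integral of \<open>h\<close> against the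
conjugate of its mollification. As \<open>2 |h(s) h(s')| \<le> |h(s)|\<^sup>2 + |h(s')|\<^sup>2\<close> and the Gaussian kernel has total mass
\<open>1\<close> in each variable, this is bounded independently of \<open>\<delta>\<close>.\<close>

lemma ft_L2_weighted_le:
  assumes d: "\<delta> > 0" and h: "integrable lborel h"
  shows "(\<integral>\<^sup>+t. ennreal ((cmod (ft h t))\<^sup>2 * gauss_weight \<delta> t) \<partial>lborel) \<le> ennreal (2 * pi) * (\<integral>\<^sup>+s. ennreal ((cmod (h s))\<^sup>2) \<partial>lborel)"
proof -
  note [measurable] = borel_measurable_integrable[OF h] borel_measurable_ft[OF h] mollify_measurable[OF h]
  let ?F = "ft h" and ?w = "gauss_weight \<delta>"
  define C where "C = (LINT s|lborel. cmod (h s))"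
  have C: "cmod (?F t) \<le> C" for t unfolding C_def by (rule norm_ft_le)
  have C0: "C \<ge> 0" unfolding C_def by simp
  have Fw: "integrable lborel (\<lambda>t. ?F t * ?w t)"
    by (rule Bochner_Integration.integrable_bound[where f="\<lambda>t. C * ?w t"])
      (use integrable_gauss_weight[OF d] gauss_weight_bounds C C0 in \<open>auto intro!: AE_I2 mult_right_mono simp: norm_mult less_imp_le\<close>)
  have cFw: "integrable lborel (\<lambda>t. cnj (?F t * ?w t))" using Fw by (subst complex_integrable_cnj)
  have F2w: "integrable lborel (\<lambda>t. (cmod (?F t))\<^sup>2 * ?w t)"
    by (rule Bochner_Integration.integrable_bound[where f="\<lambda>t. C\<^sup>2 * ?w t"])
      (use integrable_gauss_weight[OF d] gauss_weight_bounds C C0 in \<open>auto intro!: AE_I2 mult_right_mono power_mono simp: norm_mult less_imp_le abs_mult\<close>)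
  have "complex_of_real (LINT t|lborel. (cmod (?F t))\<^sup>2 * ?w t) = (LINT t|lborel. ?F t * cnj (?F t * ?w t))"
  proof -
    have "complex_of_real ((cmod (?F t))\<^sup>2 * ?w t) = ?F t * cnj (?F t * ?w t)" for t
      using complex_norm_square[of "?F t"] by simp
    then show ?thesis by (simp only: integral_complex_of_real[symmetric])
  qed
  also have "\<dots> = (LINT s|lborel. h s * ft (\<lambda>t. cnj (?F t * ?w t)) s)"
    by (rule ft_multiplication_formula[OF h cFw])
  also have "\<dots> = (LINT s|lborel. h s * cnj (2 * pi * mollify \<delta> h s))"
    by (simp only: ft_cnj ft_mollify[OF d h])
  finally have E: "complex_of_real (LINT t|lborel. (cmod (?F t))\<^sup>2 * ?w t) = (LINT s|lborel. h s * cnj (2 * pi * mollify \<delta> h s))" .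
  have "(LINT t|lborel. (cmod (?F t))\<^sup>2 * ?w t) \<ge> 0"
    using gauss_weight_bounds by (intro Bochner_Integration.integral_nonneg) (simp add: less_imp_le)
  then have "(LINT t|lborel. (cmod (?F t))\<^sup>2 * ?w t) = cmod (LINT s|lborel. h s * cnj (2 * pi * mollify \<delta> h s))"
    unfolding E[symmetric] by simp
  then have "(\<integral>\<^sup>+t. ennreal ((cmod (?F t))\<^sup>2 * ?w t) \<partial>lborel) = ennreal (cmod (LINT s|lborel. h s * cnj (2 * pi * mollify \<delta> h s)))"
    using nn_integral_eq_integral[OF F2w] gauss_weight_bounds by (simp add: less_imp_le)
  also have "\<dots> \<le> (\<integral>\<^sup>+s. ennreal (cmod (h s * cnj (2 * pi * mollify \<delta> h s))) \<partial>lborel)"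
  proof (cases "integrable lborel (\<lambda>s. h s * cnj (2 * pi * mollify \<delta> h s))")
    case True
    then show ?thesis by (rule integral_norm_bound_ennreal)
  qed (simp add: not_integrable_integral_eq)
  also have "\<dots> \<le> (\<integral>\<^sup>+s. \<integral>\<^sup>+s'. ennreal (2 * pi) * ennreal (cmod (h s) * (cmod (h s') * normal_density 0 \<delta> (s' - s))) \<partial>lborel \<partial>lborel)"
  proof (intro nn_integral_mono)
    fix s
    have "ennreal (cmod (mollify \<delta> h s)) \<le> (\<integral>\<^sup>+s'. ennreal (cmod (h s') * normal_density 0 \<delta> (s' - s)) \<partial>lborel)"
    proof (cases "integrable lborel (\<lambda>s'. h s' * normal_density 0 \<delta> (s' - s))")
      case True
      show ?thesis using integral_norm_bound_ennreal[OF True] unfolding mollify_def by (simp add: norm_mult abs_of_nonneg)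
    qed (simp add: mollify_def not_integrable_integral_eq)
    then have "ennreal (2 * pi * cmod (h s)) * ennreal (cmod (mollify \<delta> h s)) \<le> ennreal (2 * pi * cmod (h s)) * (\<integral>\<^sup>+s'. ennreal (cmod (h s') * normal_density 0 \<delta> (s' - s)) \<partial>lborel)"
      by (rule mult_left_mono) simp
    also have "\<dots> = (\<integral>\<^sup>+s'. ennreal (2 * pi * cmod (h s)) * ennreal (cmod (h s') * normal_density 0 \<delta> (s' - s)) \<partial>lborel)"
      by (rule nn_integral_cmult[symmetric]) measurable
    also have "\<dots> = (\<integral>\<^sup>+s'. ennreal (2 * pi) * ennreal (cmod (h s) * (cmod (h s') * normal_density 0 \<delta> (s' - s))) \<partial>lborel)"
      by (intro nn_integral_cong) (simp add: mult.assoc flip: ennreal_mult)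
    finally show "ennreal (cmod (h s * cnj (2 * pi * mollify \<delta> h s))) \<le> (\<integral>\<^sup>+s'. ennreal (2 * pi) * ennreal (cmod (h s) * (cmod (h s') * normal_density 0 \<delta> (s' - s))) \<partial>lborel)"
      by (simp add: norm_mult mult_ac flip: ennreal_mult)
  qed
  also have "\<dots> = ennreal (2 * pi) * (\<integral>\<^sup>+s. \<integral>\<^sup>+s'. ennreal (cmod (h s) * (cmod (h s') * normal_density 0 \<delta> (s' - s))) \<partial>lborel \<partial>lborel)"
    by (subst nn_integral_cmult[symmetric], measurable, intro nn_integral_cong nn_integral_cmult) measurable
  also have "(\<integral>\<^sup>+s. \<integral>\<^sup>+s'. ennreal (cmod (h s) * (cmod (h s') * normal_density 0 \<delta> (s' - s))) \<partial>lborel \<partial>lborel)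
     \<le> (\<integral>\<^sup>+s. \<integral>\<^sup>+s'. (ennreal ((cmod (h s))\<^sup>2 / 2) * ennreal (normal_density 0 \<delta> (s' - s))
                 + ennreal ((cmod (h s'))\<^sup>2 / 2) * ennreal (normal_density 0 \<delta> (s' - s))) \<partial>lborel \<partial>lborel)"
  proof (intro nn_integral_mono)
    fix s s'
    have "cmod (h s) * cmod (h s') \<le> (cmod (h s))\<^sup>2 / 2 + (cmod (h s'))\<^sup>2 / 2"
      using sum_squares_bound[of "cmod (h s)" "cmod (h s')"] by simp
    then have "cmod (h s) * cmod (h s') * normal_density 0 \<delta> (s' - s) \<le> ((cmod (h s))\<^sup>2 / 2 + (cmod (h s'))\<^sup>2 / 2) * normal_density 0 \<delta> (s' - s)"
      by (rule mult_right_mono) simp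
    then show "ennreal (cmod (h s) * (cmod (h s') * normal_density 0 \<delta> (s' - s))) \<le> ennreal ((cmod (h s))\<^sup>2 / 2) * ennreal (normal_density 0 \<delta> (s' - s))
                 + ennreal ((cmod (h s'))\<^sup>2 / 2) * ennreal (normal_density 0 \<delta> (s' - s))"
      by (simp add: ring_distribs mult.assoc ennreal_leI flip: ennreal_mult ennreal_plus)
  qed
  also have "\<dots> = (\<integral>\<^sup>+s. \<integral>\<^sup>+s'. ennreal ((cmod (h s))\<^sup>2 / 2) * ennreal (normal_density 0 \<delta> (s' - s)) \<partial>lborel \<partial>lborel)
    + (\<integral>\<^sup>+s. \<integral>\<^sup>+s'. ennreal ((cmod (h s'))\<^sup>2 / 2) * ennreal (normal_density 0 \<delta> (s' - s)) \<partial>lborel \<partial>lborel)"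
    by (subst nn_integral_add[symmetric], measurable, intro nn_integral_cong nn_integral_add) measurable
  also have "(\<integral>\<^sup>+s. \<integral>\<^sup>+s'. ennreal ((cmod (h s'))\<^sup>2 / 2) * ennreal (normal_density 0 \<delta> (s' - s)) \<partial>lborel \<partial>lborel)
    = (\<integral>\<^sup>+s'. \<integral>\<^sup>+s. ennreal ((cmod (h s'))\<^sup>2 / 2) * ennreal (normal_density 0 \<delta> (s' - s)) \<partial>lborel \<partial>lborel)"
    by (rule lborel_pair.Fubini') measurable
  also have "\<dots> = (\<integral>\<^sup>+s. ennreal ((cmod (h s))\<^sup>2 / 2) \<partial>lborel)"
    by (subst nn_integral_cmult) (measurable, simp add: nn_integral_normal_translate[OF d])
  also have "(\<integral>\<^sup>+s. \<integral>\<^sup>+s'. ennreal ((cmod (h s))\<^sup>2 / 2) * ennreal (normal_density 0 \<delta> (s' - s)) \<partial>lborel \<partial>lborel) = (\<integral>\<^sup>+s. ennreal ((cmod (h s))\<^sup>2 / 2) \<partial>lborel)"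
    by (subst nn_integral_cmult) (measurable, simp add: nn_integral_normal_translate[OF d])
  also have "(\<integral>\<^sup>+s. ennreal ((cmod (h s))\<^sup>2 / 2) \<partial>lborel) + (\<integral>\<^sup>+s. ennreal ((cmod (h s))\<^sup>2 / 2) \<partial>lborel) = (\<integral>\<^sup>+s. ennreal ((cmod (h s))\<^sup>2) \<partial>lborel)"
    by (subst nn_integral_add[symmetric]) (measurable, simp flip: ennreal_plus)
  finally show ?thesis by (simp add: mult_left_mono)
qed

lemma gauss_weight_tendsto_1:
  assumes "\<delta> \<longlonglongrightarrow> 0" shows "(\<lambda>k. gauss_weight (\<delta> k) t) \<longlonglongrightarrow> 1"
proof -
  have "(\<lambda>k. exp (- (\<delta> k * t)\<^sup>2 / 2)) \<longlonglongrightarrow> exp (- (0 * t)\<^sup>2 / 2)"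
    by (intro tendsto_intros assms) auto
  then show ?thesis unfolding gauss_weight_def by simp
qed

lemma ft_L2_le:
  assumes h: "integrable lborel h"
  shows "(\<integral>\<^sup>+t. ennreal ((cmod (ft h t))\<^sup>2) \<partial>lborel) \<le> ennreal (2 * pi) * (\<integral>\<^sup>+s. ennreal ((cmod (h s))\<^sup>2) \<partial>lborel)"
proof -
  note [measurable] = borel_measurable_ft[OF h]
  let ?\<delta> = "\<lambda>k. 1 / real (Suc k)"
  have lim: "(\<lambda>k. ennreal ((cmod (ft h t))\<^sup>2 * gauss_weight (?\<delta> k) t)) \<longlonglongrightarrow> ennreal ((cmod (ft h t))\<^sup>2 * 1)" for t
    by (intro tendsto_ennrealI tendsto_mult tendsto_const gauss_weight_tendsto_1) (rule LIMSEQ_Suc[OF lim_1_over_n])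
  have "(\<integral>\<^sup>+t. ennreal ((cmod (ft h t))\<^sup>2) \<partial>lborel) = (\<integral>\<^sup>+t. liminf (\<lambda>k. ennreal ((cmod (ft h t))\<^sup>2 * gauss_weight (?\<delta> k) t)) \<partial>lborel)"
    using lim_imp_Liminf[OF _ lim] by simp
  also have "\<dots> \<le> liminf (\<lambda>k. \<integral>\<^sup>+t. ennreal ((cmod (ft h t))\<^sup>2 * gauss_weight (?\<delta> k) t) \<partial>lborel)"
    by (rule nn_integral_liminf) measurable
  also have "\<dots> \<le> liminf (\<lambda>k::nat. ennreal (2 * pi) * (\<integral>\<^sup>+s. ennreal ((cmod (h s))\<^sup>2) \<partial>lborel))"
    by (intro Liminf_mono always_eventually allI ft_L2_weighted_le h) auto
  also have "\<dots> = ennreal (2 * pi) * (\<integral>\<^sup>+s. ennreal ((cmod (h s))\<^sup>2) \<partial>lborel)" by (simp add: Liminf_const)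
  finally show ?thesis .
qed

text \<open>The upper bound applied to \<open>ft h\<close> times a Gaussian, whose transform is a reflected mollification of \<open>h\<close>,
bounds the mollifications of \<open>h\<close> by \<open>ft h\<close>. Fatou's lemma along a subsequence converging almost everywhere
passes to \<open>h\<close> itself.\<close>

lemma ft_L2_ge:
  assumes h: "integrable lborel h"
  shows "ennreal (2 * pi) * (\<integral>\<^sup>+s. ennreal ((cmod (h s))\<^sup>2) \<partial>lborel) \<le> (\<integral>\<^sup>+t. ennreal ((cmod (ft h t))\<^sup>2) \<partial>lborel)"
proof -
  note [measurable] = borel_measurable_ft[OF h] mollify_measurable[OF h]
  let ?F = "ft h"
  have C: "cmod (?F t) \<le> (LINT s|lborel. cmod (h s))" for t by (rule norm_ft_le)
  have C0: "(LINT s|lborel. cmod (h s)) \<ge> 0" by simp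
  have moll: "ennreal (2 * pi) * (\<integral>\<^sup>+s. ennreal ((cmod (mollify \<delta> h s))\<^sup>2) \<partial>lborel) \<le> (\<integral>\<^sup>+t. ennreal ((cmod (?F t))\<^sup>2) \<partial>lborel)" if d: "\<delta> > 0" for \<delta>
  proof -
    let ?k = "\<lambda>t. ?F t * gauss_weight \<delta> t"
    have k: "integrable lborel ?k"
      by (rule Bochner_Integration.integrable_bound[where f="\<lambda>t. (LINT s|lborel. cmod (h s)) * gauss_weight \<delta> t"])
        (use integrable_gauss_weight[OF d] gauss_weight_bounds C C0 in \<open>auto intro!: AE_I2 mult_right_mono simp: norm_mult less_imp_le\<close>)
    note [measurable] = borel_measurable_ft[OF k]
    have "ennreal (2*pi) * (ennreal (2*pi) * (\<integral>\<^sup>+s. ennreal ((cmod (mollify \<delta> h s))\<^sup>2) \<partial>lborel)) = (\<integral>\<^sup>+s. ennreal ((cmod (2 * pi * mollify \<delta> h s))\<^sup>2) \<partial>lborel)"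
    proof -
      have "ennreal ((cmod (2 * pi * mollify \<delta> h s))\<^sup>2) = ennreal (2*pi) * (ennreal (2*pi) * ennreal ((cmod (mollify \<delta> h s))\<^sup>2))" for s
        by (simp add: norm_mult power2_eq_square mult_ac flip: ennreal_mult)
      then show ?thesis by (simp only:) (subst nn_integral_cmult, measurable)+
    qed
    also have "\<dots> = (\<integral>\<^sup>+s. ennreal ((cmod (ft ?k (- s)))\<^sup>2) \<partial>lborel)"
      by (simp only: ft_mollify[OF d h])
    also have "\<dots> = (\<integral>\<^sup>+s. ennreal ((cmod (ft ?k s))\<^sup>2) \<partial>lborel)"
      using nn_integral_real_affine[of "\<lambda>s. ennreal ((cmod (ft ?k s))\<^sup>2)" "-1" 0] by simp
    also have "\<dots> \<le> ennreal (2*pi) * (\<integral>\<^sup>+t. ennreal ((cmod (?k t))\<^sup>2) \<partial>lborel)" by (rule ft_L2_le[OF k])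
    also have "\<dots> \<le> ennreal (2*pi) * (\<integral>\<^sup>+t. ennreal ((cmod (?F t))\<^sup>2) \<partial>lborel)"
    proof (intro mult_left_mono nn_integral_mono ennreal_leI power_mono)
      show "cmod (?k t) \<le> cmod (?F t)" for t using gauss_weight_bounds[of \<delta> t] by (simp add: norm_mult mult_left_le)
    qed auto
    finally show ?thesis by (subst (asm) ennreal_mult_le_mult_iff) auto
  qed
  let ?\<delta> = "\<lambda>k. 1 / real (Suc k)"
  have dl: "?\<delta> \<longlonglongrightarrow> 0" by (rule LIMSEQ_Suc[OF lim_1_over_n])
  obtain r where r: "strict_mono r" "AE s in lborel. (\<lambda>k. mollify (?\<delta> (r k)) h s) \<longlonglongrightarrow> h s"
    using mollify_AE_subseq[OF h _ dl] by auto
  have "(\<integral>\<^sup>+s. ennreal ((cmod (h s))\<^sup>2) \<partial>lborel) = (\<integral>\<^sup>+s. liminf (\<lambda>k. ennreal ((cmod (mollify (?\<delta> (r k)) h s))\<^sup>2)) \<partial>lborel)"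
  proof (rule nn_integral_cong_AE)
    show "AE s in lborel. ennreal ((cmod (h s))\<^sup>2) = liminf (\<lambda>k. ennreal ((cmod (mollify (?\<delta> (r k)) h s))\<^sup>2))"
      using r(2)
    proof eventually_elim
      case (elim s)
      then have "(\<lambda>k. ennreal ((cmod (mollify (?\<delta> (r k)) h s))\<^sup>2)) \<longlonglongrightarrow> ennreal ((cmod (h s))\<^sup>2)"
        by (intro tendsto_ennrealI tendsto_power tendsto_norm)
      then show ?case by (intro lim_imp_Liminf[symmetric] trivial_limit_sequentially)
    qed
  qed
  also have "\<dots> \<le> liminf (\<lambda>k. \<integral>\<^sup>+s. ennreal ((cmod (mollify (?\<delta> (r k)) h s))\<^sup>2) \<partial>lborel)"
    by (rule nn_integral_liminf) measurable
  also have "\<dots> \<le> liminf (\<lambda>k::nat. (\<integral>\<^sup>+t. ennreal ((cmod (?F t))\<^sup>2) \<partial>lborel) / ennreal (2*pi))"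
  proof (intro Liminf_mono always_eventually allI)
    fix k
    show "(\<integral>\<^sup>+s. ennreal ((cmod (mollify (?\<delta> (r k)) h s))\<^sup>2) \<partial>lborel) \<le> (\<integral>\<^sup>+t. ennreal ((cmod (?F t))\<^sup>2) \<partial>lborel) / ennreal (2*pi)"
      using divide_right_mono_ennreal[OF moll[of "?\<delta> (r k)"], of "ennreal (2*pi)"] by (simp add: mult_divide_eq_ennreal mult.commute[of "ennreal (2*pi)"])
  qed
  also have "\<dots> = (\<integral>\<^sup>+t. ennreal ((cmod (?F t))\<^sup>2) \<partial>lborel) / ennreal (2*pi)" by (simp add: Liminf_const)
  finally have "ennreal (2 * pi) * (\<integral>\<^sup>+s. ennreal ((cmod (h s))\<^sup>2) \<partial>lborel) \<le> ennreal (2 * pi) * ((\<integral>\<^sup>+t. ennreal ((cmod (?F t))\<^sup>2) \<partial>lborel) / ennreal (2*pi))"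
    by (rule mult_left_mono) simp
  also have "\<dots> = (\<integral>\<^sup>+t. ennreal ((cmod (?F t))\<^sup>2) \<partial>lborel)"
    by (simp add: ennreal_times_divide mult_divide_eq_ennreal mult.commute[of "ennreal (2*pi)"])
  finally show ?thesis .
qed

text \<open>Both sides may be infinite.\<close>

theorem plancherel_L1:
  assumes "integrable lborel h"
  shows "(\<integral>\<^sup>+t. ennreal ((cmod (ft h t))\<^sup>2) \<partial>lborel) = ennreal (2 * pi) * (\<integral>\<^sup>+s. ennreal ((cmod (h s))\<^sup>2) \<partial>lborel)"
  using ft_L2_le[OF assms] ft_L2_ge[OF assms] by (rule antisym)

text \<open>The mollifications converge to \<open>h\<close> along a subsequence, and the Gaussian cutoffs may be removed by
dominated convergence because \<open>ft h\<close> is integrable.\<close>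

lemma ft_inversion_AE:
  fixes h :: "real \<Rightarrow> complex"
  assumes h: "integrable lborel h" and F: "integrable lborel (ft h)"
  shows "AE s in lborel. ft (ft h) (- s) = 2 * pi * h s"
proof -
  note [measurable] = borel_measurable_ft[OF h]
  let ?\<delta> = "\<lambda>k. 1 / real (Suc k)"
  have dl: "?\<delta> \<longlonglongrightarrow> 0" by (rule LIMSEQ_Suc[OF lim_1_over_n])
  obtain r where r: "strict_mono r" "AE s in lborel. (\<lambda>k. mollify (?\<delta> (r k)) h s) \<longlonglongrightarrow> h s"
    using mollify_AE_subseq[OF h _ dl] by auto
  have dr: "(\<lambda>k. ?\<delta> (r k)) \<longlonglongrightarrow> 0" using LIMSEQ_subseq_LIMSEQ[OF dl r(1)] by (simp add: comp_def)
  have "(\<lambda>k. ft (\<lambda>t. ft h t * gauss_weight (?\<delta> (r k)) t) (- s)) \<longlonglongrightarrow> ft (ft h) (- s)" for s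
    unfolding ft_def[of _ "-s"]
  proof (rule integral_dominated_convergence[where w="\<lambda>t. cmod (ft h t)"])
    show "AE x in lborel. (\<lambda>k. iexp (- s * x) * (ft h x * gauss_weight (?\<delta> (r k)) x)) \<longlonglongrightarrow> iexp (- s * x) * ft h x"
    proof (rule AE_I2)
      fix x
      have "(\<lambda>k. iexp (- s * x) * (ft h x * complex_of_real (gauss_weight (?\<delta> (r k)) x))) \<longlonglongrightarrow> iexp (- s * x) * (ft h x * complex_of_real 1)"
        by (intro tendsto_mult tendsto_const tendsto_of_real gauss_weight_tendsto_1 dr)
      then show "(\<lambda>k. iexp (- s * x) * (ft h x * gauss_weight (?\<delta> (r k)) x)) \<longlonglongrightarrow> iexp (- s * x) * ft h x" by simp
    qed
    show "AE x in lborel. cmod (iexp (- s * x) * (ft h x * gauss_weight (?\<delta> (r k)) x)) \<le> cmod (ft h x)" for k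
      using gauss_weight_bounds(2)[of "?\<delta> (r k)"] gauss_weight_bounds(1)[of "?\<delta> (r k)"] by (intro AE_I2) (simp add: norm_mult mult_left_le less_imp_le)
  qed (use F in auto)
  then have "(\<lambda>k. 2 * pi * mollify (?\<delta> (r k)) h s) \<longlonglongrightarrow> ft (ft h) (- s)" for s
    by (simp only: ft_mollify[OF _ h, symmetric] zero_less_divide_1_iff of_nat_0_less_iff zero_less_Suc)
  note * = this
  from r(2) show ?thesis
  proof eventually_elim
    case (elim s)
    then have "(\<lambda>k. 2 * pi * mollify (?\<delta> (r k)) h s) \<longlonglongrightarrow> 2 * pi * h s" by (intro tendsto_mult tendsto_const)
    then show ?case using * LIMSEQ_unique by blast
  qed
qed

section \<open>Oscillatory integrals with an injective phase\<close>

lemma lebesgue_integrable_borel_version: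
  fixes u :: "'a::euclidean_space \<Rightarrow> complex"
  assumes "integrable lebesgue u"
  obtains v where "integrable lborel v" "AE x in lborel. u x = v x"
proof -
  have [measurable]: "u \<in> borel_measurable lebesgue" using assms by simp
  have "(\<lambda>x. Re (u x)) \<in> borel_measurable lebesgue" "(\<lambda>x. Im (u x)) \<in> borel_measurable lebesgue" by measurable
  then obtain a b where a: "a \<in> borel_measurable lborel" "AE x in lborel. Re (u x) = a x"
    and b: "b \<in> borel_measurable lborel" "AE x in lborel. Im (u x) = b x"
    using completion_ex_borel_measurable_real by metis
  define v where "v x = Complex (a x) (b x)" for x
  have v: "v \<in> borel_measurable lborel"
    using a(1) b(1) unfolding v_def Complex_eq by measurable
  have eq: "AE x in lborel. u x = v x" using a(2) b(2) by eventually_elim (simp add: v_def complex_eq_iff)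
  then have eq': "AE x in lebesgue. u x = v x" by (rule AE_completion)
  have "v \<in> borel_measurable lebesgue" using v by (rule measurable_completion)
  then have "integrable lebesgue v" using eq' by (intro integrable_cong_AE_imp[OF assms]) auto
  then have "integrable lborel v" using v by (simp add: integrable_completion)
  then show ?thesis using eq that by blast
qed

lemma lebesgue_change_of_variables:
  fixes k :: "real \<Rightarrow> 'a::euclidean_space" and f D :: "real \<Rightarrow> real"
  assumes S: "S \<in> sets lebesgue" and D: "\<And>x. x \<in> S \<Longrightarrow> (f has_field_derivative D x) (at x)" and inj: "inj_on f S"
    and k0: "\<And>s. s \<notin> f ` S \<Longrightarrow> k s = 0"
  shows "integrable lebesgue k \<longleftrightarrow> integrable lebesgue (\<lambda>x. indicator S x *\<^sub>R (\<bar>D x\<bar> *\<^sub>R k (f x)))" (is ?A)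
    "integrable lebesgue k \<Longrightarrow> integral\<^sup>L lebesgue k = (LINT x|lebesgue. indicator S x *\<^sub>R (\<bar>D x\<bar> *\<^sub>R k (f x)))"
proof -
  have D': "(f has_field_derivative D x) (at x within S)" if "x \<in> S" for x
    using D[OF that] by (rule has_field_derivative_at_within)
  have kk: "(\<lambda>s. indicator (f ` S) s *\<^sub>R k s) = k" using k0 by (force simp: indicator_def)
  show A: ?A
    using absolutely_integrable_change_of_variables_real[OF S D' inj, of k] kk by (simp add: set_integrable_def)
  assume "integrable lebesgue k"
  then have 1: "k absolutely_integrable_on f ` S" "(\<lambda>x. \<bar>D x\<bar> *\<^sub>R k (f x)) absolutely_integrable_on S"
    using A kk by (auto simp: set_integrable_def)
  have "integral (f ` S) k = integral S (\<lambda>x. \<bar>D x\<bar> *\<^sub>R k (f x))"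
    using has_absolute_integral_change_of_variables_real[OF S D' inj, of k] 1 by metis
  then have "(LINT s:f ` S|lebesgue. k s) = (LINT x:S|lebesgue. \<bar>D x\<bar> *\<^sub>R k (f x))"
    using set_lebesgue_integral_eq_integral(2)[OF 1(1)] set_lebesgue_integral_eq_integral(2)[OF 1(2)] by simp
  then show "integral\<^sup>L lebesgue k = (LINT x|lebesgue. indicator S x *\<^sub>R (\<bar>D x\<bar> *\<^sub>R k (f x)))"
    using kk by (simp add: set_lebesgue_integral_def)
qed

lemma nn_integral_eq_integral_or_top:
  fixes k :: "'b \<Rightarrow> real"
  assumes "k \<in> borel_measurable M" "\<And>x. k x \<ge> 0"
  shows "(\<integral>\<^sup>+x. ennreal (k x) \<partial>M) = (if integrable M k then ennreal (integral\<^sup>L M k) else \<infinity>)"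
proof (cases "integrable M k")
  case True then show ?thesis using assms by (simp add: nn_integral_eq_integral)
next
  case False
  then have "\<not> (\<integral>\<^sup>+x. ennreal (k x) \<partial>M) < \<infinity>"
    using integrableI_nonneg[OF assms(1) AE_I2[OF assms(2)]] by blast
  then show ?thesis using False by (simp add: less_top[symmetric])
qed

text \<open>The substitution \<open>s = f x\<close> turns the integral into the Fourier transform of \<open>h\<close>, the function with
\<open>h (f x) = m x / |D x|\<close> on \<open>f ` S\<close>. The Jacobian enters \<open>|h|\<^sup>2\<close> twice and the substitution back removes it once.\<close>

lemma oscillatory_plancherel:
  fixes m :: "real \<Rightarrow> complex" and f D :: "real \<Rightarrow> real"
  assumes S: "S \<in> sets borel" and D: "\<And>x. x \<in> S \<Longrightarrow> (f has_field_derivative D x) (at x)" "\<And>x. x \<in> S \<Longrightarrow> D x \<noteq> 0"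
    and Dm: "D \<in> borel_measurable borel" and inj: "inj_on f S"
    and m: "integrable lborel m" and m0: "\<And>x. x \<notin> S \<Longrightarrow> m x = 0"
  shows "(\<integral>\<^sup>+t. ennreal ((cmod (LINT x|lborel. iexp (t * f x) * m x))\<^sup>2) \<partial>lborel)
     = ennreal (2 * pi) * (\<integral>\<^sup>+x. ennreal ((cmod (m x))\<^sup>2 / \<bar>D x\<bar>) \<partial>lborel)"
proof -
  note [measurable] = S Dm borel_measurable_integrable[OF m]
  have Sl: "S \<in> sets lebesgue" using S by auto
  define h where "h s = (if s \<in> f ` S then m (inv_into S f s) / \<bar>D (inv_into S f s)\<bar> else 0)" for s
  have h: "h (f x) = m x / \<bar>D x\<bar>" if "x \<in> S" for x using that inj by (simp add: h_def)
  have h0: "h s = 0" if "s \<notin> f ` S" for s using that by (simp add: h_def)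
  have hm: "indicator S x *\<^sub>R (\<bar>D x\<bar> *\<^sub>R h (f x)) = m x" for x
    using h D(2) m0 by (cases "x \<in> S") (auto simp: scaleR_conv_of_real)
  have ml: "integrable lebesgue m" using m by (simp add: integrable_completion)
  note cov = lebesgue_change_of_variables[OF Sl D(1) inj]
  have hi: "integrable lebesgue h" using cov(1)[of h] h0 hm ml by simp
  \<comment> \<open>The image \<open>f ` S\<close> is only Lebesgue measurable, so \<open>h\<close> is replaced by a Borel function.\<close>
  obtain h' where h': "integrable lborel h'" "AE x in lborel. h x = h' x"
    using lebesgue_integrable_borel_version[OF hi] .
  have [measurable]: "h \<in> borel_measurable lebesgue" using hi by simp
  note [measurable] = borel_measurable_integrable[OF h'(1)]
  have [measurable]: "(\<lambda>s. iexp (t * s)) \<in> borel_measurable lebesgue" for t :: real by (rule measurable_completion) measurable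
  have [measurable]: "h' \<in> borel_measurable lebesgue" by (rule measurable_completion) measurable
  have iexpl: "integrable lebesgue (\<lambda>s. iexp (t * s) * h s)" for t
  proof (rule Bochner_Integration.integrable_bound[OF hi])
    show "(\<lambda>s. iexp (t * s) * h s) \<in> borel_measurable lebesgue" by measurable
  qed (auto simp: norm_mult)
  have osc: "(LINT x|lborel. iexp (t * f x) * m x) = ft h' t" for t
  proof -
    have e: "indicator S x *\<^sub>R (\<bar>D x\<bar> *\<^sub>R (iexp (t * f x) * h (f x))) = iexp (t * f x) * m x" for x
      unfolding hm[symmetric] by (simp add: scaleR_conv_of_real)
    have z: "iexp (t * s) * h s = 0" if "s \<notin> f ` S" for s using h0[OF that] by simp
    have I: "integrable lebesgue (\<lambda>x. iexp (t * f x) * m x)"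
      using cov(1)[of "\<lambda>s. iexp (t * s) * h s"] z iexpl[of t] unfolding e by simp
    have fS: "f \<in> borel_measurable (restrict_space borel S)"
      by (rule borel_measurable_continuous_on_restrict)
        (use D(1) in \<open>auto intro!: continuous_at_imp_continuous_on DERIV_isCont\<close>)
    have fS': "(\<lambda>x. indicator S x *\<^sub>R f x) \<in> borel_measurable borel"
      using fS by (subst (asm) borel_measurable_restrict_space_iff) (use S in auto)
    have "(\<lambda>x. iexp (t * (indicator S x *\<^sub>R f x)) * m x) \<in> borel_measurable lborel" using fS' by measurable
    moreover have "(\<lambda>x. iexp (t * (indicator S x *\<^sub>R f x)) * m x) = (\<lambda>x. iexp (t * f x) * m x)"
      using m0 by (auto simp: fun_eq_iff indicator_def)
    ultimately have meas: "(\<lambda>x. iexp (t * f x) * m x) \<in> borel_measurable lborel" by simp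
    have "(LINT x|lborel. iexp (t * f x) * m x) = (LINT x|lebesgue. iexp (t * f x) * m x)"
      by (rule integral_completion[symmetric, OF meas])
    also have "\<dots> = (LINT s|lebesgue. iexp (t * s) * h s)"
      using cov(2)[of "\<lambda>s. iexp (t * s) * h s"] z iexpl[of t] unfolding e by simp
    also have "\<dots> = (LINT s|lebesgue. iexp (t * s) * h' s)"
    proof (rule integral_cong_AE)
      show "AE s in lebesgue. iexp (t * s) * h s = iexp (t * s) * h' s"
        using AE_completion[OF h'(2)] by eventually_elim simp
    qed measurable
    also have "\<dots> = ft h' t"
      unfolding ft_def by (rule integral_completion) measurable
    finally show ?thesis .
  qed
  have "(\<integral>\<^sup>+s. ennreal ((cmod (h' s))\<^sup>2) \<partial>lborel) = (\<integral>\<^sup>+s. ennreal ((cmod (h s))\<^sup>2) \<partial>lebesgue)"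
    unfolding nn_integral_completion using h'(2) by (intro nn_integral_cong_AE) auto
  also have "\<dots> = (\<integral>\<^sup>+x. ennreal ((cmod (m x))\<^sup>2 / \<bar>D x\<bar>) \<partial>lebesgue)"
  proof -
    have e: "indicator S x *\<^sub>R (\<bar>D x\<bar> *\<^sub>R (cmod (h (f x)))\<^sup>2) = (cmod (m x))\<^sup>2 / \<bar>D x\<bar>" for x
    proof (cases "x \<in> S")
      case True
      have "d * (c / d)\<^sup>2 = c\<^sup>2 / d" if "d > 0" for c d :: real
        using that by (simp add: power2_eq_square)
      from this[of "\<bar>D x\<bar>" "cmod (m x)"] show ?thesis
        using True h[OF True] D(2)[OF True] by (simp add: norm_divide)
    qed (simp add: m0)
    have z: "(cmod (h s))\<^sup>2 = 0" if "s \<notin> f ` S" for s using h0[OF that] by simp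
    have "(\<lambda>x. (cmod (m x))\<^sup>2 / \<bar>D x\<bar>) \<in> borel_measurable lebesgue"
      by (rule measurable_completion) measurable
    then show ?thesis
      using cov[of "\<lambda>s. (cmod (h s))\<^sup>2"] z unfolding e
      by (subst (1 2) nn_integral_eq_integral_or_top) auto
  qed
  finally show ?thesis unfolding osc plancherel_L1[OF h'(1)] nn_integral_completion by simp
qed

section \<open>Radial densities\<close>

text \<open>The derivative in \<open>r\<close> of the volume of the ball of radius \<open>r\<close> in dimension \<open>n\<close>.\<close>

definition radial_weight :: "nat \<Rightarrow> real \<Rightarrow> real" where
  "radial_weight n r = (if 0 \<le> r then real n * unit_ball_vol (real n) * r ^ (n - 1) else 0)"

lemma radial_weight_measurable [measurable]: "radial_weight n \<in> borel_measurable borel"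
  unfolding radial_weight_def by measurable

lemma radial_weight_nonneg: "radial_weight n r \<ge> 0"
  unfolding radial_weight_def by simp

lemma distr_norm_lborel:
  "distr (lborel :: 'a::euclidean_space measure) borel norm = density lborel (radial_weight DIM('a))" (is "?L = ?R")
proof -
  let ?n = "DIM('a)"
  have L: "emeasure ?L {..r} = ennreal (unit_ball_vol ?n * r ^ ?n)" if "r \<ge> 0" for r
  proof -
    have "emeasure ?L {..r} = emeasure lborel (cball (0::'a) r)"
      by (subst emeasure_distr) (auto intro!: arg_cong[where f="emeasure lborel"] simp: cball_def)
    then show ?thesis using that by (simp add: emeasure_cball)
  qed
  have R: "emeasure ?R {..r} = ennreal (unit_ball_vol ?n * r ^ ?n)" if "r \<ge> 0" for r
  proof -
    have "emeasure ?R {..r} = (\<integral>\<^sup>+x. ennreal (real ?n * unit_ball_vol ?n * x ^ (?n - 1)) * indicator {0..r} x \<partial>lborel)"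
      by (subst emeasure_density) (auto intro!: nn_integral_cong simp: radial_weight_def indicator_def)
    also have "\<dots> = ennreal (unit_ball_vol ?n * r ^ ?n - unit_ball_vol ?n * 0 ^ ?n)"
    proof (rule nn_integral_FTC_Icc)
      show "((\<lambda>x. unit_ball_vol ?n * x ^ ?n) has_real_derivative real ?n * unit_ball_vol ?n * x ^ (?n - 1)) (at x)" for x
        by (auto intro!: derivative_eq_intros)
    qed (use that in auto)
    finally show ?thesis by (simp add: zero_power)
  qed
  have neg: "emeasure ?L {..r} = 0" "emeasure ?R {..r} = 0" if "r < 0" for r
  proof -
    have "norm -` {..r} = ({}::'a set)" using that by (auto dest: order_trans[OF norm_ge_zero])
    then show "emeasure ?L {..r} = 0" by (simp add: emeasure_distr)
    show "emeasure ?R {..r} = 0" using that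
      by (subst emeasure_density) (auto simp: nn_integral_0_iff_AE radial_weight_def indicator_def)
  qed
  let ?E = "range (\<lambda>r::real. {..r})"
  have 1: "Int_stable ?E" by (auto simp: Int_stable_def)
  have 2: "emeasure ?L X = emeasure ?R X" if X: "X \<in> ?E" for X
  proof -
    obtain r where "X = {..r}" using X by blast
    then show ?thesis using L[of r] R[of r] neg[of r] by (cases "r < 0") (simp_all only: not_less)
  qed
  have 3: "sets ?L = sigma_sets UNIV ?E" "sets ?R = sigma_sets UNIV ?E"
    by (simp_all add: borel_eq_atMost)
  have 4: "(\<Union>i. {..real i}) = UNIV" using real_arch_simple by auto
  have 5: "emeasure ?L {..real i} \<noteq> \<infinity>" for i by (subst L) auto
  show ?thesis
    by (rule measure_eqI_generator_eq[OF 1 _ 2 3 _ 4 5]) auto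
qed

text \<open>A bound for all set integrals bounds the function: it is tested on the part of \<open>{g > K}\<close> in
\<open>[-N, N]\<close>, whose measure is finite and can be cancelled.\<close>

lemma AE_le_of_measure_le:
  fixes g :: "real \<Rightarrow> ennreal"
  assumes [measurable]: "g \<in> borel_measurable borel"
    and le: "\<And>B. B \<in> sets borel \<Longrightarrow> (\<integral>\<^sup>+x. g x * indicator B x \<partial>lborel) \<le> ennreal K * emeasure lborel B"
  shows "AE x in lborel. g x \<le> ennreal K"
proof -
  have "AE x in lborel. \<not> (g x > ennreal K \<and> \<bar>x\<bar> \<le> real N)" for N :: nat
  proof -
    let ?B = "{x. g x > ennreal K} \<inter> {- real N..real N}"
    have B [measurable]: "?B \<in> sets borel" by measurable
    have "emeasure lborel ?B \<le> emeasure lborel {- real N..real N}" by (rule emeasure_mono) auto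
    then have fin: "emeasure lborel ?B < \<top>" by (rule le_less_trans) auto
    have "(\<integral>\<^sup>+x. (g x - ennreal K) * indicator ?B x \<partial>lborel) + ennreal K * emeasure lborel ?B
       = (\<integral>\<^sup>+x. (g x - ennreal K) * indicator ?B x + ennreal K * indicator ?B x \<partial>lborel)"
      by (subst nn_integral_add) (auto simp: nn_integral_cmult_indicator)
    also have "\<dots> = (\<integral>\<^sup>+x. g x * indicator ?B x \<partial>lborel)"
      by (intro nn_integral_cong) (auto simp: indicator_def diff_add_cancel_ennreal less_imp_le)
    also have "\<dots> \<le> 0 + ennreal K * emeasure lborel ?B" using le[OF B] by simp
    finally have "(\<integral>\<^sup>+x. (g x - ennreal K) * indicator ?B x \<partial>lborel) \<le> 0"
      using fin by (auto simp: ennreal_add_left_cancel_le add.commute[of _ "ennreal K * _"] ennreal_mult_eq_top_iff)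
    then have "AE x in lborel. (g x - ennreal K) * indicator ?B x = 0"
      by (subst nn_integral_0_iff_AE[symmetric]) auto
    then show ?thesis
      by eventually_elim (auto simp: indicator_def split: if_splits dest!: ennreal_minus_eq_0)
  qed
  then have "AE x in lborel. \<forall>N::nat. \<not> (g x > ennreal K \<and> \<bar>x\<bar> \<le> real N)" by (subst AE_all_countable) blast
  then show ?thesis
    by eventually_elim (use real_arch_simple in \<open>force simp: not_less\<close>)
qed

text \<open>The push-forward of \<open>H d\<xi>\<close> under the norm is absolutely continuous because that of Lebesgue measure
is, and the Radon-Nikodym theorem provides the density. If \<open>H\<close> is bounded with bounded support, then so is the
density, as the push-forward is dominated by a multiple of \<open>radial_weight\<close> on a bounded interval.\<close>

lemma radial_density_nonneg:
  fixes H :: "'a::euclidean_space \<Rightarrow> real"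
  assumes H: "integrable lborel H" and H0: "\<And>\<xi>. H \<xi> \<ge> 0"
  shows "\<exists>M :: real \<Rightarrow> real. integrable lborel M \<and> (\<forall>r. M r \<ge> 0) \<and>
    (\<forall>u :: real \<Rightarrow> complex. u \<in> borel_measurable borel \<longrightarrow>
       (LINT \<xi>|lborel. H \<xi> * u (norm \<xi>)) = (LINT r|lborel. M r * u r)) \<and>
    (\<forall>C\<ge>0. \<forall>R. (AE \<xi> in lborel. H \<xi> \<le> C * indicator {..R} (norm \<xi>)) \<longrightarrow> (\<exists>K. AE r in lborel. M r \<le> K))"
proof -
  note [measurable] = borel_measurable_integrable[OF H]
  let ?N = "distr (lborel :: 'a measure) borel norm"
  define \<nu> where "\<nu> = distr (density lborel H) borel norm"
  have \<nu>: "emeasure \<nu> B = (\<integral>\<^sup>+\<xi>. ennreal (H \<xi>) * indicator B (norm \<xi>) \<partial>lborel)" if [measurable]: "B \<in> sets borel" for B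
  proof -
    have [measurable]: "norm -` B \<in> sets (borel :: 'a measure)"
      using measurable_sets[of norm "borel :: 'a measure" borel B] by simp
    have "emeasure \<nu> B = (\<integral>\<^sup>+\<xi>. ennreal (H \<xi>) * indicator (norm -` B) \<xi> \<partial>lborel)"
      unfolding \<nu>_def by (subst emeasure_distr) (auto simp: emeasure_density)
    then show ?thesis by (simp add: indicator_vimage[unfolded comp_def] indicator_def)
  qed
  have ac: "absolutely_continuous lborel \<nu>"
    unfolding absolutely_continuous_def
  proof
    fix B :: "real set" assume B: "B \<in> null_sets lborel"
    then have [measurable]: "B \<in> sets borel" by auto
    have [measurable]: "norm -` B \<in> sets (borel :: 'a measure)"
      using measurable_sets[of norm "borel :: 'a measure" borel B] by simp
    have "emeasure ?N B = (\<integral>\<^sup>+r. ennreal (radial_weight DIM('a) r) * indicator B r \<partial>lborel)"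
      unfolding distr_norm_lborel by (rule emeasure_density) auto
    also have "\<dots> = 0" using B by (simp add: nn_integral_null_set)
    finally have "AE \<xi> in (lborel :: 'a measure). norm \<xi> \<notin> B"
      by (subst (asm) emeasure_distr) (auto intro!: AE_I'[of "norm -` B"] simp: null_sets_def)
    then have "emeasure \<nu> B = 0"
      by (subst \<nu>) (auto simp: nn_integral_0_iff_AE indicator_def)
    then show "B \<in> null_sets \<nu>" by (auto simp: null_sets_def \<nu>_def)
  qed
  obtain g where g [measurable]: "g \<in> borel_measurable lborel" and dg: "density lborel g = \<nu>"
    using sigma_finite_measure.Radon_Nikodym[OF sigma_finite_lborel ac] by (auto simp: \<nu>_def)
  define M where "M r = enn2real (g r)" for r
  have [measurable]: "M \<in> borel_measurable borel" unfolding M_def by measurable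
  have "(\<integral>\<^sup>+r. g r \<partial>lborel) = emeasure \<nu> UNIV" unfolding dg[symmetric] by (simp add: emeasure_density)
  also have "\<dots> = (\<integral>\<^sup>+\<xi>. ennreal (H \<xi>) \<partial>lborel)" by (simp add: \<nu>)
  also have "\<dots> = ennreal (integral\<^sup>L lborel H)" using H H0 by (simp add: nn_integral_eq_integral)
  finally have gint: "(\<integral>\<^sup>+r. g r \<partial>lborel) \<noteq> \<infinity>" by simp
  have gM: "AE r in lborel. g r = ennreal (M r)"
    using nn_integral_PInf_AE[OF _ gint] by (auto simp: M_def top.not_eq_extremum)
  have Mint: "integrable lborel M"
  proof (rule integrableI_nonneg)
    have "(\<integral>\<^sup>+r. ennreal (M r) \<partial>lborel) = (\<integral>\<^sup>+r. g r \<partial>lborel)" using gM by (intro nn_integral_cong_AE) auto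
    then show "(\<integral>\<^sup>+r. ennreal (M r) \<partial>lborel) < \<infinity>" using gint by (simp add: top.not_eq_extremum)
  qed (auto simp: M_def)
  have \<nu>M: "\<nu> = density lborel M" unfolding dg[symmetric] using gM by (intro density_cong) auto
  show ?thesis
  proof (intro exI[of _ M] conjI allI impI Mint)
    show "M r \<ge> 0" for r by (simp add: M_def)
    fix u :: "real \<Rightarrow> complex" assume [measurable]: "u \<in> borel_measurable borel"
    have "(LINT \<xi>|lborel. H \<xi> * u (norm \<xi>)) = (LINT \<xi>|density lborel H. u (norm \<xi>))"
      using H0 by (subst integral_density) (auto simp: scaleR_conv_of_real)
    also have "\<dots> = (LINT r|\<nu>. u r)" unfolding \<nu>_def by (subst integral_distr) auto
    also have "\<dots> = (LINT r|lborel. M r * u r)"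
      unfolding \<nu>M by (subst integral_density) (auto simp: scaleR_conv_of_real M_def)
    finally show "(LINT \<xi>|lborel. H \<xi> * u (norm \<xi>)) = (LINT r|lborel. M r * u r)" .
  next
    fix C R :: real assume C0: "C \<ge> 0" and C: "AE \<xi> in lborel. H \<xi> \<le> C * indicator {..R} (norm \<xi>)"
    let ?n = "DIM('a)"
    define K where "K = C * (real ?n * unit_ball_vol ?n * \<bar>R\<bar> ^ (?n - 1))"
    have "AE r in lborel. g r \<le> ennreal K"
    proof (rule AE_le_of_measure_le)
      fix B :: "real set" assume [measurable]: "B \<in> sets borel"
      have "(\<integral>\<^sup>+r. g r * indicator B r \<partial>lborel) = emeasure \<nu> B"
        unfolding dg[symmetric] by (simp add: emeasure_density)
      also have "\<dots> = (\<integral>\<^sup>+\<xi>. ennreal (H \<xi>) * indicator B (norm \<xi>) \<partial>lborel)" by (rule \<nu>) auto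
      also have "\<dots> \<le> (\<integral>\<^sup>+\<xi>. ennreal C * indicator (B \<inter> {..R}) (norm \<xi>) \<partial>(lborel::'a measure))"
      proof (rule nn_integral_mono_AE)
        show "AE \<xi> in lborel. ennreal (H \<xi>) * indicator B (norm \<xi>) \<le> ennreal C * indicator (B \<inter> {..R}) (norm \<xi>)"
          using C by eventually_elim (auto simp: indicator_def ennreal_leI ennreal_neg split: if_splits)
      qed
      also have "\<dots> = (\<integral>\<^sup>+r. ennreal C * indicator (B \<inter> {..R}) r \<partial>?N)"
        by (subst nn_integral_distr) auto
      also have "\<dots> = (\<integral>\<^sup>+r. ennreal (radial_weight ?n r) * (ennreal C * indicator (B \<inter> {..R}) r) \<partial>lborel)"
        unfolding distr_norm_lborel by (subst nn_integral_density) auto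
      also have "\<dots> \<le> (\<integral>\<^sup>+r. ennreal K * indicator B r \<partial>lborel)"
      proof (rule nn_integral_mono)
        fix r
        have "radial_weight ?n r * C \<le> K" if "r \<le> R"
          unfolding K_def radial_weight_def using that C0
          by (cases "r \<ge> 0") (auto intro!: mult_left_mono power_mono simp: mult.commute[of _ C])
        then show "ennreal (radial_weight ?n r) * (ennreal C * indicator (B \<inter> {..R}) r) \<le> ennreal K * indicator B r"
          using C0 radial_weight_nonneg by (auto simp: indicator_def ennreal_leI simp flip: ennreal_mult)
      qed
      also have "\<dots> = ennreal K * emeasure lborel B" by (simp add: nn_integral_cmult_indicator)
      finally show "(\<integral>\<^sup>+r. g r * indicator B r \<partial>lborel) \<le> ennreal K * emeasure lborel B" .
    qed auto
    then have "AE r in lborel. M r \<le> K"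
      using gM
    proof eventually_elim
      case (elim r)
      have "K \<ge> 0" unfolding K_def using C0 by simp
      then show ?case using elim by simp
    qed
    then show "\<exists>K. AE r in lborel. M r \<le> K" by blast
  qed
qed

text \<open>The complex case, from the positive and negative parts of real and imaginary part. The test
functions \<open>u\<close> are bounded by \<open>1\<close> so that all integrals converge.\<close>

lemma radial_density:
  fixes H :: "'a::euclidean_space \<Rightarrow> complex"
  assumes H: "integrable lborel H"
  shows "\<exists>M. integrable lborel M \<and> (\<forall>r\<le>0. M r = 0) \<and>
    (\<forall>u. u \<in> borel_measurable borel \<longrightarrow> (\<forall>r. cmod (u r) \<le> 1) \<longrightarrow>
       (LINT \<xi>|lborel. H \<xi> * u (norm \<xi>)) = (LINT r|lborel. M r * u r)) \<and>
    (\<forall>C\<ge>0. \<forall>R. (AE \<xi> in lborel. cmod (H \<xi>) \<le> C * indicator {..R} (norm \<xi>)) \<longrightarrow> (\<exists>K. AE r in lborel. cmod (M r) \<le> K))"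
proof -
  define p where "p j \<xi> = max 0 (if j = 0 then Re (H \<xi>) else if j = 1 then - Re (H \<xi>) else if j = 2 then Im (H \<xi>) else - Im (H \<xi>))" for j :: nat and \<xi>
  have p0: "p j \<xi> \<ge> 0" for j \<xi> by (simp add: p_def)
  have pi: "integrable lborel (p j)" for j
    unfolding p_def using H by (cases "j = 0"; cases "j = 1"; cases "j = 2") auto
  have pb: "p j \<xi> \<le> cmod (H \<xi>)" for j \<xi>
    using abs_Re_le_cmod[of "H \<xi>"] abs_Im_le_cmod[of "H \<xi>"] by (auto simp: p_def)
  have Hp: "H \<xi> = p 0 \<xi> - p 1 \<xi> + \<i> * (p 2 \<xi> - p 3 \<xi>)" for \<xi>
    by (auto simp: p_def complex_eq_iff)
  from choice[OF allI[OF radial_density_nonneg[OF pi p0]]]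
  obtain M :: "nat \<Rightarrow> real \<Rightarrow> real" where MM: "\<forall>j. integrable lborel (M j) \<and> (\<forall>r. M j r \<ge> 0) \<and>
    (\<forall>u :: real \<Rightarrow> complex. u \<in> borel_measurable borel \<longrightarrow>
       (LINT \<xi>|lborel. p j \<xi> * u (norm \<xi>)) = (LINT r|lborel. M j r * u r)) \<and>
    (\<forall>C\<ge>0. \<forall>R. (AE \<xi> in lborel. p j \<xi> \<le> C * indicator {..R} (norm \<xi>)) \<longrightarrow> (\<exists>K. AE r in lborel. M j r \<le> K))"
    by (rule exE)
  have M: "integrable lborel (M j)" "M j r \<ge> 0"
    "u \<in> borel_measurable borel \<Longrightarrow> (LINT \<xi>|lborel. p j \<xi> * u (norm \<xi>)) = (LINT r|lborel. M j r * u r)"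
    "C \<ge> 0 \<Longrightarrow> (AE \<xi> in lborel. p j \<xi> \<le> C * indicator {..R} (norm \<xi>)) \<Longrightarrow> (\<exists>K. AE r in lborel. M j r \<le> K)" for j r C R and u :: "real \<Rightarrow> complex"
    using MM by blast+
  define N where "N r = (if r \<le> 0 then 0 else complex_of_real (M 0 r) - M 1 r + \<i> * (complex_of_real (M 2 r) - M 3 r))" for r
  have bi: "integrable N' (\<lambda>x. complex_of_real (q x) * v x)" if "integrable N' q" "v \<in> borel_measurable N'" "\<And>x. cmod (v x) \<le> 1" for N' :: "'b measure" and q :: "'b \<Rightarrow> real" and v
    by (rule Bochner_Integration.integrable_bound[OF that(1)]) (use that borel_measurable_integrable[OF that(1)] in \<open>auto simp: norm_mult mult_left_le\<close>)
  show ?thesis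
  proof (intro exI[of _ N] conjI allI impI)
    have "integrable lborel (\<lambda>r. indicator {0<..} r *\<^sub>R (complex_of_real (M 0 r) - M 1 r + \<i> * (complex_of_real (M 2 r) - M 3 r)))"
      using M(1) by (intro integrable_mult_indicator) auto
    also have "(\<lambda>r. indicator {0<..} r *\<^sub>R (complex_of_real (M 0 r) - M 1 r + \<i> * (complex_of_real (M 2 r) - M 3 r))) = N"
      by (auto simp: N_def indicator_def fun_eq_iff)
    finally show "integrable lborel N" .
    show "N r = 0" if "r \<le> 0" for r using that by (simp add: N_def)
    fix u :: "real \<Rightarrow> complex" assume [measurable]: "u \<in> borel_measurable borel" and u1: "\<forall>r. cmod (u r) \<le> 1"
    define v where "v r = (if r \<le> 0 then 0 else u r)" for r
    have [measurable]: "v \<in> borel_measurable borel" unfolding v_def by measurable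
    have v1: "cmod (v r) \<le> 1" for r using u1 by (simp add: v_def)
    have ip: "integrable lborel (\<lambda>\<xi>. p j \<xi> * v (norm \<xi>))" for j using pi v1 by (intro bi) auto
    have iM: "integrable lborel (\<lambda>r. M j r * v r)" for j using M(1) v1 by (intro bi) auto
    note [measurable] = borel_measurable_integrable[OF H]
    have nz: "AE \<xi> in (lborel :: 'a measure). \<xi> \<noteq> 0" by (rule AE_lborel_singleton)
    have "(LINT \<xi>|lborel. H \<xi> * u (norm \<xi>)) = (LINT \<xi>|lborel. H \<xi> * v (norm \<xi>))"
    proof (rule integral_cong_AE)
      show "AE \<xi> in lborel. H \<xi> * u (norm \<xi>) = H \<xi> * v (norm \<xi>)"
        using nz by eventually_elim (simp add: v_def)
    qed measurable
    also have "\<dots> = (LINT \<xi>|lborel. (p 0 \<xi> * v (norm \<xi>) - p 1 \<xi> * v (norm \<xi>)) + \<i> * (p 2 \<xi> * v (norm \<xi>) - p 3 \<xi> * v (norm \<xi>)))"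
    proof (intro Bochner_Integration.integral_cong refl)
      fix \<xi>
      have "(a - b + \<i> * (c - d)) * e = (a * e - b * e) + \<i> * (c * e - d * e)" for a b c d e :: complex
        by (simp add: algebra_simps)
      then show "H \<xi> * v (norm \<xi>) = (p 0 \<xi> * v (norm \<xi>) - p 1 \<xi> * v (norm \<xi>)) + \<i> * (p 2 \<xi> * v (norm \<xi>) - p 3 \<xi> * v (norm \<xi>))"
        unfolding Hp[of \<xi>] by simp
    qed
    also have "\<dots> = (LINT r|lborel. M 0 r * v r) - (LINT r|lborel. M 1 r * v r) + \<i> * ((LINT r|lborel. M 2 r * v r) - (LINT r|lborel. M 3 r * v r))"
      using ip by (simp add: M(3))
    also have "\<dots> = (LINT r|lborel. (M 0 r * v r - M 1 r * v r) + \<i> * (M 2 r * v r - M 3 r * v r))"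
      using iM by simp
    also have "\<dots> = (LINT r|lborel. N r * u r)"
    proof (intro Bochner_Integration.integral_cong refl)
      show "(M 0 r * v r - M 1 r * v r) + \<i> * (M 2 r * v r - M 3 r * v r) = N r * u r" for r
        by (cases "r \<le> 0") (simp_all add: N_def v_def algebra_simps)
    qed
    finally show "(LINT \<xi>|lborel. H \<xi> * u (norm \<xi>)) = (LINT r|lborel. N r * u r)" .
  next
    fix C R :: real assume C0: "C \<ge> 0" and C: "AE \<xi> in lborel. cmod (H \<xi>) \<le> C * indicator {..R} (norm \<xi>)"
    have "\<exists>K. AE r in lborel. M j r \<le> K" for j
    proof (rule M(4)[OF C0])
      show "AE \<xi> in lborel. p j \<xi> \<le> C * indicator {..R} (norm \<xi>)"
        using C by eventually_elim (rule order_trans[OF pb])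
    qed
    then have "\<forall>j. \<exists>K. AE r in lborel. M j r \<le> K" by blast
    from choice[OF this] obtain K where K: "\<And>j. AE r in lborel. M j r \<le> K j" by blast
    have "AE r in lborel. cmod (N r) \<le> \<bar>K 0\<bar> + \<bar>K 1\<bar> + \<bar>K 2\<bar> + \<bar>K 3\<bar>"
      using K[of 0] K[of 1] K[of 2] K[of 3]
    proof eventually_elim
      case (elim r)
      have "cmod (N r) \<le> cmod (complex_of_real (M 0 r) - M 1 r) + cmod (\<i> * (complex_of_real (M 2 r) - M 3 r))"
        using norm_triangle_ineq[of "complex_of_real (M 0 r) - M 1 r" "\<i> * (complex_of_real (M 2 r) - M 3 r)"]
        by (cases "r \<le> 0") (simp_all add: N_def)
      also have "\<dots> \<le> (M 0 r + M 1 r) + (M 2 r + M 3 r)"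
        using M(2)[of 0 r] M(2)[of 1 r] M(2)[of 2 r] M(2)[of 3 r]
          norm_triangle_ineq4[of "complex_of_real (M 0 r)" "complex_of_real (M 1 r)"]
          norm_triangle_ineq4[of "complex_of_real (M 2 r)" "complex_of_real (M 3 r)"]
        by (intro add_mono) (simp_all add: norm_mult)
      finally show ?case using elim by linarith
    qed
    then show "\<exists>K. AE r in lborel. cmod (N r) \<le> K" by blast
  qed
qed

section \<open>Data with compactly supported Fourier transform\<close>

definition triangle :: "real \<Rightarrow> real \<Rightarrow> real" where
  "triangle \<eta> s = max 0 (\<eta> - \<bar>s\<bar>)"

definition box :: "real \<Rightarrow> real \<Rightarrow> real" where
  "box \<eta> = indicator {- \<eta> / 2..\<eta> / 2}"

lemma box_conv:
  assumes "\<eta> > 0" shows "(LINT y|lborel. box \<eta> y * box \<eta> (s - y)) = triangle \<eta> s"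
proof -
  let ?a = "max (- \<eta> / 2) (s - \<eta> / 2)" and ?b = "min (\<eta> / 2) (s + \<eta> / 2)"
  have "(LINT y|lborel. box \<eta> y * box \<eta> (s - y)) = (LINT y|lborel. indicator {?a..?b} y)"
    by (intro Bochner_Integration.integral_cong) (auto simp: box_def indicator_def)
  also have "\<dots> = triangle \<eta> s"
    using assms by (cases "?a \<le> ?b") (auto simp: triangle_def max_def min_def split: if_splits)
  finally show ?thesis .
qed

lemma integrable_box: "integrable lborel (\<lambda>s. complex_of_real (box \<eta> s))"
  unfolding box_def by (simp add: integrable_indicator_iff emeasure_lborel_Icc_eq)

text \<open>The triangle is the convolution of a box with itself.\<close>

lemma ft_triangle:
  assumes "\<eta> > 0" shows "ft (\<lambda>s. complex_of_real (triangle \<eta> s)) t = (ft (\<lambda>s. complex_of_real (box \<eta> s)) t)\<^sup>2"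
proof -
  have [measurable]: "box \<eta> \<in> borel_measurable borel" unfolding box_def by measurable
  have ib: "integrable lborel (\<lambda>s. iexp (t * s) * complex_of_real (box \<eta> (s - y)))" for y
    using integrable_translate[OF integrable_box, of \<eta> "-y"] by (intro integrable_iexp_mult) simp
  have nb: "(LINT s|lborel. box \<eta> (s - y)) = \<eta>" for y
    using integral_translate[of "box \<eta>" "-y"] assms by (simp add: box_def)
  have int: "integrable (lborel \<Otimes>\<^sub>M lborel) (\<lambda>(y, s). iexp (t * s) * box \<eta> y * box \<eta> (s - y))"
  proof (rule lborel_pair.Fubini_integrable)
    have "(\<lambda>y. LINT s|lborel. cmod (case (y, s) of (y, s) \<Rightarrow> iexp (t * s) * box \<eta> y * box \<eta> (s - y))) = (\<lambda>y. \<bar>box \<eta> y\<bar> * \<eta>)"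
    proof
      fix y
      have "(LINT s|lborel. cmod (case (y, s) of (y, s) \<Rightarrow> iexp (t * s) * box \<eta> y * box \<eta> (s - y))) = (LINT s|lborel. \<bar>box \<eta> y\<bar> * box \<eta> (s - y))"
        by (intro Bochner_Integration.integral_cong) (auto simp: norm_mult box_def)
      then show "(LINT s|lborel. cmod (case (y, s) of (y, s) \<Rightarrow> iexp (t * s) * box \<eta> y * box \<eta> (s - y))) = \<bar>box \<eta> y\<bar> * \<eta>" by (simp add: nb)
    qed
    then show "integrable lborel (\<lambda>y. LINT s|lborel. cmod (case (y, s) of (y, s) \<Rightarrow> iexp (t * s) * box \<eta> y * box \<eta> (s - y)))"
      unfolding box_def by (simp add: integrable_indicator_iff emeasure_lborel_Icc_eq)
    show "AE y in lborel. integrable lborel (\<lambda>s. case (y, s) of (y, s) \<Rightarrow> iexp (t * s) * box \<eta> y * box \<eta> (s - y))"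
    proof (rule AE_I2)
      fix y
      have "integrable lborel (\<lambda>s. box \<eta> y * (iexp (t * s) * box \<eta> (s - y)))"
        by (rule integrable_mult_right[OF ib])
      then show "integrable lborel (\<lambda>s. case (y, s) of (y, s) \<Rightarrow> iexp (t * s) * box \<eta> y * box \<eta> (s - y))"
        by (simp add: mult_ac)
    qed
  qed measurable
  have "ft (\<lambda>s. complex_of_real (triangle \<eta> s)) t = (LINT s|lborel. LINT y|lborel. iexp (t * s) * box \<eta> y * box \<eta> (s - y))"
    unfolding ft_def box_conv[OF assms, symmetric] by (simp add: mult.assoc flip: integral_complex_of_real)
  also have "\<dots> = (LINT y|lborel. LINT s|lborel. iexp (t * s) * box \<eta> y * box \<eta> (s - y))"
    using lborel_pair.Fubini_integral[OF int] by simp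
  also have "\<dots> = (LINT y|lborel. (iexp (t * y) * box \<eta> y) * ft (\<lambda>s. complex_of_real (box \<eta> s)) t)"
  proof (intro Bochner_Integration.integral_cong refl)
    fix y
    have "(LINT s|lborel. iexp (t * s) * box \<eta> y * box \<eta> (s - y)) = (LINT s|lborel. iexp (t * (s + y)) * box \<eta> y * box \<eta> s)"
      using integral_translate[of "\<lambda>s. iexp (t * s) * box \<eta> y * box \<eta> (s - y)" y] by simp
    also have "\<dots> = (LINT s|lborel. (iexp (t * y) * box \<eta> y) * (iexp (t * s) * box \<eta> s))"
      by (intro Bochner_Integration.integral_cong) (simp_all add: ring_distribs exp_add mult_ac)
    finally show "(LINT s|lborel. iexp (t * s) * box \<eta> y * box \<eta> (s - y)) = (iexp (t * y) * box \<eta> y) * ft (\<lambda>s. complex_of_real (box \<eta> s)) t"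
      by (simp add: ft_def)
  qed
  finally show ?thesis by (simp add: ft_def power2_eq_square)
qed

lemma continuous_triangle: "continuous_on UNIV (triangle \<eta>)"
  unfolding triangle_def by (intro continuous_intros)

lemma integrable_triangle:
  assumes "\<eta> > 0" shows "integrable lborel (\<lambda>s. complex_of_real (triangle \<eta> s))"
proof (rule Bochner_Integration.integrable_bound)
  show "integrable lborel (\<lambda>s. \<eta> * indicator {-\<eta>..\<eta>} s :: real)" by (simp add: integrable_indicator_iff emeasure_lborel_Icc_eq)
  show "(\<lambda>s. complex_of_real (triangle \<eta> s)) \<in> borel_measurable lborel"
    unfolding triangle_def by measurable
qed (use assms in \<open>auto simp: triangle_def indicator_def\<close>)

lemma open_AE_empty:
  fixes U :: "'a::euclidean_space set"
  assumes U: "open U" and "AE x in lborel. x \<notin> U"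
  shows "U = {}"
proof -
  have "U \<in> null_sets lborel" using assms by (simp add: AE_iff_null)
  then have "negligible U" unfolding negligible_iff_null_sets by (rule null_sets_completionI)
  then show ?thesis using open_not_negligible[OF U] by blast
qed

text \<open>The function \<open>k\<close> is the transform of the triangle. It is the square of the transform of a box, which is
square integrable by Plancherel's identity; hence \<open>k\<close> is integrable, and inversion recovers the triangle, first
almost everywhere and then everywhere by continuity.\<close>

lemma compactly_supported_transform:
  assumes e: "\<eta> > 0"
  obtains k where "integrable lborel k" "\<And>s. (LINT x|lborel. exp (- \<i> * complex_of_real (x * s)) * k x) = complex_of_real (2 * pi * triangle \<eta> s)"
proof -
  let ?T = "\<lambda>s. complex_of_real (triangle \<eta> s)" and ?B = "\<lambda>s. complex_of_real (box \<eta> s)"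
  have kint: "integrable lborel (ft ?T)"
  proof (rule integrableI_bounded)
    show "ft ?T \<in> borel_measurable lborel" using borel_measurable_ft[OF integrable_triangle[OF e]] by simp
    have "(\<integral>\<^sup>+t. ennreal (cmod (ft ?T t)) \<partial>lborel) = (\<integral>\<^sup>+t. ennreal ((cmod (ft ?B t))\<^sup>2) \<partial>lborel)"
      by (simp add: ft_triangle[OF e] norm_power)
    also have "\<dots> = ennreal (2 * pi) * (\<integral>\<^sup>+s. ennreal ((cmod (?B s))\<^sup>2) \<partial>lborel)"
      by (rule plancherel_L1[OF integrable_box])
    also have "(\<integral>\<^sup>+s. ennreal ((cmod (?B s))\<^sup>2) \<partial>lborel) = (\<integral>\<^sup>+s. indicator {- \<eta> / 2..\<eta> / 2} s \<partial>lborel)"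
      by (intro nn_integral_cong) (auto simp: box_def indicator_def)
    also have "ennreal (2 * pi) * \<dots> < \<infinity>" using e by (simp add: ennreal_mult_less_top)
    finally show "(\<integral>\<^sup>+t. ennreal (cmod (ft ?T t)) \<partial>lborel) < \<infinity>" .
  qed
  let ?d = "\<lambda>s. ft (ft ?T) (- s) - 2 * pi * ?T s"
  have "AE s in lborel. ft (ft ?T) (- s) = 2 * pi * ?T s"
    by (rule ft_inversion_AE[OF integrable_triangle[OF e] kint])
  then have ae: "AE s in lborel. s \<notin> {s. ?d s \<noteq> 0}" by eventually_elim simp
  have op: "open {s. ?d s \<noteq> 0}"
  proof (rule open_Collect_neq)
    show "continuous_on UNIV ?d"
      by (intro continuous_intros continuous_on_compose2[OF continuous_ft[OF kint]] continuous_on_compose2[OF continuous_triangle]) auto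
  qed auto
  have "{s. ?d s \<noteq> 0} = {}" by (rule open_AE_empty[OF op ae])
  then have *: "ft (ft ?T) (- s) = 2 * pi * ?T s" for s by auto
  show ?thesis
  proof (rule that[OF kint])
    show "(LINT x|lborel. exp (- \<i> * complex_of_real (x * s)) * ft ?T x) = complex_of_real (2 * pi * triangle \<eta> s)" for s
      using *[of s] by (subst (asm) ft_def) (simp add: mult_ac)
  qed
qed

text \<open>Lebesgue measure on a Euclidean space is the product of the measures on the coordinate axes.\<close>

lemma basis_product_integral:
  fixes k :: "'a::euclidean_space \<Rightarrow> real \<Rightarrow> complex"
  assumes k: "\<And>b. b \<in> Basis \<Longrightarrow> integrable lborel (k b)"
  shows "integrable lborel (\<lambda>x::'a. \<Prod>b\<in>Basis. k b (x \<bullet> b))"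
    and "(LINT x|lborel. (\<Prod>b\<in>Basis. k b (x \<bullet> b))) = (\<Prod>b\<in>Basis. integral\<^sup>L lborel (k b))"
proof -
  interpret product_sigma_finite "\<lambda>_::'a. lborel :: real measure" by standard
  let ?P = "\<Pi>\<^sub>M b\<in>(Basis::'a set). (lborel :: real measure)"
  have [measurable]: "k b \<in> borel_measurable borel" if "b \<in> Basis" for b using borel_measurable_integrable[OF k[OF that]] by simp
  have meas: "(\<lambda>x::'a. \<Prod>b\<in>Basis. k b (x \<bullet> b)) \<in> borel_measurable borel"
    by (intro borel_measurable_prod) measurable
  have emb: "(\<lambda>f. \<Sum>b\<in>Basis. f b *\<^sub>R b) \<in> measurable ?P (borel :: 'a measure)" by measurable
  have e: "(\<Prod>b\<in>Basis. k b ((\<Sum>c\<in>Basis. f c *\<^sub>R c) \<bullet> b)) = (\<Prod>b\<in>Basis. k b (f b))" for f :: "'a \<Rightarrow> real"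
    by (intro prod.cong) (simp_all add: inner_sum_left_Basis)
  show "integrable lborel (\<lambda>x::'a. \<Prod>b\<in>Basis. k b (x \<bullet> b))"
    unfolding lborel_eq[where 'a='a] by (subst integrable_distr_eq[OF emb meas], unfold e, rule product_integrable_prod) (auto intro: k)
  show "(LINT x|lborel. (\<Prod>b\<in>Basis. k b (x \<bullet> b))) = (\<Prod>b\<in>Basis. integral\<^sup>L lborel (k b))"
    unfolding lborel_eq[where 'a='a] by (subst integral_distr[OF emb meas], unfold e, rule product_integral_prod) (auto intro: k)
qed

lemma lborel_translate:
  fixes h :: "'a::euclidean_space \<Rightarrow> complex"
  assumes h: "integrable lborel h"
  shows "integrable lborel (\<lambda>y. h (y - c))" "(LINT y|lborel. h (y - c)) = integral\<^sup>L lborel h"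
proof -
  note [measurable] = borel_measurable_integrable[OF h]
  have d: "distr lborel borel ((+) (- c)) = (lborel :: 'a measure)" by (rule lborel_distr_plus)
  have [measurable]: "(+) (- c) \<in> measurable lborel (borel :: 'a measure)" by measurable
  show "integrable lborel (\<lambda>y. h (y - c))"
    using h by (subst (asm) d[symmetric], subst (asm) integrable_distr_eq) auto
  show "(LINT y|lborel. h (y - c)) = integral\<^sup>L lborel h"
    by (subst (2) d[symmetric], subst integral_distr) auto
qed

text \<open>A product of one-dimensional kernels in the coordinates of \<open>x\<close>, modulated to centre its transform at
\<open>\<xi>0\<close>. Translation by \<open>x0\<close> only multiplies the transform by a phase, so the same bump \<open>b\<close> serves every \<open>x0\<close>.\<close>

lemma bump_datum:
  fixes \<xi>0 :: "real^'n" and e :: real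
  assumes e: "e > 0"
  obtains b where
    "\<And>x0. \<exists>\<phi>. integrable lebesgue \<phi> \<and> (\<forall>\<xi>. fourier \<phi> \<xi> = exp (- \<i> * complex_of_real (x0 \<bullet> \<xi>)) * complex_of_real (b \<xi>))"
    "continuous_on UNIV b" "\<And>\<xi>. b \<xi> \<ge> 0" "b \<xi>0 > 0" "\<And>\<xi>. dist \<xi> \<xi>0 \<ge> e \<Longrightarrow> b \<xi> = 0"
proof -
  let ?B = "Basis :: (real^'n) set"
  \<comment> \<open>A vector whose coordinates are all below \<open>\<eta>\<close> has norm below \<open>e\<close>.\<close>
  define \<eta> where "\<eta> = e / real (card ?B)"
  have cB: "card ?B > 0" by (simp add: card_gt_0_iff)
  have \<eta>: "\<eta> > 0" using e cB unfolding \<eta>_def by simp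
  obtain k where k: "integrable lborel k" "\<And>s. (LINT x|lborel. exp (- \<i> * complex_of_real (x * s)) * k x) = complex_of_real (2 * pi * triangle \<eta> s)"
    using compactly_supported_transform[OF \<eta>] by blast
  have ik: "integrable lborel (\<lambda>x. iexp (x * s) * k x)" for s
    using integrable_iexp_mult[OF k(1), of s] by (simp add: mult.commute)
  define \<psi> where "\<psi> x = iexp (x \<bullet> \<xi>0) * (\<Prod>c\<in>?B. k (x \<bullet> c))" for x :: "real^'n"
  define b where "b \<xi> = (\<Prod>c\<in>?B. 2 * pi * triangle \<eta> ((\<xi> - \<xi>0) \<bullet> c))" for \<xi>
  have split: "iexp (x \<bullet> \<zeta>) * (\<Prod>c\<in>?B. k (x \<bullet> c)) = (\<Prod>c\<in>?B. iexp ((x \<bullet> c) * (\<zeta> \<bullet> c)) * k (x \<bullet> c))" for x \<zeta> :: "real^'n"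
    by (subst euclidean_inner) (simp add: prod.distrib exp_sum sum_distrib_left)
  have \<psi>i: "integrable lborel \<psi>"
    unfolding \<psi>_def split by (rule basis_product_integral(1)[OF ik])
  have \<psi>F: "(LINT x|lborel. exp (- \<i> * complex_of_real (x \<bullet> \<xi>)) * \<psi> x) = complex_of_real (b \<xi>)" for \<xi>
  proof -
    have "exp (- \<i> * complex_of_real (x \<bullet> \<xi>)) * \<psi> x = (\<Prod>c\<in>?B. exp (\<i> * complex_of_real ((x \<bullet> c) * ((\<xi>0 - \<xi>) \<bullet> c))) * k (x \<bullet> c))" for x
      unfolding split[symmetric] \<psi>_def by (simp add: inner_diff_right ring_distribs flip: exp_add mult.assoc)
    then have "(LINT x|lborel. exp (- \<i> * complex_of_real (x \<bullet> \<xi>)) * \<psi> x) = (\<Prod>c\<in>?B. LINT x|lborel. exp (\<i> * complex_of_real (x * ((\<xi>0 - \<xi>) \<bullet> c))) * k x)"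
      by (simp only: basis_product_integral(2)[OF ik])
    also have "\<dots> = complex_of_real (b \<xi>)"
      unfolding b_def of_real_prod k(2)[symmetric] by (simp add: inner_diff_left algebra_simps)
    finally show ?thesis .
  qed
  have ex: "\<exists>\<phi>. integrable lebesgue \<phi> \<and> (\<forall>\<xi>. fourier \<phi> \<xi> = exp (- \<i> * complex_of_real (x0 \<bullet> \<xi>)) * complex_of_real (b \<xi>))" for x0
  proof -
    let ?\<phi> = "\<lambda>y. \<psi> (y - x0)"
    have \<phi>i: "integrable lborel ?\<phi>" by (rule lborel_translate(1)[OF \<psi>i])
    note [measurable] = borel_measurable_integrable[OF \<phi>i] borel_measurable_integrable[OF \<psi>i]
    show ?thesis
    proof (intro exI[of _ ?\<phi>] conjI allI)
      show "integrable lebesgue ?\<phi>" using \<phi>i by (simp add: integrable_completion)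
      fix \<xi>
      have i: "integrable lborel (\<lambda>x. exp (- \<i> * complex_of_real (x \<bullet> \<xi>)) * \<psi> x)"
        by (rule Bochner_Integration.integrable_bound[OF \<psi>i]) (auto simp: norm_mult)
      have "fourier ?\<phi> \<xi> = (LINT y|lborel. exp (- \<i> * complex_of_real (y \<bullet> \<xi>)) * \<psi> (y - x0))"
        unfolding fourier_def by (rule integral_completion) measurable
      also have "\<dots> = (LINT y|lborel. exp (- \<i> * complex_of_real (x0 \<bullet> \<xi>)) * (exp (- \<i> * complex_of_real ((y - x0) \<bullet> \<xi>)) * \<psi> (y - x0)))"
        by (simp add: inner_diff_left ring_distribs flip: exp_add mult.assoc)
      also have "\<dots> = exp (- \<i> * complex_of_real (x0 \<bullet> \<xi>)) * (LINT y|lborel. exp (- \<i> * complex_of_real ((y - x0) \<bullet> \<xi>)) * \<psi> (y - x0))"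
        by simp
      also have "(LINT y|lborel. exp (- \<i> * complex_of_real ((y - x0) \<bullet> \<xi>)) * \<psi> (y - x0)) = complex_of_real (b \<xi>)"
        using lborel_translate(2)[OF i, of x0] \<psi>F by simp
      finally show "fourier ?\<phi> \<xi> = exp (- \<i> * complex_of_real (x0 \<bullet> \<xi>)) * complex_of_real (b \<xi>)" .
    qed
  qed
  show ?thesis
  proof (rule that[OF ex])
    fix \<xi>
    show "b \<xi> \<ge> 0" unfolding b_def by (intro prod_nonneg) (auto simp: triangle_def)
    show "b \<xi> = 0" if d: "dist \<xi> \<xi>0 \<ge> e"
    proof -
      have "\<exists>c\<in>?B. \<bar>(\<xi> - \<xi>0) \<bullet> c\<bar> \<ge> \<eta>"
      proof (rule ccontr)
        assume "\<not> ?thesis"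
        then have "(\<Sum>c\<in>?B. \<bar>(\<xi> - \<xi>0) \<bullet> c\<bar>) < (\<Sum>c\<in>?B. \<eta>)"
          by (intro sum_strict_mono) (auto simp: not_le)
        also have "\<dots> = e" unfolding \<eta>_def using cB by simp
        finally show False using d norm_le_l1[of "\<xi> - \<xi>0"] by (simp add: dist_norm)
      qed
      then obtain c where c: "c \<in> ?B" "\<bar>(\<xi> - \<xi>0) \<bullet> c\<bar> \<ge> \<eta>" by blast
      then show ?thesis unfolding b_def by (intro prod_zero finite_Basis bexI[of _ c]) (simp_all add: triangle_def)
    qed
  next
    show "continuous_on UNIV b" unfolding b_def triangle_def by (intro continuous_intros)
    show "b \<xi>0 > 0" unfolding b_def using \<eta> by (intro prod_pos) (auto simp: triangle_def)
  qed
qed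

section \<open>Energies in time and in space-time\<close>

lemma AE_lebesgue_iff: "(AE x in lebesgue. P x) \<longleftrightarrow> (AE x in (lborel::'a::euclidean_space measure). P x)"
  by (simp add: AE_completion_iff)

text \<open>The density of the push-forward of \<open>H d\<xi>\<close> under the norm, characterised by its integrals against
test functions.\<close>

definition radial_profile :: "(real^'n \<Rightarrow> complex) \<Rightarrow> (real \<Rightarrow> complex) \<Rightarrow> bool" where
  "radial_profile H M \<longleftrightarrow> integrable lebesgue H \<and> integrable lborel M \<and>
     (\<forall>u. u \<in> borel_measurable borel \<longrightarrow> (\<forall>r. cmod (u r) \<le> 1) \<longrightarrow>
        (LINT \<xi>|lebesgue. H \<xi> * u (norm \<xi>)) = (LINT r|lborel. M r * u r))"

text \<open>The density may be cut off outside \<open>E\<close>, since \<open>H\<close> lives where \<open>|\<xi>| \<in> E\<close>.\<close>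

lemma radial_profile_exists:
  fixes H :: "real^'n \<Rightarrow> complex"
  assumes H: "integrable lebesgue H" and E: "E \<in> sets borel"
    and supp: "AE \<xi> in lebesgue. H \<xi> \<noteq> 0 \<longrightarrow> norm \<xi> \<in> E"
  obtains M where "radial_profile H M" "\<And>r. r \<notin> E \<Longrightarrow> M r = 0"
    "\<And>C R. C \<ge> 0 \<Longrightarrow> AE \<xi> in lebesgue. cmod (H \<xi>) \<le> C * indicator {..R} (norm \<xi>) \<Longrightarrow> \<exists>K. AE r in lborel. cmod (M r) \<le> K"
proof -
  obtain G where G: "integrable lborel G" "AE \<xi> in lborel. H \<xi> = G \<xi>"
    using lebesgue_integrable_borel_version[OF H] .
  note [measurable] = borel_measurable_integrable[OF G(1)] E
  have [measurable]: "H \<in> borel_measurable lebesgue" using H by simp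
  obtain N where N: "integrable lborel N"
    "\<And>u. u \<in> borel_measurable borel \<Longrightarrow> (\<And>r. cmod (u r) \<le> 1) \<Longrightarrow> (LINT \<xi>|lborel. G \<xi> * u (norm \<xi>)) = (LINT r|lborel. N r * u r)"
    "\<And>C R. C \<ge> 0 \<Longrightarrow> AE \<xi> in lborel. cmod (G \<xi>) \<le> C * indicator {..R} (norm \<xi>) \<Longrightarrow> \<exists>K. AE r in lborel. cmod (N r) \<le> K"
    using radial_density[OF G(1)] by blast
  define M where "M r = indicator E r *\<^sub>R N r" for r
  show ?thesis
  proof (rule that)
    show "radial_profile H M"
      unfolding radial_profile_def
    proof (intro conjI allI impI H)
      show "integrable lborel M" unfolding M_def using N(1) E by (intro integrable_mult_indicator) auto
      fix u :: "real \<Rightarrow> complex" assume [measurable]: "u \<in> borel_measurable borel" and u: "\<forall>r. cmod (u r) \<le> 1"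
      have [measurable]: "(\<lambda>\<xi>::real^'n. u (norm \<xi>)) \<in> borel_measurable lebesgue"
        by (rule measurable_completion) measurable
      have [measurable]: "(\<lambda>\<xi>::real^'n. indicator E (norm \<xi>) *\<^sub>R u (norm \<xi>)) \<in> borel_measurable lebesgue"
        by (rule measurable_completion) measurable
      have [measurable]: "G \<in> borel_measurable lebesgue"
        by (rule measurable_completion) measurable
      have "(LINT \<xi>|lebesgue. H \<xi> * u (norm \<xi>)) = (LINT \<xi>|lebesgue. G \<xi> * (indicator E (norm \<xi>) *\<^sub>R u (norm \<xi>)))"
      proof (rule integral_cong_AE)
        show "AE \<xi> in lebesgue. H \<xi> * u (norm \<xi>) = G \<xi> * (indicator E (norm \<xi>) *\<^sub>R u (norm \<xi>))"
          using supp AE_completion[OF G(2)] by eventually_elim (auto simp: indicator_def)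
      qed measurable
      also have "\<dots> = (LINT \<xi>|lborel. G \<xi> * (indicator E (norm \<xi>) *\<^sub>R u (norm \<xi>)))"
        by (rule integral_completion) measurable
      also have "\<dots> = (LINT r|lborel. N r * (indicator E r *\<^sub>R u r))"
        by (rule N(2)) (use u in \<open>auto simp: indicator_def\<close>)
      also have "\<dots> = (LINT r|lborel. M r * u r)" by (simp add: M_def)
      finally show "(LINT \<xi>|lebesgue. H \<xi> * u (norm \<xi>)) = (LINT r|lborel. M r * u r)" .
    qed
    show "M r = 0" if "r \<notin> E" for r using that by (simp add: M_def)
    show "\<exists>K. AE r in lborel. cmod (M r) \<le> K" if C: "C \<ge> 0" "AE \<xi> in lebesgue. cmod (H \<xi>) \<le> C * indicator {..R} (norm \<xi>)" for C R
    proof -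
      have "AE \<xi> in lborel. cmod (G \<xi>) \<le> C * indicator {..R} (norm \<xi>)"
        using C(2)[unfolded AE_lebesgue_iff] G(2) by eventually_elim simp
      then obtain K where "AE r in lborel. cmod (N r) \<le> K" using N(3)[OF C(1)] by blast
      then have "AE r in lborel. cmod (M r) \<le> \<bar>K\<bar>" by eventually_elim (auto simp: M_def indicator_def)
      then show ?thesis by blast
    qed
  qed
qed

lemma measurable_on_set:
  fixes \<sigma> :: "real \<Rightarrow> 'b::real_normed_vector"
  assumes "continuous_on {0<..} \<sigma>" "E \<in> sets borel" "E \<subseteq> {0<..}"
  shows "(\<lambda>\<rho>. if \<rho> \<in> E then \<sigma> \<rho> else 0) \<in> borel_measurable borel"
proof -
  have "(\<lambda>\<rho>. indicator E \<rho> *\<^sub>R \<sigma> \<rho>) \<in> borel_measurable borel"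
    using continuous_on_subset[OF assms(1,3)] assms(2) by (rule borel_measurable_continuous_on_indicator[rotated])
  also have "(\<lambda>\<rho>. indicator E \<rho> *\<^sub>R \<sigma> \<rho>) = (\<lambda>\<rho>. if \<rho> \<in> E then \<sigma> \<rho> else 0)" by (auto simp: indicator_def)
  finally show ?thesis .
qed

lemma C1_on_positives:
  fixes f :: "real \<Rightarrow> real"
  assumes "f C1_differentiable_on {0<..}"
  shows "\<And>\<rho>. \<rho> > 0 \<Longrightarrow> (f has_field_derivative deriv f \<rho>) (at \<rho>)" "continuous_on {0<..} (deriv f)" "continuous_on {0<..} f"
proof -
  obtain D where D: "\<And>\<rho>. \<rho> \<in> {0<..} \<Longrightarrow> (f has_vector_derivative D \<rho>) (at \<rho>)" "continuous_on {0<..} D"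
    using assms unfolding C1_differentiable_on_def by blast
  have d: "deriv f \<rho> = D \<rho>" if "\<rho> > 0" for \<rho>
    using D(1)[of \<rho>] that by (intro DERIV_imp_deriv) (simp add: has_real_derivative_iff_has_vector_derivative)
  then show 1: "(f has_field_derivative deriv f \<rho>) (at \<rho>)" if "\<rho> > 0" for \<rho>
    using D(1)[of \<rho>] that by (simp add: has_real_derivative_iff_has_vector_derivative)
  show "continuous_on {0<..} (deriv f)" using D(2) d by (subst continuous_on_cong[OF refl]) auto
  show "continuous_on {0<..} f" using 1 by (auto intro!: continuous_at_imp_continuous_on DERIV_isCont)
qed

definition time_energy ::
    "(real \<Rightarrow> complex) \<Rightarrow> (real \<Rightarrow> complex) \<Rightarrow> (real \<Rightarrow> real) \<Rightarrow> (real^'n \<Rightarrow> complex) \<Rightarrow> real^'n \<Rightarrow> ennreal" where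
  "time_energy chi \<sigma> f \<phi> x = (\<integral>\<^sup>+t. ennreal ((cmod (evolution chi \<sigma> f \<phi> t x))\<^sup>2) \<partial>lborel)"

text \<open>The contribution of the frequency \<open>\<rho>\<close> to the energy, per unit of \<open>|M(\<rho>)|\<^sup>2\<close>, of the flow with symbol
\<open>\<sigma>\<close> and phase \<open>f\<close> if amplitudes are normalised by \<open>wt\<close>. If \<open>|\<sigma>| \<le> wt\<close> then \<open>\<sigma>\<close> vanishes
where \<open>wt\<close> does, and the value \<open>0\<close> of the quotient there is the correct one.\<close>

definition energy_density :: "(real \<Rightarrow> complex) \<Rightarrow> (real \<Rightarrow> real) \<Rightarrow> (real \<Rightarrow> real) \<Rightarrow> real \<Rightarrow> real" where
  "energy_density \<sigma> wt f \<rho> = (cmod (\<sigma> \<rho>) / wt \<rho>)\<^sup>2 / \<bar>deriv f \<rho>\<bar>"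

text \<open>In polar form the evolution is an oscillatory integral in one variable with phase \<open>t f\<close> and amplitude
\<open>M \<sigma> / wt\<close>. The normalising weight \<open>wt\<close> is arbitrary so that one profile \<open>M\<close> can serve two symbols.\<close>

lemma evolution_L2:
  fixes \<phi> :: "real^'n \<Rightarrow> complex" and x :: "real^'n"
  assumes f: "f C1_differentiable_on {0<..}"
    and E: "E \<in> sets borel" "E \<subseteq> {0<..}" "inj_on f E" "\<And>\<rho>. \<rho> \<in> E \<Longrightarrow> deriv f \<rho> \<noteq> 0"
    and \<sigma>: "continuous_on {0<..} \<sigma>" and wt: "continuous_on {0<..} wt" "\<And>\<rho>. cmod (\<sigma> \<rho>) \<le> wt \<rho>"
    and supp: "AE \<xi> in lebesgue. chi (norm \<xi>) * fourier \<phi> \<xi> \<noteq> 0 \<longrightarrow> norm \<xi> \<in> E"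
    and q: "integrable lebesgue (\<lambda>\<xi>. chi (norm \<xi>) * \<sigma> (norm \<xi>) * fourier \<phi> \<xi>)"
    and M: "radial_profile (\<lambda>\<xi>. iexp (x \<bullet> \<xi>) * chi (norm \<xi>) * complex_of_real (wt (norm \<xi>)) * fourier \<phi> \<xi>) M"
    and M0: "\<And>\<rho>. \<rho> \<notin> E \<Longrightarrow> M \<rho> = 0"
  shows "time_energy chi \<sigma> f \<phi> x =
    ennreal (2 * pi * (1 / (2 * pi) ^ CARD('n))\<^sup>2) * (\<integral>\<^sup>+\<rho>. ennreal ((cmod (M \<rho>))\<^sup>2 * energy_density \<sigma> wt f \<rho>) \<partial>lborel)"
proof -
  note C1 = C1_on_positives[OF f]
  let ?c = "1 / (2 * pi) ^ CARD('n)"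
  define \<theta> where "\<theta> \<rho> = (if \<rho> \<in> E then \<sigma> \<rho> else 0) / complex_of_real (if \<rho> \<in> E then wt \<rho> else 0)" for \<rho>
  define D where "D \<rho> = (if \<rho> \<in> E then deriv f \<rho> else 0)" for \<rho>
  have Dm [measurable]: "D \<in> borel_measurable borel" unfolding D_def by (rule measurable_on_set[OF C1(2) E(1,2)])
  have Em [measurable]: "E \<in> sets borel" by (rule E)
  have \<theta>m [measurable]: "\<theta> \<in> borel_measurable borel"
    unfolding \<theta>_def using measurable_on_set[OF \<sigma> E(1,2)] measurable_on_set[OF wt(1) E(1,2)] by measurable
  have wt0: "wt \<rho> \<ge> 0" for \<rho> using wt(2)[of \<rho>] norm_ge_zero order_trans by blast
  have \<theta>w: "complex_of_real (wt \<rho>) * \<theta> \<rho> = \<sigma> \<rho>" if "\<rho> \<in> E" for \<rho>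
    using wt(2)[of \<rho>] that by (cases "wt \<rho> = 0") (auto simp: \<theta>_def)
  have \<theta>1: "cmod (\<theta> \<rho>) \<le> 1" for \<rho>
    using wt(2)[of \<rho>] wt0[of \<rho>] by (auto simp: \<theta>_def norm_divide divide_le_eq_1)
  have \<theta>0: "\<theta> \<rho> = 0" if "\<rho> \<notin> E" for \<rho> using that by (simp add: \<theta>_def)
  note Mi = M[unfolded radial_profile_def]
  have MI: "integrable lborel M" using Mi by blast
  have Mu: "(LINT \<xi>|lebesgue. iexp (x \<bullet> \<xi>) * chi (norm \<xi>) * complex_of_real (wt (norm \<xi>)) * fourier \<phi> \<xi> * u (norm \<xi>)) = (LINT r|lborel. M r * u r)"
    if "u \<in> borel_measurable borel" "\<And>r. cmod (u r) \<le> 1" for u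
    using Mi that by blast
  note [measurable] = borel_measurable_integrable[OF MI]
  let ?H = "\<lambda>\<xi>. iexp (x \<bullet> \<xi>) * chi (norm \<xi>) * complex_of_real (wt (norm \<xi>)) * fourier \<phi> \<xi>"
  have Hm [measurable]: "?H \<in> borel_measurable lebesgue" using Mi by auto
  define m where "m \<rho> = M \<rho> * \<theta> \<rho>" for \<rho>
  have mi: "integrable lborel m" unfolding m_def
    by (rule Bochner_Integration.integrable_bound[OF MI]) (use \<theta>1 in \<open>auto simp: norm_mult mult_left_le\<close>)
  have ev: "evolution chi \<sigma> f \<phi> t x = complex_of_real ?c * (LINT \<rho>|lborel. iexp (t * f \<rho>) * m \<rho>)" for t
  proof -
    define fE where "fE \<rho> = (if \<rho> \<in> E then f \<rho> else 0)" for \<rho>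
    \<comment> \<open>The functions \<open>fp\<close> and \<open>f\<close> agree at every \<open>|\<xi>|\<close>, including \<open>|\<xi>| = 0\<close>, and \<open>fp\<close> is Borel; \<open>f\<close> need not be.\<close>
    define fp where "fp \<rho> = (if \<rho> \<in> {0<..} then f \<rho> else 0) + (if \<rho> > 0 then 0 else f 0)" for \<rho>
    have [measurable]: "fE \<in> borel_measurable borel"
      unfolding fE_def by (rule measurable_on_set[OF C1(3) E(1,2)])
    have [measurable]: "fp \<in> borel_measurable borel"
      unfolding fp_def using measurable_on_set[OF C1(3), of "{0<..}"] by measurable
    have fp: "fp (norm \<xi>) = f (norm \<xi>)" for \<xi> :: "real^'n" by (cases "\<xi> = 0") (auto simp: fp_def)
    let ?u = "\<lambda>\<rho>. \<theta> \<rho> * iexp (t * fE \<rho>)"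
    have [measurable]: "(\<lambda>\<xi>::real^'n. ?u (norm \<xi>)) \<in> borel_measurable lebesgue"
      by (rule measurable_completion) measurable
    have [measurable]: "(\<lambda>\<xi>::real^'n. iexp (x \<bullet> \<xi>) * iexp (t * fp (norm \<xi>))) \<in> borel_measurable lebesgue"
      by (rule measurable_completion) measurable
    have [measurable]: "(\<lambda>\<xi>. chi (norm \<xi>) * \<sigma> (norm \<xi>) * fourier \<phi> \<xi>) \<in> borel_measurable lebesgue" using q by simp
    have "(LINT \<xi>|lebesgue. iexp (x \<bullet> \<xi>) * (chi (norm \<xi>) * \<sigma> (norm \<xi>) * iexp (t * f (norm \<xi>))) * fourier \<phi> \<xi>)
       = (LINT \<xi>|lebesgue. (iexp (x \<bullet> \<xi>) * iexp (t * fp (norm \<xi>))) * (chi (norm \<xi>) * \<sigma> (norm \<xi>) * fourier \<phi> \<xi>))"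
      by (simp add: fp mult_ac)
    also have "\<dots> = (LINT \<xi>|lebesgue. ?H \<xi> * ?u (norm \<xi>))"
    proof (rule integral_cong_AE)
      show "AE \<xi> in lebesgue. (iexp (x \<bullet> \<xi>) * iexp (t * fp (norm \<xi>))) * (chi (norm \<xi>) * \<sigma> (norm \<xi>) * fourier \<phi> \<xi>) = ?H \<xi> * ?u (norm \<xi>)"
        using supp
      proof eventually_elim
        case (elim \<xi>)
        show ?case
        proof (cases "chi (norm \<xi>) * fourier \<phi> \<xi> = 0")
          case True then show ?thesis by auto
        next
          case False
          then have "norm \<xi> \<in> E" using elim by blast
          then show ?thesis using \<theta>w[of "norm \<xi>", symmetric] by (simp add: fp fE_def mult_ac)
        qed
      qed
    qed measurable
    also have "\<dots> = (LINT \<rho>|lborel. M \<rho> * ?u \<rho>)"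
      by (rule Mu) (measurable, simp add: norm_mult \<theta>1)
    also have "\<dots> = (LINT \<rho>|lborel. iexp (t * f \<rho>) * m \<rho>)"
      by (intro Bochner_Integration.integral_cong refl) (auto simp: m_def fE_def \<theta>0)
    finally show ?thesis unfolding evolution_def radial_multiplier_def by simp
  qed
  have "(\<integral>\<^sup>+t. ennreal ((cmod (evolution chi \<sigma> f \<phi> t x))\<^sup>2) \<partial>lborel) = (\<integral>\<^sup>+t. ennreal (?c\<^sup>2) * ennreal ((cmod (LINT \<rho>|lborel. iexp (t * f \<rho>) * m \<rho>))\<^sup>2) \<partial>lborel)"
  proof (intro nn_integral_cong)
    have "(cmod (complex_of_real c * z))\<^sup>2 = c\<^sup>2 * (cmod z)\<^sup>2" for c z
      by (simp only: norm_mult power_mult_distrib norm_of_real power2_abs)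
    then show "ennreal ((cmod (evolution chi \<sigma> f \<phi> t x))\<^sup>2) = ennreal (?c\<^sup>2) * ennreal ((cmod (LINT \<rho>|lborel. iexp (t * f \<rho>) * m \<rho>))\<^sup>2)" for t
      unfolding ev by (simp only: ennreal_mult zero_le_power2)
  qed
  also have "\<dots> = ennreal (?c\<^sup>2) * (\<integral>\<^sup>+t. ennreal ((cmod (LINT \<rho>|lborel. iexp (t * f \<rho>) * m \<rho>))\<^sup>2) \<partial>lborel)"
  proof (rule nn_integral_cmult)
    have fEm: "(\<lambda>\<rho>. if \<rho> \<in> E then f \<rho> else 0) \<in> borel_measurable borel" by (rule measurable_on_set[OF C1(3) E(1,2)])
    have "(LINT \<rho>|lborel. iexp (t * f \<rho>) * m \<rho>) = (LINT \<rho>|lborel. iexp (t * (if \<rho> \<in> E then f \<rho> else 0)) * m \<rho>)" for t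
      by (intro Bochner_Integration.integral_cong refl) (auto simp: m_def \<theta>0)
    then show "(\<lambda>t. ennreal ((cmod (LINT \<rho>|lborel. iexp (t * f \<rho>) * m \<rho>))\<^sup>2)) \<in> borel_measurable lborel"
      using fEm borel_measurable_integrable[OF mi] by simp
  qed
  also have "(\<integral>\<^sup>+t. ennreal ((cmod (LINT \<rho>|lborel. iexp (t * f \<rho>) * m \<rho>))\<^sup>2) \<partial>lborel) = ennreal (2 * pi) * (\<integral>\<^sup>+\<rho>. ennreal ((cmod (m \<rho>))\<^sup>2 / \<bar>D \<rho>\<bar>) \<partial>lborel)"
    by (rule oscillatory_plancherel[OF Em _ _ Dm E(3) mi]) (use E C1(1) in \<open>auto simp: D_def m_def \<theta>0\<close>)
  also have "(\<integral>\<^sup>+\<rho>. ennreal ((cmod (m \<rho>))\<^sup>2 / \<bar>D \<rho>\<bar>) \<partial>lborel) = (\<integral>\<^sup>+\<rho>. ennreal ((cmod (M \<rho>))\<^sup>2 * ((cmod (\<sigma> \<rho>) / wt \<rho>)\<^sup>2 / \<bar>deriv f \<rho>\<bar>)) \<partial>lborel)"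
  proof (intro nn_integral_cong)
    fix \<rho>
    show "ennreal ((cmod (m \<rho>))\<^sup>2 / \<bar>D \<rho>\<bar>) = ennreal ((cmod (M \<rho>))\<^sup>2 * ((cmod (\<sigma> \<rho>) / wt \<rho>)\<^sup>2 / \<bar>deriv f \<rho>\<bar>))"
      using wt0[of \<rho>] by (cases "\<rho> \<in> E") (auto simp: m_def D_def \<theta>_def M0 norm_mult norm_divide power_mult_distrib power_divide)
  qed
  also have "ennreal (?c\<^sup>2) * (ennreal (2 * pi) * (\<integral>\<^sup>+\<rho>. ennreal ((cmod (M \<rho>))\<^sup>2 * ((cmod (\<sigma> \<rho>) / wt \<rho>)\<^sup>2 / \<bar>deriv f \<rho>\<bar>)) \<partial>lborel))
    = ennreal (2 * pi * ?c\<^sup>2) * (\<integral>\<^sup>+\<rho>. ennreal ((cmod (M \<rho>))\<^sup>2 * ((cmod (\<sigma> \<rho>) / wt \<rho>)\<^sup>2 / \<bar>deriv f \<rho>\<bar>)) \<partial>lborel)"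
    by (simp only: ennreal_mult mult_ac zero_le_power2 pi_ge_zero zero_le_mult_iff zero_le_numeral simp_thms)
  finally show ?thesis unfolding time_energy_def energy_density_def .
qed

text \<open>Comparisons of norms are comparisons of the integrals of the squares, the value \<open>\<infinity>\<close> included.\<close>

lemma L2_ennorm_le_iff:
  fixes u v :: "'a::euclidean_space \<Rightarrow> complex"
  assumes "A > 0"
  shows "L2_ennorm u \<le> ennreal A * L2_ennorm v \<longleftrightarrow>
    (\<integral>\<^sup>+ z. ennreal ((cmod (u z))\<^sup>2) \<partial>lborel) \<le> ennreal (A\<^sup>2) * (\<integral>\<^sup>+ z. ennreal ((cmod (v z))\<^sup>2) \<partial>lborel)"
proof -
  have *: "(if I = \<infinity> then \<infinity> else ennreal (sqrt (enn2real I))) \<le> ennreal A * (if J = \<infinity> then \<infinity> else ennreal (sqrt (enn2real J)))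
    \<longleftrightarrow> I \<le> ennreal (A\<^sup>2) * J" for I J :: ennreal
  proof (cases I; cases J)
    fix i j :: real assume [simp]: "i \<ge> 0" "I = ennreal i" "j \<ge> 0" "J = ennreal j"
    have "A * sqrt j = sqrt (A\<^sup>2 * j)" using assms by (simp add: real_sqrt_mult)
    then show ?thesis using assms by (simp flip: ennreal_mult)
  qed (use assms in \<open>auto simp: ennreal_mult_top ennreal_top_mult top_unique simp flip: ennreal_mult\<close>)
  show ?thesis unfolding L2_ennorm_def Let_def nn_integral_completion by (rule *)
qed

lemma L2_ennorm_finite_iff:
  fixes u :: "'a::euclidean_space \<Rightarrow> complex"
  shows "L2_ennorm u < \<infinity> \<longleftrightarrow> (\<integral>\<^sup>+ z. ennreal ((cmod (u z))\<^sup>2) \<partial>lborel) < \<infinity>"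
  unfolding L2_ennorm_def Let_def nn_integral_completion by (auto simp: less_top)

text \<open>The evolution is a Borel function of \<open>(t, x)\<close>, being a parameter integral with a Borel integrand once
the amplitude and the phase are replaced by Borel functions.\<close>

lemma evolution_borel:
  fixes \<phi> :: "real^'n \<Rightarrow> complex"
  assumes f: "f C1_differentiable_on {0<..}"
    and q: "integrable lebesgue (\<lambda>\<xi>. chi (norm \<xi>) * \<sigma> (norm \<xi>) * fourier \<phi> \<xi>)"
  shows "(\<lambda>(t, x). evolution chi \<sigma> f \<phi> t x) \<in> borel_measurable (lborel \<Otimes>\<^sub>M lborel)"
proof -
  obtain r where r: "integrable lborel r" "AE \<xi> in lborel. chi (norm \<xi>) * \<sigma> (norm \<xi>) * fourier \<phi> \<xi> = r \<xi>"
    using lebesgue_integrable_borel_version[OF q] .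
  define fp where "fp \<rho> = (if \<rho> \<in> {0<..} then f \<rho> else 0) + (if \<rho> > 0 then 0 else f 0)" for \<rho>
  have [measurable]: "fp \<in> borel_measurable borel"
    unfolding fp_def using measurable_on_set[OF C1_on_positives(3)[OF f], of "{0<..}"] by measurable
  have fp: "fp (norm \<xi>) = f (norm \<xi>)" for \<xi> :: "real^'n" by (cases "\<xi> = 0") (auto simp: fp_def)
  note [measurable] = borel_measurable_integrable[OF r(1)]
  have [measurable]: "r \<in> borel_measurable lebesgue" by (rule measurable_completion) measurable
  have [measurable]: "(\<lambda>\<xi>. chi (norm \<xi>) * \<sigma> (norm \<xi>) * fourier \<phi> \<xi>) \<in> borel_measurable lebesgue" using q by simp
  have ev: "evolution chi \<sigma> f \<phi> t x = complex_of_real (1 / (2 * pi) ^ CARD('n)) *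
      (LINT \<xi>|lborel. (iexp (x \<bullet> \<xi>) * iexp (t * fp (norm \<xi>))) * r \<xi>)" for t x
  proof -
    have [measurable]: "(\<lambda>\<xi>::real^'n. iexp (x \<bullet> \<xi>) * iexp (t * fp (norm \<xi>))) \<in> borel_measurable lebesgue"
      by (rule measurable_completion) measurable
    have "(LINT \<xi>|lebesgue. iexp (x \<bullet> \<xi>) * (chi (norm \<xi>) * \<sigma> (norm \<xi>) * iexp (t * f (norm \<xi>))) * fourier \<phi> \<xi>)
       = (LINT \<xi>|lebesgue. (iexp (x \<bullet> \<xi>) * iexp (t * fp (norm \<xi>))) * (chi (norm \<xi>) * \<sigma> (norm \<xi>) * fourier \<phi> \<xi>))"
      by (simp add: fp mult_ac)
    also have "\<dots> = (LINT \<xi>|lebesgue. (iexp (x \<bullet> \<xi>) * iexp (t * fp (norm \<xi>))) * r \<xi>)"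
    proof (rule integral_cong_AE)
      show "AE \<xi> in lebesgue. (iexp (x \<bullet> \<xi>) * iexp (t * fp (norm \<xi>))) * (chi (norm \<xi>) * \<sigma> (norm \<xi>) * fourier \<phi> \<xi>)
         = (iexp (x \<bullet> \<xi>) * iexp (t * fp (norm \<xi>))) * r \<xi>"
        using AE_completion[OF r(2)] by eventually_elim simp
    qed measurable
    also have "\<dots> = (LINT \<xi>|lborel. (iexp (x \<bullet> \<xi>) * iexp (t * fp (norm \<xi>))) * r \<xi>)"
      by (rule integral_completion) measurable
    finally show ?thesis unfolding evolution_def radial_multiplier_def by simp
  qed
  show ?thesis unfolding ev by measurable
qed

text \<open>Tonelli's theorem. The weight enters through a Borel function \<open>W\<close> that agrees with \<open>|w|\<^sup>2\<close> off a null
set, because \<open>w\<close> itself is only Lebesgue measurable.\<close>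

lemma spacetime_energy:
  fixes \<phi> w :: "real^'n \<Rightarrow> complex"
  assumes f: "f C1_differentiable_on {0<..}"
    and q: "integrable lebesgue (\<lambda>\<xi>. chi (norm \<xi>) * \<sigma> (norm \<xi>) * fourier \<phi> \<xi>)"
    and W: "W \<in> borel_measurable borel" "AE x in lborel. ennreal ((cmod (w x))\<^sup>2) = W x"
  shows "(\<integral>\<^sup>+z. ennreal ((cmod ((\<lambda>(t, x). w x * evolution chi \<sigma> f \<phi> t x) z))\<^sup>2) \<partial>lborel)
    = (\<integral>\<^sup>+x. W x * time_energy chi \<sigma> f \<phi> x \<partial>lborel)"
    "(\<lambda>x. time_energy chi \<sigma> f \<phi> x) \<in> borel_measurable borel"
  unfolding time_energy_def
proof -
  note ev = evolution_borel[OF f q]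
  note [measurable] = W(1)
  have m2 [measurable]: "(\<lambda>(t, x). ennreal ((cmod (evolution chi \<sigma> f \<phi> t x))\<^sup>2)) \<in> borel_measurable (lborel \<Otimes>\<^sub>M lborel)"
    using measurable_compose[OF ev, of "\<lambda>z. ennreal ((cmod z)\<^sup>2)" borel] by (simp add: case_prod_unfold)
  have m3: "(\<lambda>(t, x). W x * ennreal ((cmod (evolution chi \<sigma> f \<phi> t x))\<^sup>2)) \<in> borel_measurable (lborel \<Otimes>\<^sub>M lborel)"
  proof -
    have "W \<in> borel_measurable lborel" using W(1) by simp
    then have "(\<lambda>z. W (snd z)) \<in> borel_measurable (lborel \<Otimes>\<^sub>M lborel :: (real \<times> (real^'n)) measure)"
      by (rule measurable_compose[OF measurable_snd])
    from borel_measurable_times_ennreal[OF this m2] show ?thesis by (simp add: case_prod_unfold)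
  qed
  obtain N where N: "N \<in> null_sets lborel" "{x. ennreal ((cmod (w x))\<^sup>2) \<noteq> W x} \<subseteq> N"
    using AE_E[OF W(2)] by (auto simp: null_sets_def)
  have "UNIV \<times> N \<in> null_sets (lborel \<Otimes>\<^sub>M lborel :: (real \<times> (real^'n)) measure)"
    using N(1) by (auto simp: null_sets_def lborel.emeasure_pair_measure_Times)
  then have ae: "AE z in (lborel \<Otimes>\<^sub>M lborel :: (real \<times> (real^'n)) measure). ennreal ((cmod (w (snd z)))\<^sup>2) = W (snd z)"
    by (rule AE_I') (use N(2) in auto)
  have "(\<integral>\<^sup>+z. ennreal ((cmod ((\<lambda>(t, x). w x * evolution chi \<sigma> f \<phi> t x) z))\<^sup>2) \<partial>lborel)
    = (\<integral>\<^sup>+z. (\<lambda>(t, x). W x * ennreal ((cmod (evolution chi \<sigma> f \<phi> t x))\<^sup>2)) z \<partial>(lborel \<Otimes>\<^sub>M lborel))"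
    unfolding lborel_prod[symmetric]
  proof (rule nn_integral_cong_AE)
    show "AE z in lborel \<Otimes>\<^sub>M lborel. ennreal ((cmod ((\<lambda>(t, x). w x * evolution chi \<sigma> f \<phi> t x) z))\<^sup>2)
       = (\<lambda>(t, x). W x * ennreal ((cmod (evolution chi \<sigma> f \<phi> t x))\<^sup>2)) z"
      using ae by eventually_elim (auto simp: norm_mult power_mult_distrib ennreal_mult split: prod.splits)
  qed
  also have "\<dots> = (\<integral>\<^sup>+x. \<integral>\<^sup>+t. W x * ennreal ((cmod (evolution chi \<sigma> f \<phi> t x))\<^sup>2) \<partial>lborel \<partial>lborel)"
    using lborel_pair.nn_integral_snd[OF m3] by simp
  also have "\<dots> = (\<integral>\<^sup>+x. W x * (\<integral>\<^sup>+t. ennreal ((cmod (evolution chi \<sigma> f \<phi> t x))\<^sup>2) \<partial>lborel) \<partial>lborel)"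
  proof (intro nn_integral_cong nn_integral_cmult)
    show "(\<lambda>t. ennreal ((cmod (evolution chi \<sigma> f \<phi> t x))\<^sup>2)) \<in> borel_measurable lborel" for x
      using measurable_compose[OF measurable_Pair2'[of x lborel lborel] m2] by simp
  qed
  finally show "(\<integral>\<^sup>+z. ennreal ((cmod ((\<lambda>(t, x). w x * evolution chi \<sigma> f \<phi> t x) z))\<^sup>2) \<partial>lborel)
    = (\<integral>\<^sup>+x. W x * (\<integral>\<^sup>+t. ennreal ((cmod (evolution chi \<sigma> f \<phi> t x))\<^sup>2) \<partial>lborel) \<partial>lborel)" .
  show "(\<lambda>x. \<integral>\<^sup>+t. ennreal ((cmod (evolution chi \<sigma> f \<phi> t x))\<^sup>2) \<partial>lborel) \<in> borel_measurable borel"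
    using lborel.borel_measurable_nn_integral[of "\<lambda>x t. ennreal ((cmod (evolution chi \<sigma> f \<phi> t x))\<^sup>2)" lborel]
      measurable_pair_swap[OF m2] by (simp add: case_prod_unfold)
qed

section \<open>Comparison of two flows\<close>

text \<open>Multiplication by the unimodular function \<open>cnj (\<sigma> / |\<sigma>|)\<close> turns \<open>chi \<sigma>\<close> into \<open>chi |\<sigma>|\<close>.\<close>

lemma modulus_amplitude_integrable:
  fixes \<phi> :: "real^'n \<Rightarrow> complex"
  assumes \<sigma>: "continuous_on {0<..} \<sigma>"
    and q: "integrable lebesgue (\<lambda>\<xi>. chi (norm \<xi>) * \<sigma> (norm \<xi>) * fourier \<phi> \<xi>)"
  shows "integrable lebesgue (\<lambda>\<xi>. iexp (x \<bullet> \<xi>) * chi (norm \<xi>) * complex_of_real (cmod (\<sigma> (norm \<xi>))) * fourier \<phi> \<xi>)"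
proof -
  define s where "s \<rho> = (if \<rho> \<in> {0<..} then \<sigma> \<rho> else 0) + (if \<rho> > 0 then 0 else \<sigma> 0)" for \<rho>
  define a where "a \<rho> = cnj (s \<rho>) / complex_of_real (cmod (s \<rho>))" for \<rho>
  have [measurable]: "s \<in> borel_measurable borel"
    unfolding s_def using measurable_on_set[OF \<sigma>, of "{0<..}"] by measurable
  have [measurable]: "a \<in> borel_measurable borel" unfolding a_def using borel_measurable_continuous_onI[OF continuous_on_cnj[OF continuous_on_id]] by measurable
  have s: "s (norm \<xi>) = \<sigma> (norm \<xi>)" for \<xi> :: "real^'n" by (cases "\<xi> = 0") (auto simp: s_def)
  have a1: "cmod (a \<rho>) \<le> 1" for \<rho> by (simp add: a_def norm_divide)
  have as: "a \<rho> * s \<rho> = complex_of_real (cmod (s \<rho>))" for \<rho>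
    using complex_norm_square[of "s \<rho>"] by (cases "s \<rho> = 0") (simp_all add: a_def field_simps power2_eq_square)
  have [measurable]: "(\<lambda>\<xi>::real^'n. iexp (x \<bullet> \<xi>) * a (norm \<xi>)) \<in> borel_measurable lebesgue"
    by (rule measurable_completion) measurable
  have [measurable]: "(\<lambda>\<xi>. chi (norm \<xi>) * \<sigma> (norm \<xi>) * fourier \<phi> \<xi>) \<in> borel_measurable lebesgue" using q by simp
  have "integrable lebesgue (\<lambda>\<xi>. (iexp (x \<bullet> \<xi>) * a (norm \<xi>)) * (chi (norm \<xi>) * \<sigma> (norm \<xi>) * fourier \<phi> \<xi>))"
  proof (rule Bochner_Integration.integrable_bound[OF q])
    show "AE \<xi> in lebesgue. cmod ((iexp (x \<bullet> \<xi>) * a (norm \<xi>)) * (chi (norm \<xi>) * \<sigma> (norm \<xi>) * fourier \<phi> \<xi>)) \<le> cmod (chi (norm \<xi>) * \<sigma> (norm \<xi>) * fourier \<phi> \<xi>)"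
    proof (rule AE_I2)
      fix \<xi>
      show "cmod ((iexp (x \<bullet> \<xi>) * a (norm \<xi>)) * (chi (norm \<xi>) * \<sigma> (norm \<xi>) * fourier \<phi> \<xi>)) \<le> cmod (chi (norm \<xi>) * \<sigma> (norm \<xi>) * fourier \<phi> \<xi>)"
        using mult_right_mono[OF a1[of "norm \<xi>"], of "cmod (chi (norm \<xi>) * \<sigma> (norm \<xi>) * fourier \<phi> \<xi>)"] by (simp only: norm_mult norm_exp_i_times mult_1 norm_ge_zero mult_nonneg_nonneg)
    qed
  qed measurable
  also have "(\<lambda>\<xi>. (iexp (x \<bullet> \<xi>) * a (norm \<xi>)) * (chi (norm \<xi>) * \<sigma> (norm \<xi>) * fourier \<phi> \<xi>))
     = (\<lambda>\<xi>. iexp (x \<bullet> \<xi>) * chi (norm \<xi>) * complex_of_real (cmod (\<sigma> (norm \<xi>))) * fourier \<phi> \<xi>)"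
    unfolding s[symmetric] as[symmetric] by (simp add: mult_ac)
  finally show ?thesis .
qed

lemma energy_density_nonneg: "energy_density \<sigma> wt f \<rho> \<ge> 0"
  unfolding energy_density_def by simp

lemma energy_density_alt: "energy_density \<sigma> wt f \<rho> = (cmod (\<sigma> \<rho>) / sqrt \<bar>deriv f \<rho>\<bar>)\<^sup>2 / (wt \<rho>)\<^sup>2"
  unfolding energy_density_def by (simp add: power_divide)

text \<open>Two flows issued from the same datum, with frequencies in a set \<open>E\<close> on which both phases are injective
and free of critical points. The locale is used with the noncritical part of the support of \<open>chi\<close>, and with a
short interval for the test data of the converse; it is symmetric in the two flows.\<close>

locale evolution_pair =
  fixes f g :: "real \<Rightarrow> real" and chi \<sigma> \<tau> :: "real \<Rightarrow> complex" and E :: "real set" and \<phi> :: "real^'n \<Rightarrow> complex"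
  assumes f: "f C1_differentiable_on {0<..}" and g: "g C1_differentiable_on {0<..}"
    and \<sigma>: "continuous_on {0<..} \<sigma>" and \<tau>: "continuous_on {0<..} \<tau>"
    and E: "E \<in> sets borel" "E \<subseteq> {0<..}" "inj_on f E" "inj_on g E"
    and noncritical: "\<And>\<rho>. \<rho> \<in> E \<Longrightarrow> deriv f \<rho> \<noteq> 0" "\<And>\<rho>. \<rho> \<in> E \<Longrightarrow> deriv g \<rho> \<noteq> 0"
    and supp: "AE \<xi> in lebesgue. chi (norm \<xi>) * fourier \<phi> \<xi> \<noteq> 0 \<longrightarrow> norm \<xi> \<in> E"
    and integrable_f: "integrable lebesgue (\<lambda>\<xi>. chi (norm \<xi>) * \<sigma> (norm \<xi>) * fourier \<phi> \<xi>)"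
    and integrable_g: "integrable lebesgue (\<lambda>\<xi>. chi (norm \<xi>) * \<tau> (norm \<xi>) * fourier \<phi> \<xi>)"
begin

definition wt :: "real \<Rightarrow> real" where
  "wt \<rho> = cmod (\<sigma> \<rho>) + cmod (\<tau> \<rho>)"

text \<open>Only \<open>chi \<sigma>\<close> and \<open>chi \<tau>\<close> times the Fourier transform of \<open>\<phi>\<close> are known to be integrable, not
\<open>chi\<close> times it; the weight \<open>|\<sigma>| + |\<tau>|\<close> makes the amplitude integrable and dominates both symbols.\<close>

definition amplitude :: "real^'n \<Rightarrow> real^'n \<Rightarrow> complex" where
  "amplitude x \<xi> = iexp (x \<bullet> \<xi>) * chi (norm \<xi>) * complex_of_real (wt (norm \<xi>)) * fourier \<phi> \<xi>"

text \<open>One density for each \<open>x\<close>, chosen once and for all: both energies have to be expressed by the same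
function.\<close>

definition profile :: "real^'n \<Rightarrow> real \<Rightarrow> complex" where
  "profile x = (SOME M. radial_profile (amplitude x) M \<and> (\<forall>\<rho>. \<rho> \<notin> E \<longrightarrow> M \<rho> = 0) \<and>
     (\<forall>C\<ge>0. \<forall>R. (AE \<xi> in lebesgue. cmod (amplitude x \<xi>) \<le> C * indicator {..R} (norm \<xi>)) \<longrightarrow>
        (\<exists>K. AE r in lborel. cmod (M r) \<le> K)))"

lemma
  shows profile: "radial_profile (amplitude x) (profile x)"
    and profile_outside: "\<rho> \<notin> E \<Longrightarrow> profile x \<rho> = 0"
    and profile_bounded: "C \<ge> 0 \<Longrightarrow> AE \<xi> in lebesgue. cmod (amplitude x \<xi>) \<le> C * indicator {..R} (norm \<xi>) \<Longrightarrow>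
       \<exists>K. AE r in lborel. cmod (profile x r) \<le> K"
proof -
  have "integrable lebesgue (\<lambda>\<xi>. iexp (x \<bullet> \<xi>) * chi (norm \<xi>) * complex_of_real (cmod (\<sigma> (norm \<xi>))) * fourier \<phi> \<xi>
    + iexp (x \<bullet> \<xi>) * chi (norm \<xi>) * complex_of_real (cmod (\<tau> (norm \<xi>))) * fourier \<phi> \<xi>)"
    by (intro Bochner_Integration.integrable_add modulus_amplitude_integrable \<sigma> \<tau> integrable_f integrable_g)
  also have "(\<lambda>\<xi>. iexp (x \<bullet> \<xi>) * chi (norm \<xi>) * complex_of_real (cmod (\<sigma> (norm \<xi>))) * fourier \<phi> \<xi>
    + iexp (x \<bullet> \<xi>) * chi (norm \<xi>) * complex_of_real (cmod (\<tau> (norm \<xi>))) * fourier \<phi> \<xi>) = amplitude x"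
    unfolding amplitude_def wt_def by (simp add: algebra_simps fun_eq_iff)
  finally have H: "integrable lebesgue (amplitude x)" .
  have HE: "AE \<xi> in lebesgue. amplitude x \<xi> \<noteq> 0 \<longrightarrow> norm \<xi> \<in> E"
    using supp by eventually_elim (auto simp: amplitude_def)
  obtain M where "radial_profile (amplitude x) M" "\<And>r. r \<notin> E \<Longrightarrow> M r = 0"
    "\<And>C R. C \<ge> 0 \<Longrightarrow> AE \<xi> in lebesgue. cmod (amplitude x \<xi>) \<le> C * indicator {..R} (norm \<xi>) \<Longrightarrow> \<exists>K. AE r in lborel. cmod (M r) \<le> K"
    using radial_profile_exists[OF H E(1) HE] by blast
  then have "\<exists>M. radial_profile (amplitude x) M \<and> (\<forall>\<rho>. \<rho> \<notin> E \<longrightarrow> M \<rho> = 0) \<and>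
     (\<forall>C\<ge>0. \<forall>R. (AE \<xi> in lebesgue. cmod (amplitude x \<xi>) \<le> C * indicator {..R} (norm \<xi>)) \<longrightarrow>
        (\<exists>K. AE r in lborel. cmod (M r) \<le> K))" by blast
  from someI_ex[OF this]
  show "radial_profile (amplitude x) (profile x)" "\<rho> \<notin> E \<Longrightarrow> profile x \<rho> = 0"
    "C \<ge> 0 \<Longrightarrow> AE \<xi> in lebesgue. cmod (amplitude x \<xi>) \<le> C * indicator {..R} (norm \<xi>) \<Longrightarrow> \<exists>K. AE r in lborel. cmod (profile x r) \<le> K"
    unfolding profile_def[symmetric] by blast+
qed

lemma continuous_wt: "continuous_on {0<..} wt"
  unfolding wt_def by (intro continuous_intros \<sigma> \<tau>)

lemma symbol_le_wt: "cmod (\<sigma> \<rho>) \<le> wt \<rho>" "cmod (\<tau> \<rho>) \<le> wt \<rho>"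
  by (simp_all add: wt_def)

lemma integrable_profile: "integrable lborel (profile x)"
  using profile[of x] unfolding radial_profile_def by blast

lemma
  shows time_energy_f: "time_energy chi \<sigma> f \<phi> x = ennreal (2 * pi * (1 / (2 * pi) ^ CARD('n))\<^sup>2) *
      (\<integral>\<^sup>+\<rho>. ennreal ((cmod (profile x \<rho>))\<^sup>2 * energy_density \<sigma> wt f \<rho>) \<partial>lborel)"
    and time_energy_g: "time_energy chi \<tau> g \<phi> x = ennreal (2 * pi * (1 / (2 * pi) ^ CARD('n))\<^sup>2) *
      (\<integral>\<^sup>+\<rho>. ennreal ((cmod (profile x \<rho>))\<^sup>2 * energy_density \<tau> wt g \<rho>) \<partial>lborel)"
  using profile[of x, unfolded amplitude_def[abs_def]]
  by (blast intro: evolution_L2[OF f E(1,2,3) noncritical(1) \<sigma> continuous_wt symbol_le_wt(1) supp integrable_f]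
    evolution_L2[OF g E(1,2,4) noncritical(2) \<tau> continuous_wt symbol_le_wt(2) supp integrable_g] profile_outside)+

lemma profile_density_measurable:
  assumes "k C1_differentiable_on {0<..}" and "continuous_on {0<..} \<upsilon>"
  shows "(\<lambda>\<rho>. (cmod (profile x \<rho>))\<^sup>2 * energy_density \<upsilon> wt k \<rho>) \<in> borel_measurable borel"
proof -
  note [measurable] = measurable_on_set[OF assms(2) E(1,2)] measurable_on_set[OF continuous_wt E(1,2)]
    measurable_on_set[OF C1_on_positives(2)[OF assms(1)] E(1,2)] borel_measurable_integrable[OF integrable_profile[of x]]
  have "(\<lambda>\<rho>. (cmod (profile x \<rho>))\<^sup>2 * ((cmod (if \<rho> \<in> E then \<upsilon> \<rho> else 0) / (if \<rho> \<in> E then wt \<rho> else 0))\<^sup>2 / \<bar>if \<rho> \<in> E then deriv k \<rho> else 0\<bar>)) \<in> borel_measurable borel"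
    by measurable
  also have "(\<lambda>\<rho>. (cmod (profile x \<rho>))\<^sup>2 * ((cmod (if \<rho> \<in> E then \<upsilon> \<rho> else 0) / (if \<rho> \<in> E then wt \<rho> else 0))\<^sup>2 / \<bar>if \<rho> \<in> E then deriv k \<rho> else 0\<bar>)) = (\<lambda>\<rho>. (cmod (profile x \<rho>))\<^sup>2 * energy_density \<upsilon> wt k \<rho>)"
    by (auto simp: energy_density_def profile_outside)
  finally show ?thesis .
qed

lemma time_energy_le:
  assumes A: "A \<ge> 0"
    and le: "\<And>\<rho>. \<rho> \<in> E \<Longrightarrow> cmod (\<sigma> \<rho>) / sqrt \<bar>deriv f \<rho>\<bar> \<le> A * (cmod (\<tau> \<rho>) / sqrt \<bar>deriv g \<rho>\<bar>)"
  shows "time_energy chi \<sigma> f \<phi> x \<le> ennreal (A\<^sup>2) * time_energy chi \<tau> g \<phi> x"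
proof -
  have "(\<integral>\<^sup>+\<rho>. ennreal ((cmod (profile x \<rho>))\<^sup>2 * energy_density \<sigma> wt f \<rho>) \<partial>lborel) \<le> (\<integral>\<^sup>+\<rho>. ennreal (A\<^sup>2) * ennreal ((cmod (profile x \<rho>))\<^sup>2 * energy_density \<tau> wt g \<rho>) \<partial>lborel)"
  proof (rule nn_integral_mono)
    fix \<rho>
    show "ennreal ((cmod (profile x \<rho>))\<^sup>2 * energy_density \<sigma> wt f \<rho>) \<le> ennreal (A\<^sup>2) * ennreal ((cmod (profile x \<rho>))\<^sup>2 * energy_density \<tau> wt g \<rho>)"
    proof (cases "\<rho> \<in> E")
      case True
      have "(cmod (\<sigma> \<rho>) / sqrt \<bar>deriv f \<rho>\<bar>)\<^sup>2 \<le> (A * (cmod (\<tau> \<rho>) / sqrt \<bar>deriv g \<rho>\<bar>))\<^sup>2"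
        by (rule power_mono[OF le[OF True]]) simp
      then have "(cmod (\<sigma> \<rho>) / sqrt \<bar>deriv f \<rho>\<bar>)\<^sup>2 / (wt \<rho>)\<^sup>2 \<le> (A * (cmod (\<tau> \<rho>) / sqrt \<bar>deriv g \<rho>\<bar>))\<^sup>2 / (wt \<rho>)\<^sup>2"
        by (rule divide_right_mono) simp
      then have "energy_density \<sigma> wt f \<rho> \<le> A\<^sup>2 * energy_density \<tau> wt g \<rho>"
        unfolding energy_density_alt power_mult_distrib by (simp only: times_divide_eq_right)
      then have "(cmod (profile x \<rho>))\<^sup>2 * energy_density \<sigma> wt f \<rho> \<le> A\<^sup>2 * ((cmod (profile x \<rho>))\<^sup>2 * energy_density \<tau> wt g \<rho>)"
        using mult_left_mono[of "energy_density \<sigma> wt f \<rho>" "A\<^sup>2 * energy_density \<tau> wt g \<rho>" "(cmod (profile x \<rho>))\<^sup>2"]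
        by (simp add: mult_ac)
      then show ?thesis using energy_density_nonneg by (simp add: ennreal_leI flip: ennreal_mult)
    qed (simp add: profile_outside)
  qed
  also have "\<dots> = ennreal (A\<^sup>2) * (\<integral>\<^sup>+\<rho>. ennreal ((cmod (profile x \<rho>))\<^sup>2 * energy_density \<tau> wt g \<rho>) \<partial>lborel)"
    using measurable_compose[OF profile_density_measurable[OF g \<tau>, of x] measurable_ennreal]
    by (intro nn_integral_cmult) simp
  finally show ?thesis
    unfolding time_energy_f time_energy_g by (simp only: mult.left_commute[of "ennreal (A\<^sup>2)"]) (rule mult_left_mono, auto)
qed

text \<open>If the densities satisfy the strict inequality but the energies the opposite one, then
\<open>|M|\<^sup>2\<close> times the positive difference of the densities has integral \<open>0\<close>; finiteness of the smaller energy allows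
the cancellation. Hence the profile vanishes almost everywhere.\<close>

lemma amplitude_moments_vanish:
  assumes A: "A \<ge> 0"
    and less: "\<And>\<rho>. \<rho> \<in> E \<Longrightarrow> A * (cmod (\<tau> \<rho>) / sqrt \<bar>deriv g \<rho>\<bar>) < cmod (\<sigma> \<rho>) / sqrt \<bar>deriv f \<rho>\<bar>"
    and en: "time_energy chi \<sigma> f \<phi> x \<le> ennreal (A\<^sup>2) * time_energy chi \<tau> g \<phi> x"
    and fin: "time_energy chi \<tau> g \<phi> x < \<infinity>"
    and u: "u \<in> borel_measurable borel" "\<And>r. cmod (u r) \<le> 1"
  shows "(LINT \<xi>|lebesgue. amplitude x \<xi> * u (norm \<xi>)) = 0"
proof -
  let ?C = "2 * pi * (1 / (2 * pi) ^ CARD('n))\<^sup>2"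
  have C: "?C > 0" by simp
  define a where "a \<rho> = (cmod (profile x \<rho>))\<^sup>2 * energy_density \<sigma> wt f \<rho>" for \<rho>
  define b where "b \<rho> = (cmod (profile x \<rho>))\<^sup>2 * energy_density \<tau> wt g \<rho>" for \<rho>
  have [measurable]: "a \<in> borel_measurable borel" "b \<in> borel_measurable borel"
    unfolding a_def b_def by (rule profile_density_measurable[OF f \<sigma>] profile_density_measurable[OF g \<tau>])+
  have strict: "A\<^sup>2 * energy_density \<tau> wt g \<rho> < energy_density \<sigma> wt f \<rho>" if "\<rho> \<in> E" for \<rho>
  proof -
    have n: "0 \<le> A * (cmod (\<tau> \<rho>) / sqrt \<bar>deriv g \<rho>\<bar>)" using A by simp
    then have "cmod (\<sigma> \<rho>) / sqrt \<bar>deriv f \<rho>\<bar> > 0" using less[OF that] by linarith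
    then have "\<sigma> \<rho> \<noteq> 0" by auto
    then have w: "wt \<rho> > 0" unfolding wt_def by (simp add: add_pos_nonneg)
    have "(A * (cmod (\<tau> \<rho>) / sqrt \<bar>deriv g \<rho>\<bar>))\<^sup>2 < (cmod (\<sigma> \<rho>) / sqrt \<bar>deriv f \<rho>\<bar>)\<^sup>2"
      using less[OF that] n by (rule power_strict_mono) simp
    then have "(A * (cmod (\<tau> \<rho>) / sqrt \<bar>deriv g \<rho>\<bar>))\<^sup>2 / (wt \<rho>)\<^sup>2 < (cmod (\<sigma> \<rho>) / sqrt \<bar>deriv f \<rho>\<bar>)\<^sup>2 / (wt \<rho>)\<^sup>2"
      by (rule divide_strict_right_mono) (use w in simp)
    then show ?thesis unfolding energy_density_alt power_mult_distrib by (simp only: times_divide_eq_right)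
  qed
  have ab: "A\<^sup>2 * b \<rho> \<le> a \<rho>" for \<rho>
  proof (cases "\<rho> \<in> E")
    case True
    then show ?thesis using mult_left_mono[OF less_imp_le[OF strict[OF True]], of "(cmod (profile x \<rho>))\<^sup>2"] by (simp add: a_def b_def mult_ac)
  qed (simp add: a_def b_def profile_outside)
  have b0: "b \<rho> \<ge> 0" for \<rho> by (simp add: b_def energy_density_nonneg)
  have le: "(\<integral>\<^sup>+\<rho>. ennreal (a \<rho>) \<partial>lborel) \<le> ennreal (A\<^sup>2) * (\<integral>\<^sup>+\<rho>. ennreal (b \<rho>) \<partial>lborel)"
    using en C unfolding time_energy_f time_energy_g a_def[symmetric] b_def[symmetric] mult.left_commute[of "ennreal (A\<^sup>2)"] by (subst (asm) ennreal_mult_le_mult_iff) auto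
  have finb: "(\<integral>\<^sup>+\<rho>. ennreal (b \<rho>) \<partial>lborel) < \<infinity>"
    using fin C unfolding time_energy_g b_def[symmetric] by (auto simp: ennreal_mult_less_top)
  have "(\<integral>\<^sup>+\<rho>. ennreal (a \<rho>) \<partial>lborel) = (\<integral>\<^sup>+\<rho>. ennreal (A\<^sup>2) * ennreal (b \<rho>) + ennreal (a \<rho> - A\<^sup>2 * b \<rho>) \<partial>lborel)"
    using ab b0 by (intro nn_integral_cong) (simp add: mult_nonneg_nonneg flip: ennreal_mult ennreal_plus)
  also have "\<dots> = ennreal (A\<^sup>2) * (\<integral>\<^sup>+\<rho>. ennreal (b \<rho>) \<partial>lborel) + (\<integral>\<^sup>+\<rho>. ennreal (a \<rho> - A\<^sup>2 * b \<rho>) \<partial>lborel)"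
    by (subst nn_integral_add) (auto simp: nn_integral_cmult)
  finally have "ennreal (A\<^sup>2) * (\<integral>\<^sup>+\<rho>. ennreal (b \<rho>) \<partial>lborel) + (\<integral>\<^sup>+\<rho>. ennreal (a \<rho> - A\<^sup>2 * b \<rho>) \<partial>lborel) \<le> ennreal (A\<^sup>2) * (\<integral>\<^sup>+\<rho>. ennreal (b \<rho>) \<partial>lborel) + 0"
    using le by simp
  then have "(\<integral>\<^sup>+\<rho>. ennreal (a \<rho> - A\<^sup>2 * b \<rho>) \<partial>lborel) \<le> 0"
    unfolding ennreal_add_left_cancel_le using finb by (auto simp: ennreal_mult_eq_top_iff)
  then have "AE \<rho> in lborel. ennreal (a \<rho> - A\<^sup>2 * b \<rho>) = 0"
    by (subst nn_integral_0_iff_AE[symmetric]) auto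
  then have M0: "AE \<rho> in lborel. profile x \<rho> = 0"
  proof eventually_elim
    case (elim \<rho>)
    show ?case
    proof (cases "\<rho> \<in> E")
      case True
      have "(cmod (profile x \<rho>))\<^sup>2 * (energy_density \<sigma> wt f \<rho> - A\<^sup>2 * energy_density \<tau> wt g \<rho>) \<le> 0"
        using elim by (simp add: a_def b_def ennreal_eq_0_iff algebra_simps)
      then show ?thesis using strict[OF True] by (simp add: mult_le_0_iff)
    qed (rule profile_outside)
  qed
  have "(LINT \<xi>|lebesgue. amplitude x \<xi> * u (norm \<xi>)) = (LINT r|lborel. profile x r * u r)"
    using profile[of x] u unfolding radial_profile_def by blast
  also have "\<dots> = 0" using M0 by (intro integral_eq_zero_AE) auto
  finally show ?thesis .
qed

text \<open>A bounded amplitude of bounded support has a bounded profile, and \<open>|M|\<^sup>2 \<le> K |M|\<close> is integrable against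
a bounded density.\<close>

lemma time_energy_finite:
  assumes bd: "C \<ge> 0" "AE \<xi> in lebesgue. cmod (amplitude x \<xi>) \<le> C * indicator {..R} (norm \<xi>)"
    and d: "d > 0" "\<And>\<rho>. \<rho> \<in> E \<Longrightarrow> d \<le> \<bar>deriv f \<rho>\<bar>" "\<And>\<rho>. \<rho> \<in> E \<Longrightarrow> d \<le> \<bar>deriv g \<rho>\<bar>"
  shows "time_energy chi \<sigma> f \<phi> x < \<infinity>" "time_energy chi \<tau> g \<phi> x < \<infinity>"
proof -
  let ?C = "2 * pi * (1 / (2 * pi) ^ CARD('n))\<^sup>2"
  obtain K where K: "AE r in lborel. cmod (profile x r) \<le> K" using profile_bounded[OF bd] by blast
  have fin: "(\<integral>\<^sup>+\<rho>. ennreal ((cmod (profile x \<rho>))\<^sup>2 * energy_density \<upsilon> wt k \<rho>) \<partial>lborel) < \<infinity>"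
    if k: "\<And>\<rho>. \<rho> \<in> E \<Longrightarrow> d \<le> \<bar>deriv k \<rho>\<bar>" and \<upsilon>: "\<And>\<rho>. cmod (\<upsilon> \<rho>) \<le> wt \<rho>" for \<upsilon> k
  proof -
    have "(\<integral>\<^sup>+\<rho>. ennreal ((cmod (profile x \<rho>))\<^sup>2 * energy_density \<upsilon> wt k \<rho>) \<partial>lborel) \<le> (\<integral>\<^sup>+\<rho>. ennreal (\<bar>K\<bar> / d * cmod (profile x \<rho>)) \<partial>lborel)"
    proof (rule nn_integral_mono_AE)
      show "AE \<rho> in lborel. ennreal ((cmod (profile x \<rho>))\<^sup>2 * energy_density \<upsilon> wt k \<rho>) \<le> ennreal (\<bar>K\<bar> / d * cmod (profile x \<rho>))"
        using K
      proof eventually_elim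
        case (elim \<rho>)
        show ?case
        proof (cases "\<rho> \<in> E")
          case True
          have "cmod (\<upsilon> \<rho>) / wt \<rho> \<le> 1" using \<upsilon>[of \<rho>] order_trans[OF norm_ge_zero \<upsilon>[of \<rho>]] by (auto simp: divide_le_eq_1)
          then have "(cmod (\<upsilon> \<rho>) / wt \<rho>)\<^sup>2 \<le> 1"
            using order_trans[OF norm_ge_zero \<upsilon>[of \<rho>]] by (intro power_le_one) auto
          then have "energy_density \<upsilon> wt k \<rho> \<le> 1 / d" unfolding energy_density_def using k[OF True] d(1) by (intro frac_le) auto
          moreover have "(cmod (profile x \<rho>))\<^sup>2 \<le> \<bar>K\<bar> * cmod (profile x \<rho>)" unfolding power2_eq_square using elim by (intro mult_right_mono) auto
          ultimately have "(cmod (profile x \<rho>))\<^sup>2 * energy_density \<upsilon> wt k \<rho> \<le> (\<bar>K\<bar> * cmod (profile x \<rho>)) * (1 / d)"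
            by (intro mult_mono) (auto simp: energy_density_nonneg)
          then show ?thesis by (intro ennreal_leI) simp
        qed (simp add: profile_outside)
      qed
    qed
    also have "\<dots> = ennreal (LINT \<rho>|lborel. \<bar>K\<bar> / d * cmod (profile x \<rho>))"
      using integrable_profile d(1) by (intro nn_integral_eq_integral) auto
    also have "\<dots> < \<infinity>" by simp
    finally show ?thesis .
  qed
  show "time_energy chi \<sigma> f \<phi> x < \<infinity>"
    unfolding time_energy_f using fin[of f \<sigma>] d(2) by (simp add: ennreal_mult_less_top symbol_le_wt)
  show "time_energy chi \<tau> g \<phi> x < \<infinity>"
    unfolding time_energy_g using fin[of g \<tau>] d(3) by (simp add: ennreal_mult_less_top symbol_le_wt)
qed

end

section \<open>Test data where the comparison fails\<close>

lemma isCont_pos_near: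
  fixes p :: "real \<Rightarrow> real"
  assumes "isCont p a" "p a > 0"
  shows "eventually (\<lambda>x. p x > 0) (nhds a)"
proof -
  have "eventually (\<lambda>x. x \<noteq> a \<longrightarrow> p x > 0) (nhds a)"
    using order_tendstoD(1)[OF isContD[OF assms(1)] assms(2)] by (simp add: eventually_at_filter)
  then show ?thesis by eventually_elim (use assms(2) in auto)
qed

text \<open>Failure at a point \<open>\<rho>0\<close> of the support persists nearby, and points with \<open>chi \<noteq> 0\<close> accumulate at \<open>\<rho>0\<close>.
This is where the continuity of \<open>chi\<close> and of the derivatives enters.\<close>

lemma comparison_failure_interval:
  assumes f: "f C1_differentiable_on {0<..}" and g: "g C1_differentiable_on {0<..}"
    and \<sigma>: "continuous_on {0<..} \<sigma>" and \<tau>: "continuous_on {0<..} \<tau>" and chi: "continuous_on {0<..} chi"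
    and fail: "\<not> symbol_comparison chi \<sigma> \<tau> f g A"
  obtains \<rho>1 d where "0 < d" "d < \<rho>1"
    "\<And>\<rho>. \<bar>\<rho> - \<rho>1\<bar> \<le> d \<Longrightarrow> chi \<rho> \<noteq> 0 \<and> deriv f \<rho> \<noteq> 0 \<and> deriv g \<rho> \<noteq> 0 \<and>
       A * (cmod (\<tau> \<rho>) / sqrt \<bar>deriv g \<rho>\<bar>) < cmod (\<sigma> \<rho>) / sqrt \<bar>deriv f \<rho>\<bar>"
proof -
  have cont: "isCont h \<rho>" if "continuous_on {0<..} h" "\<rho> > 0" for h :: "real \<Rightarrow> 'b::real_normed_vector" and \<rho>
    using that by (simp add: continuous_on_eq_continuous_at)
  obtain \<rho>0 where \<rho>0: "\<rho>0 \<in> supp_pos chi" "deriv f \<rho>0 \<noteq> 0" "deriv g \<rho>0 \<noteq> 0"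
    "A * (cmod (\<tau> \<rho>0) / sqrt \<bar>deriv g \<rho>0\<bar>) < cmod (\<sigma> \<rho>0) / sqrt \<bar>deriv f \<rho>0\<bar>"
    using fail unfolding symbol_comparison_def by (auto simp: not_le)
  have pos: "\<rho>0 > 0" using \<rho>0(1) by (simp add: supp_pos_def)
  let ?p = "\<lambda>\<rho>. cmod (\<sigma> \<rho>) / sqrt \<bar>deriv f \<rho>\<bar> - A * (cmod (\<tau> \<rho>) / sqrt \<bar>deriv g \<rho>\<bar>)"
  note cs = cont[OF \<sigma>] cont[OF \<tau>] cont[OF C1_on_positives(2)[OF f]] cont[OF C1_on_positives(2)[OF g]] cont[OF chi]
  have "isCont ?p \<rho>0" using \<rho>0(2,3) pos by (intro continuous_intros cs) auto
  then have "eventually (\<lambda>\<rho>. ?p \<rho> > 0) (nhds \<rho>0)" by (rule isCont_pos_near) (use \<rho>0(4) in simp)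
  moreover have "eventually (\<lambda>\<rho>. \<bar>deriv f \<rho>\<bar> > 0) (nhds \<rho>0)" "eventually (\<lambda>\<rho>. \<bar>deriv g \<rho>\<bar> > 0) (nhds \<rho>0)"
    by (rule isCont_pos_near; use \<rho>0 pos in \<open>auto intro!: continuous_intros cs\<close>)+
  ultimately have "eventually (\<lambda>\<rho>. ?p \<rho> > 0 \<and> \<bar>deriv f \<rho>\<bar> > 0 \<and> \<bar>deriv g \<rho>\<bar> > 0) (nhds \<rho>0)"
    by eventually_elim auto
  then obtain e where e: "e > 0" "\<And>\<rho>. dist \<rho> \<rho>0 < e \<Longrightarrow> ?p \<rho> > 0 \<and> \<bar>deriv f \<rho>\<bar> > 0 \<and> \<bar>deriv g \<rho>\<bar> > 0"
    unfolding eventually_nhds_metric by blast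
  obtain \<rho>1 where \<rho>1: "\<rho>1 > 0" "chi \<rho>1 \<noteq> 0" "dist \<rho>1 \<rho>0 < e"
  proof -
    have "\<rho>0 \<in> closure {\<rho>. 0 < \<rho> \<and> chi \<rho> \<noteq> 0}" using \<rho>0(1) by (simp add: supp_pos_def)
    then have "\<exists>\<rho>\<in>{\<rho>. 0 < \<rho> \<and> chi \<rho> \<noteq> 0}. dist \<rho> \<rho>0 < e"
      using e(1) by (simp only: closure_approachable)
    then show thesis using that by fast
  qed
  have "eventually (\<lambda>\<rho>. cmod (chi \<rho>) > 0) (nhds \<rho>1)"
    by (rule isCont_pos_near) (use \<rho>1 in \<open>auto intro!: continuous_intros cs\<close>)
  then obtain e' where e': "e' > 0" "\<And>\<rho>. dist \<rho> \<rho>1 < e' \<Longrightarrow> cmod (chi \<rho>) > 0"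
    unfolding eventually_nhds_metric by blast
  define d where "d = min (\<rho>1 / 2) (min (e' / 2) ((e - dist \<rho>1 \<rho>0) / 2))"
  show ?thesis
  proof (rule that[of d \<rho>1])
    show "0 < d" "d < \<rho>1" using \<rho>1 e'(1) by (auto simp: d_def)
    fix \<rho> assume "\<bar>\<rho> - \<rho>1\<bar> \<le> d"
    then have "\<bar>\<rho> - \<rho>1\<bar> \<le> e' / 2" "\<bar>\<rho> - \<rho>1\<bar> \<le> (e - dist \<rho>1 \<rho>0) / 2" by (simp_all add: d_def)
    then have dd: "dist \<rho> \<rho>1 \<le> e' / 2" "dist \<rho> \<rho>1 \<le> (e - dist \<rho>1 \<rho>0) / 2" by (simp_all add: dist_real_def)
    have "dist \<rho> \<rho>1 < e'" using dd(1) e'(1) by simp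
    moreover have "dist \<rho> \<rho>0 < e"
    proof -
      have "dist \<rho> \<rho>0 \<le> dist \<rho> \<rho>1 + dist \<rho>1 \<rho>0" by (rule dist_triangle)
      also have "\<dots> \<le> (e - dist \<rho>1 \<rho>0) / 2 + dist \<rho>1 \<rho>0" using dd(2) by simp
      also have "\<dots> = (e + dist \<rho>1 \<rho>0) / 2" by (simp add: field_simps)
      also have "\<dots> < e" using \<rho>1(3) by simp
      finally show ?thesis .
    qed
    ultimately show "chi \<rho> \<noteq> 0 \<and> deriv f \<rho> \<noteq> 0 \<and> deriv g \<rho> \<noteq> 0 \<and> A * (cmod (\<tau> \<rho>) / sqrt \<bar>deriv g \<rho>\<bar>) < cmod (\<sigma> \<rho>) / sqrt \<bar>deriv f \<rho>\<bar>"
      using e(2)[of \<rho>] e'(2)[of \<rho>] by auto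
  qed
qed

text \<open>The integral is continuous in \<open>y\<close> and positive at \<open>y = 0\<close>.\<close>

lemma inverse_transform_nonzero_near_origin:
  fixes b :: "real^'n \<Rightarrow> real"
  assumes b: "integrable lborel b" "continuous_on UNIV b" "\<And>\<xi>. b \<xi> \<ge> 0" "b \<xi>0 > 0"
  obtains r where "r > 0" "\<And>y. norm y < r \<Longrightarrow> (LINT \<xi>|lborel. iexp (y \<bullet> \<xi>) * complex_of_real (b \<xi>)) \<noteq> 0"
proof -
  let ?B = "\<lambda>y. LINT \<xi>|lborel. iexp (y \<bullet> \<xi>) * complex_of_real (b \<xi>)"
  note [measurable] = borel_measurable_integrable[OF b(1)]
  have "isCont ?B 0"
    unfolding continuous_at_sequentially comp_def
  proof safe
    fix y :: "nat \<Rightarrow> real^'n" assume y: "y \<longlonglongrightarrow> 0"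
    show "(\<lambda>n. ?B (y n)) \<longlonglongrightarrow> ?B 0"
    proof (rule integral_dominated_convergence[where w=b])
      show "AE \<xi> in lborel. (\<lambda>n. iexp (y n \<bullet> \<xi>) * complex_of_real (b \<xi>)) \<longlonglongrightarrow> iexp (0 \<bullet> \<xi>) * complex_of_real (b \<xi>)"
        by (intro AE_I2 tendsto_intros y)
    qed (use b in \<open>auto simp: norm_mult\<close>)
  qed
  moreover have "?B 0 \<noteq> 0"
  proof
    assume "?B 0 = 0"
    then have "(LINT \<xi>|lborel. b \<xi>) = 0" by simp
    then have "AE \<xi> in lborel. b \<xi> = 0" using integral_nonneg_eq_0_iff_AE[OF b(1)] b(3) by auto
    then have ae: "AE \<xi> in lborel. \<xi> \<notin> {\<xi>. b \<xi> \<noteq> 0}" by eventually_elim simp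
    have "open {\<xi>. b \<xi> \<noteq> 0}" by (intro open_Collect_neq b(2) continuous_intros)
    from open_AE_empty[OF this ae] have "b \<xi>0 = 0" by blast
    then show False using b(4) by simp
  qed
  ultimately have "eventually (\<lambda>y. ?B y \<noteq> 0) (at 0)"
    using tendsto_imp_eventually_ne isContD by blast
  then obtain r where "r > 0" "\<And>y. y \<noteq> 0 \<Longrightarrow> dist y 0 < r \<Longrightarrow> ?B y \<noteq> 0"
    unfolding eventually_at by blast
  note r = this
  show ?thesis
  proof (rule that[OF r(1)])
    show "?B y \<noteq> 0" if "norm y < r" for y
      using r(2)[of y] \<open>?B 0 \<noteq> 0\<close> that by (cases "y = 0") (simp_all add: dist_norm)
  qed
qed

text \<open>The datum has Fourier transform \<open>exp(- i x0 \<bullet> \<xi>) b(\<xi>)\<close> with a bump \<open>b\<close> supported over the interval of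
failure. The reversed inequality for the energies holds at every \<open>x\<close>. If it were an equality at \<open>x\<close>, the
radial moments of the amplitude would vanish, in particular the inverse transform of \<open>b\<close> at \<open>x - x0\<close>. The
radius \<open>r\<close> is independent of \<open>x0\<close>, which is essential for covering the space by balls.\<close>

lemma localized_test_data:
  fixes f g :: "real \<Rightarrow> real" and chi \<sigma> \<tau> :: "real \<Rightarrow> complex" and A :: real
  assumes f: "f C1_differentiable_on {0<..}" and g: "g C1_differentiable_on {0<..}"
    and \<sigma>: "continuous_on {0<..} \<sigma>" and \<tau>: "continuous_on {0<..} \<tau>" and chi: "continuous_on {0<..} chi"
    and inj: "inj_on f (supp_pos chi)" "inj_on g (supp_pos chi)" and A: "A > 0"
    and fail: "\<not> symbol_comparison chi \<sigma> \<tau> f g A"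
  obtains r where "r > 0"
    "\<And>x0 :: real^'n. \<exists>\<phi>. localized_datum chi \<sigma> \<tau> f g \<phi> \<and>
       (\<forall>x. time_energy chi \<sigma> f \<phi> x < \<infinity> \<and> time_energy chi \<tau> g \<phi> x < \<infinity>) \<and>
       (\<forall>x. ennreal (A\<^sup>2) * time_energy chi \<tau> g \<phi> x \<le> time_energy chi \<sigma> f \<phi> x) \<and>
       (\<forall>x. dist x x0 < r \<longrightarrow> ennreal (A\<^sup>2) * time_energy chi \<tau> g \<phi> x < time_energy chi \<sigma> f \<phi> x)"
proof -
  obtain \<rho>1 d where d: "0 < d" "d < \<rho>1"
    and good: "\<And>\<rho>. \<bar>\<rho> - \<rho>1\<bar> \<le> d \<Longrightarrow> chi \<rho> \<noteq> 0 \<and> deriv f \<rho> \<noteq> 0 \<and> deriv g \<rho> \<noteq> 0 \<and>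
       A * (cmod (\<tau> \<rho>) / sqrt \<bar>deriv g \<rho>\<bar>) < cmod (\<sigma> \<rho>) / sqrt \<bar>deriv f \<rho>\<bar>"
    using comparison_failure_interval[OF f g \<sigma> \<tau> chi fail] by blast
  define E where "E = {\<rho>1 - d..\<rho>1 + d}"
  have Egood: "chi \<rho> \<noteq> 0" "deriv f \<rho> \<noteq> 0" "deriv g \<rho> \<noteq> 0" "\<rho> > 0"
    "A * (cmod (\<tau> \<rho>) / sqrt \<bar>deriv g \<rho>\<bar>) < cmod (\<sigma> \<rho>) / sqrt \<bar>deriv f \<rho>\<bar>" if "\<rho> \<in> E" for \<rho>
    using good[of \<rho>] that d by (auto simp: E_def abs_le_iff)
  have Epos: "E \<subseteq> {0<..}" using Egood(4) by auto
  have Ecompact: "compact E" and Ene: "E \<noteq> {}" and Eb: "E \<in> sets borel" using d by (auto simp: E_def)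
  have Esupp: "E \<subseteq> supp_pos chi"
    using Egood(1,4) closure_subset[of "{\<rho>. 0 < \<rho> \<and> chi \<rho> \<noteq> 0}"] by (auto simp: supp_pos_def)
  have \<sigma>0: "\<sigma> \<rho> \<noteq> 0" if "\<rho> \<in> E" for \<rho>
  proof
    assume "\<sigma> \<rho> = 0"
    then have "A * (cmod (\<tau> \<rho>) / sqrt \<bar>deriv g \<rho>\<bar>) < 0" using Egood(5)[OF that] by simp
    moreover have "0 \<le> A * (cmod (\<tau> \<rho>) / sqrt \<bar>deriv g \<rho>\<bar>)" using A by simp
    ultimately show False by linarith
  qed
  obtain k :: 'n where True by blast
  define \<xi>0 :: "real^'n" where "\<xi>0 = \<rho>1 *\<^sub>R axis k 1"
  have n\<xi>0: "norm \<xi>0 = \<rho>1" using d by (simp add: \<xi>0_def norm_axis_1)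
  let ?K = "cball \<xi>0 d"
  have KE: "norm \<xi> \<in> E" if "\<xi> \<in> ?K" for \<xi>
    using that norm_triangle_ineq3[of \<xi> \<xi>0] n\<xi>0 by (auto simp: E_def dist_norm norm_minus_commute abs_le_iff)
  obtain b where b: "\<And>x0. \<exists>\<phi>. integrable lebesgue \<phi> \<and> (\<forall>\<xi>. fourier \<phi> \<xi> = exp (- \<i> * complex_of_real (x0 \<bullet> \<xi>)) * complex_of_real (b \<xi>))"
    "continuous_on UNIV b" "\<And>\<xi>. b \<xi> \<ge> 0" "b \<xi>0 > 0" "\<And>\<xi>. dist \<xi> \<xi>0 \<ge> d \<Longrightarrow> b \<xi> = 0"
    using bump_datum[OF d(1), of \<xi>0] by blast
  have bK: "b \<xi> = 0" if "\<xi> \<notin> ?K" for \<xi> using that b(5)[of \<xi>] by (simp add: dist_commute)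
  have compact_integrable: "integrable lborel F" if "continuous_on ?K F" "\<And>\<xi>. \<xi> \<notin> ?K \<Longrightarrow> F \<xi> = 0" for F :: "real^'n \<Rightarrow> 'b::{banach, second_countable_topology}"
  proof -
    have "integrable lborel (\<lambda>\<xi>. indicator ?K \<xi> *\<^sub>R F \<xi>)"
      by (rule borel_integrable_compact) (use that(1) in auto)
    also have "(\<lambda>\<xi>. indicator ?K \<xi> *\<^sub>R F \<xi>) = F" using that(2) by (auto simp: indicator_def fun_eq_iff)
    finally show ?thesis .
  qed
  have bi: "integrable lborel b" by (rule compact_integrable) (use continuous_on_subset[OF b(2)] bK in auto)
  obtain r where r: "r > 0" "\<And>y. norm y < r \<Longrightarrow> (LINT \<xi>|lborel. iexp (y \<bullet> \<xi>) * complex_of_real (b \<xi>)) \<noteq> 0"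
    using inverse_transform_nonzero_near_origin[OF bi b(2,3,4)] by blast
  show ?thesis
  proof (rule that[OF r(1)])
    fix x0 :: "real^'n"
    obtain \<phi> where \<phi>: "integrable lebesgue \<phi>" "\<And>\<xi>. fourier \<phi> \<xi> = exp (- \<i> * complex_of_real (x0 \<bullet> \<xi>)) * complex_of_real (b \<xi>)"
      using b(1)[of x0] by blast
    have \<phi>0: "fourier \<phi> \<xi> = 0" if "\<xi> \<notin> ?K" for \<xi> using bK[OF that] by (simp add: \<phi>(2))
    have c\<phi>: "continuous_on ?K (fourier \<phi>)"
      unfolding \<phi>(2)[abs_def] by (intro continuous_intros continuous_on_subset[OF b(2)]) auto
    have crad: "continuous_on ?K (\<lambda>\<xi>. h (norm \<xi>))" if "continuous_on {0<..} h" for h :: "real \<Rightarrow> complex"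
      by (rule continuous_on_compose2[OF that continuous_on_norm[OF continuous_on_id]]) (use KE Epos in blast)
    have integrable_symbol: "integrable lebesgue (\<lambda>\<xi>. chi (norm \<xi>) * h (norm \<xi>) * fourier \<phi> \<xi>)" if "continuous_on {0<..} h" for h
    proof -
      have "integrable lborel (\<lambda>\<xi>. chi (norm \<xi>) * h (norm \<xi>) * fourier \<phi> \<xi>)"
        by (rule compact_integrable) (auto intro!: continuous_intros crad chi that c\<phi> simp: \<phi>0)
      then show ?thesis by (simp add: integrable_completion)
    qed
    have suppE: "norm \<xi> \<in> E" if "fourier \<phi> \<xi> \<noteq> 0" for \<xi> using \<phi>0 KE that by blast
    interpret evolution_pair f g chi \<sigma> \<tau> E \<phi>
    proof
      show "inj_on f E" "inj_on g E" using inj Esupp inj_on_subset by blast+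
      show "AE \<xi> in lebesgue. chi (norm \<xi>) * fourier \<phi> \<xi> \<noteq> 0 \<longrightarrow> norm \<xi> \<in> E" using suppE by auto
    qed (use f g \<sigma> \<tau> Eb Epos Egood integrable_symbol in auto)
    interpret swapped: evolution_pair g f chi \<tau> \<sigma> E \<phi>
      using f g \<sigma> \<tau> E noncritical supp integrable_f integrable_g by unfold_locales auto
    have loc: "localized_datum chi \<sigma> \<tau> f g \<phi>"
      unfolding localized_datum_def admissible_datum_def
    proof (intro conjI)
      have cl: "closure {\<xi>. fourier \<phi> \<xi> \<noteq> 0} \<subseteq> ?K" by (rule closure_minimal) (use \<phi>0 in blast, rule closed_cball)
      then show "compact (closure {\<xi>. fourier \<phi> \<xi> \<noteq> 0})"
        using compact_Int_closed[OF compact_cball closed_closure, of \<xi>0 d "{\<xi>. fourier \<phi> \<xi> \<noteq> 0}"] by (simp add: Int_absorb1)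
      show "\<forall>\<xi>\<in>closure {\<xi>. fourier \<phi> \<xi> \<noteq> 0}. \<xi> \<noteq> 0 \<and> deriv f (norm \<xi>) \<noteq> 0 \<and> deriv g (norm \<xi>) \<noteq> 0"
        using cl KE Egood(2,3,4) by fastforce
      show "AE \<xi> in lebesgue. chi (norm \<xi>) * fourier \<phi> \<xi> \<noteq> 0 \<longrightarrow> deriv f (norm \<xi>) \<noteq> 0 \<and> deriv g (norm \<xi>) \<noteq> 0"
        using suppE Egood(2,3) by auto
    qed (fact \<phi>(1) integrable_f integrable_g)+
    have fin: "time_energy chi \<sigma> f \<phi> x < \<infinity>" "time_energy chi \<tau> g \<phi> x < \<infinity>" for x
    proof -
      have "continuous_on ?K (amplitude x)"
        unfolding amplitude_def[abs_def] wt_def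
        by (intro continuous_intros crad chi c\<phi> continuous_on_of_real crad[unfolded o_def] \<sigma> \<tau>)
      then have "bounded (amplitude x ` ?K)" by (intro compact_imp_bounded compact_continuous_image) auto
      then obtain C where C: "C > 0" "\<And>\<xi>. \<xi> \<in> ?K \<Longrightarrow> cmod (amplitude x \<xi>) \<le> C"
        unfolding bounded_pos by auto
      have bd: "AE \<xi> in lebesgue. cmod (amplitude x \<xi>) \<le> C * indicator {..\<rho>1 + d} (norm \<xi>)"
      proof (rule AE_I2)
        fix \<xi>
        show "cmod (amplitude x \<xi>) \<le> C * indicator {..\<rho>1 + d} (norm \<xi>)"
          using C KE[of \<xi>] \<phi>0[of \<xi>] by (cases "\<xi> \<in> ?K") (auto simp: E_def amplitude_def)
      qed
      have low: "\<exists>\<delta>>0. \<forall>\<rho>\<in>E. \<delta> \<le> \<bar>deriv k \<rho>\<bar>" if k: "k C1_differentiable_on {0<..}" "\<And>\<rho>. \<rho> \<in> E \<Longrightarrow> deriv k \<rho> \<noteq> 0" for k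
      proof -
        have "continuous_on E (\<lambda>\<rho>. \<bar>deriv k \<rho>\<bar>)"
          by (intro continuous_intros continuous_on_subset[OF C1_on_positives(2)[OF k(1)] Epos])
        then obtain \<rho>m where "\<rho>m \<in> E" "\<forall>\<rho>\<in>E. \<bar>deriv k \<rho>m\<bar> \<le> \<bar>deriv k \<rho>\<bar>"
          using continuous_attains_inf[OF Ecompact Ene] by blast
        then show ?thesis using k(2) by (intro exI[of _ "\<bar>deriv k \<rho>m\<bar>"]) auto
      qed
      obtain \<delta>1 \<delta>2 where "\<delta>1 > 0" "\<forall>\<rho>\<in>E. \<delta>1 \<le> \<bar>deriv f \<rho>\<bar>" "\<delta>2 > 0" "\<forall>\<rho>\<in>E. \<delta>2 \<le> \<bar>deriv g \<rho>\<bar>"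
        using low[OF f noncritical(1)] low[OF g noncritical(2)] by blast
      then show "time_energy chi \<sigma> f \<phi> x < \<infinity>" "time_energy chi \<tau> g \<phi> x < \<infinity>"
        using time_energy_finite[OF less_imp_le[OF C(1)] bd, of "min \<delta>1 \<delta>2"] by force+
    qed
    have le: "ennreal (A\<^sup>2) * time_energy chi \<tau> g \<phi> x \<le> time_energy chi \<sigma> f \<phi> x" for x
    proof -
      have "time_energy chi \<tau> g \<phi> x \<le> ennreal ((1 / A)\<^sup>2) * time_energy chi \<sigma> f \<phi> x"
      proof (rule swapped.time_energy_le)
        fix \<rho> assume "\<rho> \<in> E"
        have "v \<le> 1 / A * s" if "A * v < s" for s v :: real
          using A that by (simp add: pos_le_divide_eq mult.commute)
        then show "cmod (\<tau> \<rho>) / sqrt \<bar>deriv g \<rho>\<bar> \<le> 1 / A * (cmod (\<sigma> \<rho>) / sqrt \<bar>deriv f \<rho>\<bar>)"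
          using Egood(5)[OF \<open>\<rho> \<in> E\<close>] by blast
      qed (use A in simp)
      then have "ennreal (A\<^sup>2) * time_energy chi \<tau> g \<phi> x \<le> ennreal (A\<^sup>2) * (ennreal ((1 / A)\<^sup>2) * time_energy chi \<sigma> f \<phi> x)"
        by (rule mult_left_mono) simp
      also have "\<dots> = ennreal (A\<^sup>2 * (1 / A)\<^sup>2) * time_energy chi \<sigma> f \<phi> x"
        by (simp only: ennreal_mult zero_le_power2 mult.assoc)
      also have "A\<^sup>2 * (1 / A)\<^sup>2 = 1" using A by (simp add: power_divide)
      finally show ?thesis by simp
    qed
    have strict: "ennreal (A\<^sup>2) * time_energy chi \<tau> g \<phi> x < time_energy chi \<sigma> f \<phi> x" if x: "dist x x0 < r" for x
    proof (rule ccontr)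
      assume "\<not> ?thesis"
      then have en: "time_energy chi \<sigma> f \<phi> x \<le> ennreal (A\<^sup>2) * time_energy chi \<tau> g \<phi> x" by simp
      have wtpos: "wt \<rho> > 0" if "\<rho> \<in> E" for \<rho> using \<sigma>0[OF that] by (simp add: wt_def add_pos_nonneg)
      have "continuous_on E (\<lambda>\<rho>. cmod (chi \<rho>) * wt \<rho>)"
        by (intro continuous_intros continuous_on_subset[OF chi Epos] continuous_on_subset[OF continuous_wt Epos])
      then obtain \<rho>m where \<rho>m: "\<rho>m \<in> E" "\<forall>\<rho>\<in>E. cmod (chi \<rho>m) * wt \<rho>m \<le> cmod (chi \<rho>) * wt \<rho>"
        using continuous_attains_inf[OF Ecompact Ene] by blast
      \<comment> \<open>The test function \<open>u\<close> undoes the factors \<open>chi\<close> and \<open>wt\<close> of the amplitude, scaled by the minimum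
        \<open>\<kappa>\<close> of \<open>|chi| wt\<close> over \<open>E\<close> so that \<open>|u| \<le> 1\<close>.\<close>
      define \<kappa> where "\<kappa> = cmod (chi \<rho>m) * wt \<rho>m"
      have \<kappa>: "\<kappa> > 0" using Egood(1)[OF \<rho>m(1)] wtpos[OF \<rho>m(1)] by (simp add: \<kappa>_def)
      define u where "u \<rho> = complex_of_real \<kappa> * ((if \<rho> \<in> E then 1 else 0) / ((if \<rho> \<in> E then chi \<rho> else 0) * complex_of_real (if \<rho> \<in> E then wt \<rho> else 0)))" for \<rho>
      have um: "u \<in> borel_measurable borel"
        unfolding u_def using measurable_on_set[OF chi Eb Epos] measurable_on_set[OF continuous_wt Eb Epos] Eb by measurable
      have u1: "cmod (u \<rho>) \<le> 1" for \<rho>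
        using \<rho>m(2) \<kappa> wtpos[of \<rho>] Egood(1)[of \<rho>] by (auto simp: u_def norm_mult norm_divide \<kappa>_def[symmetric] divide_le_eq_1)
      have "(LINT \<xi>|lebesgue. amplitude x \<xi> * u (norm \<xi>)) = 0"
        by (rule amplitude_moments_vanish[OF less_imp_le[OF A] Egood(5) en fin(2) um u1])
      also have "(\<lambda>\<xi>. amplitude x \<xi> * u (norm \<xi>)) = (\<lambda>\<xi>. complex_of_real \<kappa> * (iexp ((x - x0) \<bullet> \<xi>) * complex_of_real (b \<xi>)))"
      proof
        fix \<xi>
        show "amplitude x \<xi> * u (norm \<xi>) = complex_of_real \<kappa> * (iexp ((x - x0) \<bullet> \<xi>) * complex_of_real (b \<xi>))"
        proof (cases "fourier \<phi> \<xi> = 0")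
          case True
          then have "b \<xi> = 0" by (simp add: \<phi>(2))
          then show ?thesis using True by (simp add: amplitude_def)
        next
          case False
          then have "norm \<xi> \<in> E" by (rule suppE)
          then have "u (norm \<xi>) * (chi (norm \<xi>) * complex_of_real (wt (norm \<xi>))) = complex_of_real \<kappa>"
            using wtpos[of "norm \<xi>"] Egood(1)[of "norm \<xi>"] by (simp add: u_def)
          then have "amplitude x \<xi> * u (norm \<xi>) = complex_of_real \<kappa> * (iexp (x \<bullet> \<xi>) * fourier \<phi> \<xi>)"
            unfolding amplitude_def by (metis (no_types, opaque_lifting) mult.assoc mult.commute)
          also have "iexp (x \<bullet> \<xi>) * fourier \<phi> \<xi> = iexp ((x - x0) \<bullet> \<xi>) * complex_of_real (b \<xi>)"
            by (simp add: \<phi>(2) inner_diff_left ring_distribs flip: exp_add mult.assoc)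
          finally show ?thesis .
        qed
      qed
      finally have "(LINT \<xi>|lebesgue. iexp ((x - x0) \<bullet> \<xi>) * complex_of_real (b \<xi>)) = 0"
        using \<kappa> by simp
      moreover have "(LINT \<xi>|lebesgue. iexp ((x - x0) \<bullet> \<xi>) * complex_of_real (b \<xi>)) = (LINT \<xi>|lborel. iexp ((x - x0) \<bullet> \<xi>) * complex_of_real (b \<xi>))"
      proof -
        note [measurable] = borel_measurable_integrable[OF bi]
        show ?thesis by (rule integral_completion) measurable
      qed
      ultimately show False using r(2)[of "x - x0"] x by (simp add: dist_norm)
    qed
    show "\<exists>\<phi>. localized_datum chi \<sigma> \<tau> f g \<phi> \<and>
       (\<forall>x. time_energy chi \<sigma> f \<phi> x < \<infinity> \<and> time_energy chi \<tau> g \<phi> x < \<infinity>) \<and>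
       (\<forall>x. ennreal (A\<^sup>2) * time_energy chi \<tau> g \<phi> x \<le> time_energy chi \<sigma> f \<phi> x) \<and>
       (\<forall>x. dist x x0 < r \<longrightarrow> ennreal (A\<^sup>2) * time_energy chi \<tau> g \<phi> x < time_energy chi \<sigma> f \<phi> x)"
      using loc fin le strict by blast
  qed
qed

section \<open>The comparison principle\<close>

lemma time_norm_le_iff:
  "A > 0 \<Longrightarrow> time_norm chi \<sigma> f \<phi> x \<le> ennreal A * time_norm chi \<tau> g \<phi> x \<longleftrightarrow>
    time_energy chi \<sigma> f \<phi> x \<le> ennreal (A\<^sup>2) * time_energy chi \<tau> g \<phi> x"
  unfolding time_norm_def time_energy_def by (rule L2_ennorm_le_iff)

lemma time_norm_finite_iff: "time_norm chi \<sigma> f \<phi> x < \<infinity> \<longleftrightarrow> time_energy chi \<sigma> f \<phi> x < \<infinity>"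
  unfolding time_norm_def time_energy_def by (rule L2_ennorm_finite_iff)

lemma strictly_monotone_on_imp_inj_on:
  assumes "strictly_monotone_on S f" shows "inj_on f S"
proof (rule inj_onI)
  fix x y assume "x \<in> S" "y \<in> S" "f x = f y"
  then show "x = y"
    using assms unfolding strictly_monotone_on_def monotone_on_def by (metis linorder_neqE less_irrefl)
qed

theorem theorem2p5:
  fixes f g :: "real \<Rightarrow> real"
    and chi \<sigma> \<tau> :: "real \<Rightarrow> complex"
    and A :: real
  assumes "f C1_differentiable_on {0<..}" and "g C1_differentiable_on {0<..}"
    and "chi \<in> borel_measurable (lebesgue_on {0<..})"
    and "strictly_monotone_on (supp_pos chi) f" and "strictly_monotone_on (supp_pos chi) g"
    and "continuous_on {0<..} \<sigma>" and "continuous_on {0<..} \<tau>"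
    and "A > 0"
  shows
    "(symbol_comparison chi \<sigma> \<tau> f g A \<longrightarrow>
        (\<forall>(\<phi> :: real^'n \<Rightarrow> complex) x. admissible_datum chi \<sigma> \<tau> f g \<phi> \<longrightarrow>
           time_norm chi \<sigma> f \<phi> x \<le> ennreal A * time_norm chi \<tau> g \<phi> x) \<and>
        (\<forall>w \<in> borel_measurable lebesgue. \<forall>\<phi> :: real^'n \<Rightarrow> complex.
           admissible_datum chi \<sigma> \<tau> f g \<phi> \<longrightarrow>
           spacetime_norm w chi \<sigma> f \<phi> \<le> ennreal A * spacetime_norm w chi \<tau> g \<phi>))
     \<and>
     (continuous_on {0<..} chi \<longrightarrow>
        ((\<exists>x :: real^'n. \<forall>\<phi>. admissible_datum chi \<sigma> \<tau> f g \<phi> \<and>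
             time_norm chi \<sigma> f \<phi> x < \<infinity> \<and> time_norm chi \<tau> g \<phi> x < \<infinity> \<longrightarrow>
             time_norm chi \<sigma> f \<phi> x \<le> ennreal A * time_norm chi \<tau> g \<phi> x) \<longrightarrow>
           symbol_comparison chi \<sigma> \<tau> f g A) \<and>
        (\<forall>w :: real^'n \<Rightarrow> complex.
           w \<in> borel_measurable lebesgue \<and> emeasure lebesgue {x. w x \<noteq> 0} > 0 \<and>
           (\<forall>\<phi>. admissible_datum chi \<sigma> \<tau> f g \<phi> \<and>
              spacetime_norm w chi \<sigma> f \<phi> < \<infinity> \<and> spacetime_norm w chi \<tau> g \<phi> < \<infinity> \<longrightarrow>
              spacetime_norm w chi \<sigma> f \<phi> \<le> ennreal A * spacetime_norm w chi \<tau> g \<phi>) \<and>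
           (\<forall>\<phi>. localized_datum chi \<sigma> \<tau> f g \<phi> \<longrightarrow>
              spacetime_norm w chi \<sigma> f \<phi> < \<infinity> \<and> spacetime_norm w chi \<tau> g \<phi> < \<infinity>) \<longrightarrow>
           symbol_comparison chi \<sigma> \<tau> f g A))"
proof -
  note f = assms(1) and g = assms(2) and \<sigma> = assms(6) and \<tau> = assms(7) and A = assms(8)
  have inj: "inj_on f (supp_pos chi)" "inj_on g (supp_pos chi)"
    using assms(4,5) strictly_monotone_on_imp_inj_on by blast+
  \<comment> \<open>For almost every \<open>\<xi>\<close> in the support of an admissible amplitude, \<open>|\<xi>|\<close> lies in \<open>E\<close>.\<close>
  define E where "E = {\<rho> \<in> supp_pos chi. deriv f \<rho> \<noteq> 0 \<and> deriv g \<rho> \<noteq> 0}"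
  have Epos: "E \<subseteq> {0<..}" by (auto simp: E_def supp_pos_def)
  have Eb: "E \<in> sets borel"
  proof -
    note [measurable] = measurable_on_set[OF C1_on_positives(2)[OF f], of "{0<..}"] measurable_on_set[OF C1_on_positives(2)[OF g], of "{0<..}"]
    have sb [measurable]: "supp_pos chi \<in> sets borel" unfolding supp_pos_def by measurable
    have "{\<rho>. (if \<rho> \<in> {0<..} then deriv f \<rho> else 0) \<noteq> 0 \<and> (if \<rho> \<in> {0<..} then deriv g \<rho> else 0) \<noteq> 0} \<inter> supp_pos chi \<in> sets borel"
      by measurable
    also have "{\<rho>. (if \<rho> \<in> {0<..} then deriv f \<rho> else 0) \<noteq> 0 \<and> (if \<rho> \<in> {0<..} then deriv g \<rho> else 0) \<noteq> 0} \<inter> supp_pos chi = E"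
      by (auto simp: E_def supp_pos_def)
    finally show ?thesis .
  qed
  have pair: "evolution_pair f g chi \<sigma> \<tau> E \<phi>" if adm: "admissible_datum chi \<sigma> \<tau> f g \<phi>" for \<phi> :: "real^'n \<Rightarrow> complex"
  proof
    have nz: "AE \<xi> in lebesgue. \<xi> \<noteq> (0 :: real^'n)" by (rule AE_completion[OF AE_lborel_singleton])
    have "AE \<xi> in lebesgue. chi (norm \<xi>) * fourier \<phi> \<xi> \<noteq> 0 \<longrightarrow> deriv f (norm \<xi>) \<noteq> 0 \<and> deriv g (norm \<xi>) \<noteq> 0"
      using adm by (simp add: admissible_datum_def)
    then show "AE \<xi> in lebesgue. chi (norm \<xi>) * fourier \<phi> \<xi> \<noteq> 0 \<longrightarrow> norm \<xi> \<in> E"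
      using nz
    proof eventually_elim
      case (elim \<xi>)
      then show ?case using closure_subset[of "{\<rho>. 0 < \<rho> \<and> chi \<rho> \<noteq> 0}"] by (auto simp: E_def supp_pos_def)
    qed
    show "inj_on f E" "inj_on g E" using inj by (auto simp: E_def intro: inj_on_subset)
  qed (use f g \<sigma> \<tau> Eb Epos adm in \<open>auto simp: E_def admissible_datum_def\<close>)
  have weight: "\<exists>W \<in> borel_measurable borel. AE x in lborel. ennreal ((cmod (w x))\<^sup>2) = W x" if "w \<in> borel_measurable lebesgue" for w :: "real^'n \<Rightarrow> complex"
    using completion_ex_borel_measurable[of "\<lambda>x. ennreal ((cmod (w x))\<^sup>2)" lborel] that by simp
  have st_le: "spacetime_norm w chi \<sigma> f \<phi> \<le> ennreal A * spacetime_norm w chi \<tau> g \<phi> \<longleftrightarrow>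
      (\<integral>\<^sup>+x. W x * time_energy chi \<sigma> f \<phi> x \<partial>lborel) \<le> ennreal (A\<^sup>2) * (\<integral>\<^sup>+x. W x * time_energy chi \<tau> g \<phi> x \<partial>lborel)"
    and st_fin: "spacetime_norm w chi \<tau> g \<phi> < \<infinity> \<longleftrightarrow> (\<integral>\<^sup>+x. W x * time_energy chi \<tau> g \<phi> x \<partial>lborel) < \<infinity>"
    and te_meas: "time_energy chi \<sigma> f \<phi> \<in> borel_measurable borel" "time_energy chi \<tau> g \<phi> \<in> borel_measurable borel"
    if adm: "admissible_datum chi \<sigma> \<tau> f g \<phi>" and W: "W \<in> borel_measurable borel" "AE x in lborel. ennreal ((cmod (w x))\<^sup>2) = W x" for w \<phi> :: "real^'n \<Rightarrow> complex" and W
  proof -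
    have q: "integrable lebesgue (\<lambda>\<xi>. chi (norm \<xi>) * \<sigma> (norm \<xi>) * fourier \<phi> \<xi>)" "integrable lebesgue (\<lambda>\<xi>. chi (norm \<xi>) * \<tau> (norm \<xi>) * fourier \<phi> \<xi>)"
      using adm by (auto simp: admissible_datum_def)
    note e = spacetime_energy[OF f q(1) W] spacetime_energy[OF g q(2) W]
    show "spacetime_norm w chi \<sigma> f \<phi> \<le> ennreal A * spacetime_norm w chi \<tau> g \<phi> \<longleftrightarrow>
      (\<integral>\<^sup>+x. W x * time_energy chi \<sigma> f \<phi> x \<partial>lborel) \<le> ennreal (A\<^sup>2) * (\<integral>\<^sup>+x. W x * time_energy chi \<tau> g \<phi> x \<partial>lborel)"
      unfolding spacetime_norm_def L2_ennorm_le_iff[OF A] e(1,3) ..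
    show "spacetime_norm w chi \<tau> g \<phi> < \<infinity> \<longleftrightarrow> (\<integral>\<^sup>+x. W x * time_energy chi \<tau> g \<phi> x \<partial>lborel) < \<infinity>"
      unfolding spacetime_norm_def L2_ennorm_finite_iff e(3) ..
    show "time_energy chi \<sigma> f \<phi> \<in> borel_measurable borel" "time_energy chi \<tau> g \<phi> \<in> borel_measurable borel"
      using e(2,4) by auto
  qed
  show ?thesis
  proof (intro conjI impI allI ballI)
    assume cmp: "symbol_comparison chi \<sigma> \<tau> f g A"
    have le: "time_energy chi \<sigma> f \<phi> x \<le> ennreal (A\<^sup>2) * time_energy chi \<tau> g \<phi> x" if "admissible_datum chi \<sigma> \<tau> f g \<phi>" for \<phi> and x :: "real^'n"
      by (rule evolution_pair.time_energy_le[OF pair[OF that]]) (use A cmp in \<open>auto simp: symbol_comparison_def E_def\<close>)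
    show "time_norm chi \<sigma> f \<phi> x \<le> ennreal A * time_norm chi \<tau> g \<phi> x" if "admissible_datum chi \<sigma> \<tau> f g \<phi>" for \<phi> and x :: "real^'n"
      unfolding time_norm_le_iff[OF A] by (rule le[OF that])
    show "spacetime_norm w chi \<sigma> f \<phi> \<le> ennreal A * spacetime_norm w chi \<tau> g \<phi>"
      if w: "w \<in> borel_measurable lebesgue" and adm: "admissible_datum chi \<sigma> \<tau> f g \<phi>" for w \<phi> :: "real^'n \<Rightarrow> complex"
    proof -
      obtain W where W: "W \<in> borel_measurable borel" "AE x in lborel. ennreal ((cmod (w x))\<^sup>2) = W x"
        using weight[OF w] by blast
      note [measurable] = W(1) te_meas[OF adm W]
      have "(\<integral>\<^sup>+x. W x * time_energy chi \<sigma> f \<phi> x \<partial>lborel) \<le> (\<integral>\<^sup>+x. ennreal (A\<^sup>2) * (W x * time_energy chi \<tau> g \<phi> x) \<partial>lborel)"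
        by (intro nn_integral_mono) (use mult_left_mono[OF le[OF adm]] in \<open>simp add: mult.left_commute\<close>)
      also have "\<dots> = ennreal (A\<^sup>2) * (\<integral>\<^sup>+x. W x * time_energy chi \<tau> g \<phi> x \<partial>lborel)"
        by (rule nn_integral_cmult) measurable
      finally show ?thesis unfolding st_le[OF adm W] .
    qed
  next
    assume chi: "continuous_on {0<..} chi"
      and "\<exists>x :: real^'n. \<forall>\<phi>. admissible_datum chi \<sigma> \<tau> f g \<phi> \<and>
             time_norm chi \<sigma> f \<phi> x < \<infinity> \<and> time_norm chi \<tau> g \<phi> x < \<infinity> \<longrightarrow>
             time_norm chi \<sigma> f \<phi> x \<le> ennreal A * time_norm chi \<tau> g \<phi> x"
    then obtain x :: "real^'n" where x: "\<And>\<phi>. admissible_datum chi \<sigma> \<tau> f g \<phi> \<Longrightarrow> time_energy chi \<sigma> f \<phi> x < \<infinity> \<Longrightarrow>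
        time_energy chi \<tau> g \<phi> x < \<infinity> \<Longrightarrow> time_energy chi \<sigma> f \<phi> x \<le> ennreal (A\<^sup>2) * time_energy chi \<tau> g \<phi> x"
      unfolding time_norm_le_iff[OF A] time_norm_finite_iff by blast
    show "symbol_comparison chi \<sigma> \<tau> f g A"
    proof (rule ccontr)
      assume "\<not> ?thesis"
      from localized_test_data[OF f g \<sigma> \<tau> chi inj A this]
      obtain r where "r > 0" "\<And>x0 :: real^'n. \<exists>\<phi>. localized_datum chi \<sigma> \<tau> f g \<phi> \<and>
       (\<forall>x. time_energy chi \<sigma> f \<phi> x < \<infinity> \<and> time_energy chi \<tau> g \<phi> x < \<infinity>) \<and>
       (\<forall>x. ennreal (A\<^sup>2) * time_energy chi \<tau> g \<phi> x \<le> time_energy chi \<sigma> f \<phi> x) \<and>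
       (\<forall>x. dist x x0 < r \<longrightarrow> ennreal (A\<^sup>2) * time_energy chi \<tau> g \<phi> x < time_energy chi \<sigma> f \<phi> x)" by blast
      then obtain \<phi> where "admissible_datum chi \<sigma> \<tau> f g \<phi>" "time_energy chi \<sigma> f \<phi> x < \<infinity>" "time_energy chi \<tau> g \<phi> x < \<infinity>"
        "ennreal (A\<^sup>2) * time_energy chi \<tau> g \<phi> x < time_energy chi \<sigma> f \<phi> x"
        unfolding localized_datum_def by (metis dist_self)
      then show False using x[of \<phi>] by simp
    qed
  next
    fix w :: "real^'n \<Rightarrow> complex"
    assume chi: "continuous_on {0<..} chi"
      and hyp: "w \<in> borel_measurable lebesgue \<and> emeasure lebesgue {x. w x \<noteq> 0} > 0 \<and>
           (\<forall>\<phi>. admissible_datum chi \<sigma> \<tau> f g \<phi> \<and>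
              spacetime_norm w chi \<sigma> f \<phi> < \<infinity> \<and> spacetime_norm w chi \<tau> g \<phi> < \<infinity> \<longrightarrow>
              spacetime_norm w chi \<sigma> f \<phi> \<le> ennreal A * spacetime_norm w chi \<tau> g \<phi>) \<and>
           (\<forall>\<phi>. localized_datum chi \<sigma> \<tau> f g \<phi> \<longrightarrow>
              spacetime_norm w chi \<sigma> f \<phi> < \<infinity> \<and> spacetime_norm w chi \<tau> g \<phi> < \<infinity>)"
    then have w: "w \<in> borel_measurable lebesgue" by blast
    obtain W where W: "W \<in> borel_measurable borel" "AE x in lborel. ennreal ((cmod (w x))\<^sup>2) = W x"
      using weight[OF w] by blast
    show "symbol_comparison chi \<sigma> \<tau> f g A"
    proof (rule ccontr)
      assume "\<not> ?thesis"
      from localized_test_data[OF f g \<sigma> \<tau> chi inj A this]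
      obtain r where r: "r > 0" "\<And>x0 :: real^'n. \<exists>\<phi>. localized_datum chi \<sigma> \<tau> f g \<phi> \<and>
       (\<forall>x. time_energy chi \<sigma> f \<phi> x < \<infinity> \<and> time_energy chi \<tau> g \<phi> x < \<infinity>) \<and>
       (\<forall>x. ennreal (A\<^sup>2) * time_energy chi \<tau> g \<phi> x \<le> time_energy chi \<sigma> f \<phi> x) \<and>
       (\<forall>x. dist x x0 < r \<longrightarrow> ennreal (A\<^sup>2) * time_energy chi \<tau> g \<phi> x < time_energy chi \<sigma> f \<phi> x)" by blast
      \<comment> \<open>On the ball around \<open>x0\<close> the integrands differ strictly wherever \<open>w\<close> does not vanish, while their
        integrals are finite and ordered the other way.\<close>
      have null: "AE x in lborel. dist x x0 < r \<longrightarrow> w x = 0" for x0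
      proof -
        obtain \<phi> where loc: "localized_datum chi \<sigma> \<tau> f g \<phi>"
          and fin: "\<And>x. time_energy chi \<tau> g \<phi> x < \<infinity>"
          and le: "\<And>x. ennreal (A\<^sup>2) * time_energy chi \<tau> g \<phi> x \<le> time_energy chi \<sigma> f \<phi> x"
          and less: "\<And>x. dist x x0 < r \<Longrightarrow> ennreal (A\<^sup>2) * time_energy chi \<tau> g \<phi> x < time_energy chi \<sigma> f \<phi> x"
          using r(2)[of x0] by blast
        have adm: "admissible_datum chi \<sigma> \<tau> f g \<phi>" using loc by (simp add: localized_datum_def)
        note [measurable] = W(1) te_meas[OF adm W]
        let ?F = "\<lambda>x. W x * time_energy chi \<sigma> f \<phi> x" and ?G = "\<lambda>x. ennreal (A\<^sup>2) * (W x * time_energy chi \<tau> g \<phi> x)"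
        have G: "(\<integral>\<^sup>+x. ?G x \<partial>lborel) = ennreal (A\<^sup>2) * (\<integral>\<^sup>+x. W x * time_energy chi \<tau> g \<phi> x \<partial>lborel)"
          by (rule nn_integral_cmult) measurable
        have "(\<integral>\<^sup>+x. W x * time_energy chi \<tau> g \<phi> x \<partial>lborel) < \<infinity>" using hyp loc st_fin[OF adm W] by blast
        then have Gfin: "(\<integral>\<^sup>+x. ?G x \<partial>lborel) < \<infinity>" unfolding G by (simp add: ennreal_mult_less_top)
        have FG: "(\<integral>\<^sup>+x. ?F x \<partial>lborel) \<le> (\<integral>\<^sup>+x. ?G x \<partial>lborel)"
          unfolding G using hyp loc adm st_le[OF adm W] by blast
        have GF: "?G x \<le> ?F x" for x using mult_left_mono[OF le[of x], of "W x"] by (simp add: mult.left_commute)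
        have "(\<integral>\<^sup>+x. ?F x - ?G x \<partial>lborel) = (\<integral>\<^sup>+x. ?F x \<partial>lborel) - (\<integral>\<^sup>+x. ?G x \<partial>lborel)"
          by (rule nn_integral_diff) (use Gfin GF in auto)
        also have "\<dots> = 0" using diff_eq_0_ennreal[OF le_less_trans[OF FG Gfin, unfolded infinity_ennreal_def] FG] .
        finally have "AE x in lborel. ?F x - ?G x = 0" by (subst (asm) nn_integral_0_iff_AE) auto
        then show ?thesis using W(2)
        proof eventually_elim
          case (elim x)
          show ?case
          proof (intro impI, rule ccontr)
            assume d: "dist x x0 < r" and "w x \<noteq> 0"
            then have "W x * (ennreal (A\<^sup>2) * time_energy chi \<tau> g \<phi> x) < W x * time_energy chi \<sigma> f \<phi> x"
              using less[OF d] elim(2)[symmetric] by (intro ennreal_mult_strict_left_mono) auto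
            then show False using ennreal_minus_eq_0[OF elim(1)] by (simp add: mult.left_commute)
          qed
        qed
      qed
      obtain D :: "(real^'n) set" where D: "countable D" "\<And>X. open X \<Longrightarrow> X \<noteq> {} \<Longrightarrow> \<exists>d\<in>D. d \<in> X"
        using countable_dense_setE by blast
      have "AE x in lborel. \<forall>x0\<in>D. dist x x0 < r \<longrightarrow> w x = 0"
        unfolding AE_ball_countable[OF D(1)] using null by blast
      then have "AE x in lborel. w x = 0"
      proof eventually_elim
        case (elim x)
        obtain x0 where "x0 \<in> D" "x0 \<in> ball x r" using D(2)[of "ball x r"] r(1) by auto
        then show ?case using elim by (auto simp: dist_commute)
      qed
      then have "AE x in lebesgue. w x = 0" by (rule AE_completion)
      moreover have "{x \<in> space lebesgue. w x \<noteq> 0} \<in> sets lebesgue" using w by measurable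
      ultimately have "emeasure lebesgue {x \<in> space lebesgue. w x \<noteq> 0} = 0"
        using AE_iff_measurable[of "{x \<in> space lebesgue. w x \<noteq> 0}" lebesgue "\<lambda>x. w x = 0"] by simp
      then show False using hyp by simp
    qed
  qed
qed

end
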